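(* Let $K$ be an algebraically closed field complete with respect to a nontrivial non-Archimedean absolute value, with residue field $k$, and let $\varphi\in K(z)$ have degree $d\geq 2$. The following are equivalent. (i) For every $n\geq1$ the minimal resultant iteration formula \[ R_{[\varphi^n]} = \frac{d^n(d^n-1)}{d(d-1)}\, R_{[\varphi]} \] holds. (ii) For every $\gamma\in\mathrm{PGL}_2(K)$ such that $\varphi^\gamma$ has semistable reduction, we have $(\varphi^\gamma)_v\notin I(d)$, and $(\varphi^\gamma)^n$ has semistable reduction for all $n\geq1$.
   Context: Let $\mathcal{O}$ be the valuation ring of $K$ and $\mathfrak{m}$ its maximal ideal, so $k=\mathcal{O}/\mathfrak{m}$. Let $q_v=e$ if $\mathrm{char}(k)=0$ and $q_v=\mathrm{char}(k)$ otherwise, and normalize $|\cdot|$ so that $\mathrm{ord}(x):=-\log_{q_v}|x|$. A homogeneous lift of a rational map $\psi$ of degree $D$ is a pair $(F,G)$ of coprime degree-$D$ forms in $K[X,Y]$ with $\psi(z)=F(z,1)/G(z,1)$. It is normalized if the maximal absolute value of its coefficients is $1$. We set $R_\psi:=\mathrm{ord}\,\mathrm{Res}(F,G)$ for a normalized lift. For $\gamma\in\mathrm{PGL}_2(K)$ we write $\psi^\gamma=\gamma^{-1}\circ\psi\circ\gamma$, and the minimal resultant is $R_{[\psi]}:=\min_{\gamma\in\mathrm{PGL}_2(K)}R_{\psi^\gamma}$. The reduction $\psi_v\in\mathbb{P}^{2D+1}(k)$ is the point given by the coefficients of a normalized lift reduced modulo $\mathfrak{m}$. It is a pair of degree-$D$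 forms over $k$, possibly with a common factor. $\psi$ has semistable reduction if $\psi_v$ lies in the GIT-semistable locus of $\mathbb{P}^{2D+1}_k$ for the conjugation action of $\mathrm{SL}_2$ (with respect to $\mathcal{O}(1)$). Equivalently, some $\mathrm{SL}_2$-invariant homogeneous form of positive degree in the coefficients does not vanish at $\psi_v$. $I(d)\subseteq\mathbb{P}^{2d+1}(k)$ is the set of pairs $[\tilde F:\tilde G]$ satisfying the following. Write $\tilde A=\gcd(\tilde F,\tilde G)$ and $\tilde F=\tilde A\tilde F_0$, $\tilde G=\tilde A\tilde G_0$. Then $[\tilde F_0:\tilde G_0]$ is a constant map whose value $c\in\mathbb{P}^1(k)$ is a root of $\tilde A$. This is the indeterminacy locus of the iteration maps $\mathbb{P}^{2d+1}\dashrightarrow\mathbb{P}^{2d^n+1}$. *)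

theory Defs
  imports "HOL-Computational_Algebra.Polynomial" "Jordan_Normal_Form.Determinant"
begin

definition nonarch_complete_algclosed :: "('a::field \<Rightarrow> real) \<Rightarrow> bool" where
  "nonarch_complete_algclosed absv \<longleftrightarrow>
     (\<forall>x. absv x \<ge> 0) \<and> (\<forall>x. absv x = 0 \<longleftrightarrow> x = 0) \<and>
     (\<forall>x y. absv (x * y) = absv x * absv y) \<and>
     (\<forall>x y. absv (x + y) \<le> max (absv x) (absv y)) \<and>
     (\<exists>x. absv x \<noteq> 0 \<and> absv x \<noteq> 1) \<and>
     (\<forall>s :: nat \<Rightarrow> 'a. (\<forall>e>0. \<exists>N. \<forall>m\<ge>N. \<forall>n\<ge>N. absv (s m - s n) < e) \<longrightarrow>
          (\<exists>L. \<forall>e>0. \<exists>N. \<forall>n\<ge>N. absv (s n - L) < e)) \<and>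
     (\<forall>p :: 'a poly. degree p \<ge> 1 \<longrightarrow> (\<exists>x. poly p x = 0))"

text \<open>A model of the residue field k = O/m: a surjective ring map red from the valuation
ring O = {x. absv x \<le> 1} onto the field 'k whose kernel is m = {x. absv x < 1}.\<close>

definition residue_map :: "('a::field \<Rightarrow> real) \<Rightarrow> ('a \<Rightarrow> 'k::field) \<Rightarrow> bool" where
  "residue_map absv red \<longleftrightarrow>
     (\<forall>x y. absv x \<le> 1 \<longrightarrow> absv y \<le> 1 \<longrightarrow> red (x + y) = red x + red y \<and> red (x * y) = red x * red y) \<and>
     red 1 = 1 \<and>
     (\<forall>x. absv x \<le> 1 \<longrightarrow> (red x = 0 \<longleftrightarrow> absv x < 1)) \<and>
     red ` {x. absv x \<le> 1} = UNIV"

text \<open>q_v = e if char k = 0 and q_v = char k otherwise; char k is the least p > 0 with p*1 in m.\<close>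

definition qv :: "('a::field \<Rightarrow> real) \<Rightarrow> real" where
  "qv absv = (if \<exists>p::nat. p > 0 \<and> absv (of_nat p) < 1
              then real (LEAST p::nat. p > 0 \<and> absv (of_nat p) < 1) else exp 1)"

definition ord :: "('a::field \<Rightarrow> real) \<Rightarrow> 'a \<Rightarrow> real" where
  "ord absv x = - log (qv absv) (absv x)"

text \<open>A binary form of degree D over a ring is represented by a polynomial p with
degree p \<le> D: it stands for sum_{i\<le>D} coeff p i * X^i * Y^(D-i).\<close>

definition bform_eval :: "nat \<Rightarrow> 'a::comm_ring_1 poly \<Rightarrow> 'a \<Rightarrow> 'a \<Rightarrow> 'a" where
  "bform_eval D p x y = (\<Sum>i\<le>D. coeff p i * x ^ i * y ^ (D - i))"

definition bform_subst :: "nat \<Rightarrow> 'a::comm_ring_1 poly \<Rightarrow> 'a poly \<Rightarrow> 'a poly \<Rightarrow> 'a poly" where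
  "bform_subst D p A B = (\<Sum>i\<le>D. smult (coeff p i) (A ^ i * B ^ (D - i)))"

definition bform_coprime :: "nat \<Rightarrow> 'a::field poly \<Rightarrow> 'a poly \<Rightarrow> bool" where
  "bform_coprime D F G \<longleftrightarrow>
     \<not> (\<exists>e H Q1 Q2. 1 \<le> e \<and> e \<le> D \<and> H \<noteq> 0 \<and> degree H \<le> e \<and>
          degree Q1 \<le> D - e \<and> degree Q2 \<le> D - e \<and> F = H * Q1 \<and> G = H * Q2)"

definition bform_res :: "nat \<Rightarrow> 'a::comm_ring_1 poly \<Rightarrow> 'a poly \<Rightarrow> 'a" where
  "bform_res D F G = det (mat (2 * D) (2 * D) (\<lambda>(i, j).
      if i < D then (if i \<le> j \<and> j \<le> i + D then coeff F (D - (j - i)) else 0)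
      else (if i - D \<le> j \<and> j \<le> i - D + D then coeff G (D - (j - (i - D))) else 0)))"

text \<open>Matrices (a,b,c,d) act by z \<mapsto> (a z + b)/(c z + d).\<close>
definition pgl2 :: "('a::field \<times> 'a \<times> 'a \<times> 'a) set" where
  "pgl2 = {(a, b, c, d). a * d - b * c \<noteq> 0}"

definition sl2 :: "('a::field \<times> 'a \<times> 'a \<times> 'a) set" where
  "sl2 = {(a, b, c, d). a * d - b * c = 1}"

text \<open>Lift of psi^gamma = gamma^{-1} o psi o gamma, from a lift (F,G) of psi.\<close>
definition conj_lift :: "nat \<Rightarrow> 'a::comm_ring_1 \<times> 'a \<times> 'a \<times> 'a \<Rightarrow> 'a poly \<times> 'a poly \<Rightarrow> 'a poly \<times> 'a poly" where
  "conj_lift D g FG = (case g of (a, b, c, d) \<Rightarrow> case FG of (F, G) \<Rightarrow>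
     (let F' = bform_subst D F [:b, a:] [:d, c:]; G' = bform_subst D G [:b, a:] [:d, c:]
      in (smult d F' - smult b G', smult a G' - smult c F')))"

fun iter_lift :: "nat \<Rightarrow> 'a::comm_ring_1 poly \<times> 'a poly \<Rightarrow> nat \<Rightarrow> 'a poly \<times> 'a poly" where
  "iter_lift D FG 0 = ([:0, 1:], 1)"
| "iter_lift D FG (Suc n) = (case iter_lift D FG n of (A, B) \<Rightarrow>
      (bform_subst D (fst FG) A B, bform_subst D (snd FG) A B))"

definition coeff_set :: "nat \<Rightarrow> 'a::zero poly \<times> 'a poly \<Rightarrow> 'a set" where
  "coeff_set D FG = {coeff (fst FG) i | i. i \<le> D} \<union> {coeff (snd FG) i | i. i \<le> D}"

definition normalize_lift :: "('a::field \<Rightarrow> real) \<Rightarrow> nat \<Rightarrow> 'a poly \<times> 'a poly \<Rightarrow> 'a poly \<times> 'a poly" where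
  "normalize_lift absv D FG =
     (let c = (SOME c. c \<in> coeff_set D FG \<and> absv c = Max (absv ` coeff_set D FG))
      in (smult (inverse c) (fst FG), smult (inverse c) (snd FG)))"

definition Rlift :: "('a::field \<Rightarrow> real) \<Rightarrow> nat \<Rightarrow> 'a poly \<times> 'a poly \<Rightarrow> real" where
  "Rlift absv D FG = (case normalize_lift absv D FG of (F, G) \<Rightarrow> ord absv (bform_res D F G))"

definition minres :: "('a::field \<Rightarrow> real) \<Rightarrow> nat \<Rightarrow> 'a poly \<times> 'a poly \<Rightarrow> real" where
  "minres absv D FG = (INF g\<in>pgl2. Rlift absv D (conj_lift D g FG))"

definition red_pair :: "('a::field \<Rightarrow> real) \<Rightarrow> ('a \<Rightarrow> 'k::field) \<Rightarrow> nat \<Rightarrow> 'a poly \<times> 'a poly \<Rightarrow> 'k poly \<times> 'k poly" where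
  "red_pair absv red D FG = (case normalize_lift absv D FG of (F, G) \<Rightarrow> (map_poly red F, map_poly red G))"

definition coords :: "nat \<Rightarrow> 'a::zero poly \<times> 'a poly \<Rightarrow> nat \<Rightarrow> 'a" where
  "coords D FG i = (if i \<le> D then coeff (fst FG) i else coeff (snd FG) (i - D - 1))"

definition mp_eval :: "nat \<Rightarrow> (nat \<Rightarrow> nat) set \<Rightarrow> ((nat \<Rightarrow> nat) \<Rightarrow> 'a::comm_ring_1) \<Rightarrow> (nat \<Rightarrow> 'a) \<Rightarrow> 'a" where
  "mp_eval N S c x = (\<Sum>\<alpha>\<in>S. c \<alpha> * (\<Prod>i<N. x i ^ \<alpha> i))"

definition semistable :: "nat \<Rightarrow> 'k::field poly \<times> 'k poly \<Rightarrow> bool" where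
  "semistable D FG \<longleftrightarrow>
     (\<exists>m::nat. \<exists>S c. m > 0 \<and> finite S \<and>
        (\<forall>\<alpha>\<in>S. (\<forall>i\<ge>2 * D + 2. \<alpha> i = 0) \<and> (\<Sum>i<2 * D + 2. \<alpha> i) = m) \<and>
        (\<forall>g\<in>sl2. \<forall>F G. degree F \<le> D \<longrightarrow> degree G \<le> D \<longrightarrow>
            mp_eval (2 * D + 2) S c (coords D (conj_lift D g (F, G)))
              = mp_eval (2 * D + 2) S c (coords D (F, G))) \<and>
        mp_eval (2 * D + 2) S c (coords D FG) \<noteq> 0)"

definition semistable_red :: "('a::field \<Rightarrow> real) \<Rightarrow> ('a \<Rightarrow> 'k::field) \<Rightarrow> nat \<Rightarrow> 'a poly \<times> 'a poly \<Rightarrow> bool" where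
  "semistable_red absv red D FG \<longleftrightarrow> semistable D (red_pair absv red D FG)"

text \<open>The indeterminacy locus I(D): gcd A with [F0:G0] a constant map [a:b] and A(a,b)=0.\<close>
definition in_I :: "nat \<Rightarrow> 'k::field poly \<times> 'k poly \<Rightarrow> bool" where
  "in_I D FG \<longleftrightarrow> (\<exists>A a b. degree A \<le> D \<and> (a, b) \<noteq> (0, 0) \<and>
      fst FG = smult a A \<and> snd FG = smult b A \<and> bform_eval D A a b = 0)"

end

theory Submission
  imports Defs
begin

text \<open>Up to a constant, the resultant of a conjugate is 2D times the logarithm of the maximal coefficient of the conjugated
  lift, taken over SL2. So a conjugate has minimal resultant iff no SL2(K)-conjugate of its normalized lift has all
  coefficients in the maximal ideal, which by the Cartan decomposition means that no one-parameter subgroup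
  destabilises the reduction. Over the algebraically closed residue field this is equivalent to semistability
  (Hilbert--Mumford). For the hard direction, a valuative argument produces a polynomial without constant term
  that is 1 on the orbit; its part of weight 0 is a function on G/T, i.e. a bihomogeneous form on pairs
  of vectors, and the determinant of its coefficient matrix is an invariant. On the given point the form is a power of the
  bracket [xy], whose matrix is regular when the exponent is p^r - 1.

  The minimum is attained, because the maximal coefficient is controlled by sup norms on discs centred at finitely many points.
  Finally Res(Phi^n) is a power of Res(Phi), and for a normalized lift Phi the iterate Phi^n is
  integral, with norm 1 for all n iff the reduction lies outside I(d).\<close>

section \<open>Substitution in binary forms\<close>

text \<open>The equivalence is a squeeze. If h makes the conjugate of phi minimal, then R_[phi^n]
  \<le> R of the n-th iterate of phi^h \<le> C_n R(phi^h) = C_n R_[phi], with C_n the constant of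
  the formula. The first inequality is an equality iff that iterate is semistable, the second iff
  the normalized lift keeps norm 1 under iteration; so (i) splits into the two clauses of (ii). A
  failure of the second shows already at n = 2. Three obstacles shape the rest. The value group is
  dense and K need not be spherically complete, so discs might shrink without a limit and a minimal
  conjugate has to be found by hand. The residue field may have positive characteristic, where SL2
  is not linearly reductive and no averaging yields invariants; a determinant takes its place, and
  it is nonzero only if no binomial coefficient (n choose i) vanishes in k, whence the exponent p^r
  - 1. Finally, the valuative argument compares only finitely many elements, so finitely many
  adjunctions in the style of Chevalley replace a full valuation ring.\<close>

lemma smult_sum_right: "smult c (\<Sum>i\<in>S. f i) = (\<Sum>i\<in>S. smult c (f i))"
  by (induction S rule: infinite_finite_induct) (simp_all add: smult_add_right)

lemma bform_subst_add: "bform_subst n (p + q) P Q = bform_subst n p P Q + bform_subst n q P Q"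
  by (simp add: bform_subst_def smult_add_left sum.distrib)

lemma bform_subst_diff: "bform_subst n (p - q) P Q = bform_subst n p P Q - bform_subst n q P Q"
  by (simp add: bform_subst_def smult_diff_left sum_subtractf)

lemma bform_subst_smult: "bform_subst n (smult c p) P Q = smult c (bform_subst n p P Q)"
  by (simp add: bform_subst_def smult_sum_right)

lemma bform_subst_0 [simp]: "bform_subst n 0 P Q = 0"
  by (simp add: bform_subst_def)

lemma bform_subst_sum: "bform_subst n (\<Sum>i\<in>S. f i) P Q = (\<Sum>i\<in>S. bform_subst n (f i) P Q)"
  by (induction S rule: infinite_finite_induct) (simp_all add: bform_subst_add)

lemma bform_subst_monom:
  assumes "i \<le> n"
  shows "bform_subst n (monom a i) P Q = smult a (P ^ i * Q ^ (n - i))"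
proof -
  have "bform_subst n (monom a i) P Q =
      (\<Sum>j\<le>n. if j = i then smult a (P ^ j * Q ^ (n - j)) else 0)"
    unfolding bform_subst_def by (rule sum.cong) auto
  then show ?thesis using assms by simp
qed

text \<open>Forms carry a formal degree that may exceed the degree of the polynomial, the difference
  being a power of Y. Substitution is multiplicative only if formal degrees are added, hence the
  degree bounds carried along everywhere.\<close>

lemma bform_subst_mult:
  fixes p q P Q :: "'a::comm_ring_1 poly"
  assumes p: "degree p \<le> m" and q: "degree q \<le> n"
  shows "bform_subst (m + n) (p * q) P Q = bform_subst m p P Q * bform_subst n q P Q"
proof -
  have "p * q = (\<Sum>i\<le>m. monom (coeff p i) i) * (\<Sum>j\<le>n. monom (coeff q j) j)"
    using poly_as_sum_of_monoms'[OF p] poly_as_sum_of_monoms'[OF q] by simp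
  also have "\<dots> = (\<Sum>i\<le>m. \<Sum>j\<le>n. monom (coeff p i * coeff q j) (i + j))"
    by (simp add: sum_product mult_monom)
  finally have "bform_subst (m + n) (p * q) P Q =
      (\<Sum>i\<le>m. \<Sum>j\<le>n. bform_subst (m + n) (monom (coeff p i * coeff q j) (i + j)) P Q)"
    by (simp add: bform_subst_sum)
  also have "\<dots> = (\<Sum>i\<le>m. \<Sum>j\<le>n. smult (coeff p i) (P ^ i * Q ^ (m - i)) * smult (coeff q j) (P ^ j * Q ^ (n - j)))"
  proof (intro sum.cong refl)
    fix i j assume "i \<in> {..m}" "j \<in> {..n}"
    then have ij: "i \<le> m" "j \<le> n" by auto
    then have "Q ^ (m + n - (i + j)) = Q ^ (m - i) * Q ^ (n - j)" by (simp flip: power_add)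
    then show "bform_subst (m + n) (monom (coeff p i * coeff q j) (i + j)) P Q =
        smult (coeff p i) (P ^ i * Q ^ (m - i)) * smult (coeff q j) (P ^ j * Q ^ (n - j))"
      using ij by (simp add: bform_subst_monom power_add mult_ac)
  qed
  finally show ?thesis by (simp add: bform_subst_def sum_product)
qed

lemma bform_subst_0_const: "bform_subst 0 p P Q = [:coeff p 0:]"
  by (simp add: bform_subst_def)

lemma bform_subst_power:
  fixes A P Q :: "'a::comm_ring_1 poly"
  assumes "degree A \<le> m"
  shows "bform_subst (i * m) (A ^ i) P Q = bform_subst m A P Q ^ i"
proof (induction i)
  case 0
  then show ?case by (simp add: bform_subst_0_const one_pCons)
next
  case (Suc i)
  have "degree (A ^ i) \<le> i * m"
    using degree_power_le[of A i] assms by (metis le_trans mult.commute mult_le_mono2)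
  from bform_subst_mult[OF assms this] Suc show ?case by simp
qed

lemma bform_subst_prod:
  fixes A :: "nat \<Rightarrow> 'a::comm_ring_1 poly"
  assumes "\<And>i. i < n \<Longrightarrow> degree (A i) \<le> m"
  shows "bform_subst (n * m) (\<Prod>i<n. A i) P Q = (\<Prod>i<n. bform_subst m (A i) P Q)"
  using assms
proof (induction n)
  case 0
  then show ?case by (simp add: bform_subst_0_const one_pCons)
next
  case (Suc n)
  have "degree (\<Prod>i<n. A i) \<le> (\<Sum>i<n. degree (A i))"
    by (rule degree_prod_sum_le[unfolded comp_def]) simp
  also have "\<dots> \<le> n * m"
    using sum_bounded_above[of "{..<n}" "\<lambda>i. degree (A i)" m] Suc.prems by simp
  finally have "degree (\<Prod>i<n. A i) \<le> n * m" .
  from bform_subst_mult[OF this, of "A n" m] Suc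
  show ?case by (simp add: add.commute)
qed

lemma degree_bform_subst:
  fixes A B :: "'a::comm_ring_1 poly"
  assumes "degree A \<le> m" "degree B \<le> m"
  shows "degree (bform_subst D F A B) \<le> D * m"
  unfolding bform_subst_def
proof (rule degree_sum_le)
  fix i assume "i \<in> {..D}"
  then have i: "i \<le> D" by simp
  have "degree (smult (coeff F i) (A ^ i * B ^ (D - i))) \<le> degree (A ^ i * B ^ (D - i))"
    by (rule degree_smult_le)
  also have "\<dots> \<le> degree (A ^ i) + degree (B ^ (D - i))" by (rule degree_mult_le)
  also have "\<dots> \<le> m * i + m * (D - i)"
    using degree_power_le[of A i] degree_power_le[of B "D - i"] assms
    by (meson add_mono le_trans mult_le_mono1)
  also have "\<dots> = D * m" using i by (simp add: algebra_simps flip: distrib_left)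
  finally show "degree (smult (coeff F i) (A ^ i * B ^ (D - i))) \<le> D * m" .
qed simp

lemma bform_subst_subst:
  fixes A B P Q :: "'a::comm_ring_1 poly"
  assumes A: "degree A \<le> m" and B: "degree B \<le> m"
  shows "bform_subst (D * m) (bform_subst D F A B) P Q =
         bform_subst D F (bform_subst m A P Q) (bform_subst m B P Q)"
proof -
  have "bform_subst (D * m) (A ^ i * B ^ (D - i)) P Q =
      bform_subst m A P Q ^ i * bform_subst m B P Q ^ (D - i)" if "i \<le> D" for i
  proof -
    have "degree (A ^ i) \<le> i * m" "degree (B ^ (D - i)) \<le> (D - i) * m"
      using degree_power_le[of A i] degree_power_le[of B "D - i"] A B
      by (metis le_trans mult.commute mult_le_mono2)+
    from bform_subst_mult[OF this, of P Q] have
      "bform_subst (i * m + (D - i) * m) (A ^ i * B ^ (D - i)) P Q =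
        bform_subst m A P Q ^ i * bform_subst m B P Q ^ (D - i)"
      by (simp add: bform_subst_power A B)
    moreover have "i * m + (D - i) * m = D * m"
      using that by (simp flip: distrib_right)
    ultimately show ?thesis by simp
  qed
  then show ?thesis
    unfolding bform_subst_def[of D]
    by (simp add: bform_subst_sum bform_subst_smult)
qed

lemma bform_subst_linear: "bform_subst (Suc 0) [:b, a:] P Q = smult b Q + smult a P"
  by (simp add: bform_subst_def)

text \<open>Evaluation is substitution of constants, so every substitution law yields an evaluation
  law.\<close>

lemma bform_subst_const: "bform_subst D p [:x:] [:y:] = [:bform_eval D p x y:]"
  by (simp add: bform_subst_def bform_eval_def poly_const_pow mult_ac sum_to_poly)

lemma bform_eval_mult:
  assumes "degree p \<le> m" "degree q \<le> n"
  shows "bform_eval (m + n) (p * q) x y = bform_eval m p x y * bform_eval n q x y"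
  using bform_subst_mult[OF assms, of "[:x:]" "[:y:]"] by (simp add: bform_subst_const)

lemma bform_eval_subst:
  assumes "degree A \<le> m" "degree B \<le> m"
  shows "bform_eval (D * m) (bform_subst D F A B) x y =
         bform_eval D F (bform_eval m A x y) (bform_eval m B x y)"
  using bform_subst_subst[OF assms, of D F "[:x:]" "[:y:]"] by (simp add: bform_subst_const)

lemma bform_eval_prod:
  assumes "\<And>i. i < n \<Longrightarrow> degree (A i) \<le> m"
  shows "bform_eval (n * m) (\<Prod>i<n. A i) x y = (\<Prod>i<n. bform_eval m (A i) x y)"
proof -
  have "(\<Prod>i<n. [:f i:]) = [:\<Prod>i<n. f i:]" for f :: "nat \<Rightarrow> 'a"
    by (induction n) (simp_all add: one_pCons mult_ac)
  then show ?thesis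
    using bform_subst_prod[of n A m "[:x:]" "[:y:]"] assms
    by (simp add: bform_subst_const)
qed

lemma bform_eval_smult: "bform_eval D (smult c p) x y = c * bform_eval D p x y"
  by (simp add: bform_eval_def sum_distrib_left mult_ac)

lemma bform_eval_add: "bform_eval D (p + q) x y = bform_eval D p x y + bform_eval D q x y"
  by (simp add: bform_eval_def sum.distrib algebra_simps)

lemma bform_eval_linear: "bform_eval (Suc 0) [:b, a:] x y = b * y + a * x"
  by (simp add: bform_eval_def)

lemma bform_eval_1:
  assumes "degree p \<le> D"
  shows "bform_eval D p x 1 = poly p x"
proof -
  have "bform_eval D p x 1 = (\<Sum>i\<le>D. coeff p i * x ^ i)" by (simp add: bform_eval_def)
  also have "\<dots> = (\<Sum>i\<le>degree p. coeff p i * x ^ i)"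
    using assms by (intro sum.mono_neutral_right) (auto simp: coeff_eq_0)
  finally show ?thesis by (simp add: poly_altdef)
qed

lemma bform_eval_scale: "bform_eval D p (c * x) (c * y) = c ^ D * bform_eval D p x y"
  unfolding bform_eval_def sum_distrib_left
proof (rule sum.cong)
  fix i assume "i \<in> {..D}"
  then have "c ^ D = c ^ i * c ^ (D - i)" by (simp flip: power_add)
  then show "coeff p i * (c * x) ^ i * (c * y) ^ (D - i) = c ^ D * (coeff p i * x ^ i * y ^ (D - i))"
    by (simp add: power_mult_distrib mult_ac)
qed simp

text \<open>On a pair of constant direction [a:b] every form collapses to its value at (a, b). This
  is the computation behind the indeterminacy locus I(d).\<close>

lemma bform_subst_proportional:
  "bform_subst D p (smult a H) (smult b H) = smult (bform_eval D p a b) (H ^ D)"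
  unfolding bform_subst_def bform_eval_def smult_sum
proof (rule sum.cong)
  fix i assume "i \<in> {..D}"
  then have "H ^ D = H ^ i * H ^ (D - i)" by (simp flip: power_add)
  then show "smult (coeff p i) (smult a H ^ i * smult b H ^ (D - i)) =
      smult (coeff p i * a ^ i * b ^ (D - i)) (H ^ D)"
    by (simp add: smult_power mult_ac)
qed simp

lemma bform_subst_scale:
  "bform_subst D p (smult c A) (smult c B) = smult (c ^ D) (bform_subst D p A B)"
  unfolding bform_subst_def smult_sum_right
proof (rule sum.cong)
  fix i assume "i \<in> {..D}"
  then have "c ^ D = c ^ i * c ^ (D - i)" by (simp flip: power_add)
  then show "smult (coeff p i) (smult c A ^ i * smult c B ^ (D - i)) =
      smult (c ^ D) (smult (coeff p i) (A ^ i * B ^ (D - i)))"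
    by (simp add: smult_power mult_ac)
qed simp

lemma bform_subst_id:
  assumes "degree p \<le> D"
  shows "bform_subst D p [:0, 1:] [:1:] = p"
proof -
  have "bform_subst D p [:0, 1:] [:1:] = (\<Sum>i\<le>D. monom (coeff p i) i)"
    by (simp add: bform_subst_def monom_altdef flip: one_pCons)
  then show ?thesis using poly_as_sum_of_monoms'[OF assms] by simp
qed

lemma coeff_bform_subst_diag:
  assumes "k \<le> D"
  shows "coeff (bform_subst D p [:0, t:] [:s:]) k = t ^ k * s ^ (D - k) * coeff p k"
proof -
  have "[:0, t:] ^ i * [:s:] ^ (D - i) = monom (t ^ i * s ^ (D - i)) i" for i
  proof -
    have "[:0, t:] = smult t [:0, 1:]" by simp
    then show ?thesis by (simp only: smult_power poly_const_pow) (simp add: monom_altdef mult_ac)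
  qed
  then have "coeff (bform_subst D p [:0, t:] [:s:]) k =
      (\<Sum>i\<le>D. if i = k then t ^ i * s ^ (D - i) * coeff p i else 0)"
    unfolding bform_subst_def coeff_sum by (intro sum.cong) (auto simp: mult_ac)
  then show ?thesis using assms by simp
qed

section \<open>Conjugation\<close>

fun mmult :: "'a::comm_ring_1 \<times> 'a \<times> 'a \<times> 'a \<Rightarrow> 'a \<times> 'a \<times> 'a \<times> 'a \<Rightarrow> 'a \<times> 'a \<times> 'a \<times> 'a" where
  "mmult (a, b, c, d) (a', b', c', d') = (a * a' + b * c', a * b' + b * d', c * a' + d * c', c * b' + d * d')"

lemma mmult_assoc: "mmult (mmult g h) k = mmult g (mmult h k)"
  by (cases g; cases h; cases k) (simp add: algebra_simps)

lemma mmult_in_sl2: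
  assumes "g \<in> sl2" "h \<in> sl2"
  shows "mmult g h \<in> sl2"
proof -
  obtain a b c d where g: "g = (a, b, c, d)" by (cases g)
  obtain a' b' c' d' where h: "h = (a', b', c', d')" by (cases h)
  have "(a * a' + b * c') * (c * b' + d * d') - (a * b' + b * d') * (c * a' + d * c') =
      (a * d - b * c) * (a' * d' - b' * c')" by (simp add: algebra_simps)
  then show ?thesis using assms by (simp add: g h sl2_def)
qed

text \<open>The adjugate: the inverse in determinant 1, with the same entries up to sign and order,
  so it stays inside any subring that contains them.\<close>

fun adj2 :: "'a::comm_ring_1 \<times> 'a \<times> 'a \<times> 'a \<Rightarrow> 'a \<times> 'a \<times> 'a \<times> 'a" where
  "adj2 (a, b, c, d) = (d, - b, - c, a)"

lemma adj2_in_sl2: "g \<in> sl2 \<Longrightarrow> adj2 g \<in> sl2"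
  by (cases g) (simp add: sl2_def algebra_simps)

lemma mmult_adj2:
  assumes "g \<in> sl2"
  shows "mmult g (adj2 g) = (1, 0, 0, 1)" "mmult (adj2 g) g = (1, 0, 0, 1)"
  using assms by (cases g; simp add: sl2_def algebra_simps)+

lemma degree_conj_lift:
  "degree (fst (conj_lift D g FG)) \<le> D" "degree (snd (conj_lift D g FG)) \<le> D"
proof -
  have *: "degree (bform_subst D p [:b, a:] [:d, c:]) \<le> D" for p :: "'a poly" and a b c d
    using degree_bform_subst[of "[:b, a:]" 1 "[:d, c:]" D p] by simp
  show "degree (fst (conj_lift D g FG)) \<le> D" "degree (snd (conj_lift D g FG)) \<le> D"
    by (cases g; cases FG;
        auto simp: conj_lift_def Let_def intro!: degree_diff_le order_trans[OF degree_smult_le] *)+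
qed

lemma conj_lift_mmult: "conj_lift D h (conj_lift D g FG) = conj_lift D (mmult g h) FG"
proof -
  obtain a b c d where g: "g = (a, b, c, d)" by (cases g)
  obtain a' b' c' d' where h: "h = (a', b', c', d')" by (cases h)
  obtain F G where FG: "FG = (F, G)" by (cases FG)
  have *: "bform_subst D (bform_subst D p [:b, a:] [:d, c:]) [:b', a':] [:d', c':] =
      bform_subst D p [:a * b' + b * d', a * a' + b * c':] [:c * b' + d * d', c * a' + d * c':]" for p
    using bform_subst_subst[of "[:b, a:]" 1 "[:d, c:]" D p "[:b', a':]" "[:d', c':]"]
    by (simp add: bform_subst_linear algebra_simps)
  show ?thesis
    by (simp add: g h FG conj_lift_def Let_def bform_subst_diff bform_subst_smult *
        smult_diff_right smult_add_left algebra_simps)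
qed

lemma conj_lift_1:
  assumes "degree F \<le> D" "degree G \<le> D"
  shows "conj_lift D (1, 0, 0, 1) (F, G) = (F, G)"
  using assms by (simp add: conj_lift_def bform_subst_id)

text \<open>\<open>xdeg\<close> and \<open>ydeg\<close> are the exponents of t and s by which
  conjugation with diag(t, s) scales coordinate i. The inverse on the left adds a factor s to the
  coefficients of F and a factor t to those of G, so the two exponents always sum to D + 1.\<close>

definition xdeg :: "nat \<Rightarrow> nat \<Rightarrow> nat" where
  "xdeg D i = (if i \<le> D then i else i - D)"

definition ydeg :: "nat \<Rightarrow> nat \<Rightarrow> nat" where
  "ydeg D i = D + 1 - xdeg D i"

lemma coords_conj_diag:
  assumes "i < 2 * D + 2"
  shows "coords D (conj_lift D (t, 0, 0, s) FG) i = t ^ xdeg D i * s ^ ydeg D i * coords D FG i"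
proof -
  obtain F G where FG: "FG = (F, G)" by (cases FG)
  have 2: "t ^ (i - D) = t * t ^ (i - D - 1)" "D + 1 - (i - D) = D - (i - D - 1)" if "\<not> i \<le> D"
  proof -
    have "i - D = Suc (i - D - 1)" using that by simp
    then show "t ^ (i - D) = t * t ^ (i - D - 1)" by (metis power_Suc)
    show "D + 1 - (i - D) = D - (i - D - 1)" using that by simp
  qed
  show ?thesis
  proof (cases "i \<le> D")
    case True
    then show ?thesis
      by (simp add: FG coords_def conj_lift_def xdeg_def ydeg_def coeff_bform_subst_diag
          Suc_diff_le mult_ac)
  next
    case False
    then have "i - D - 1 \<le> D" using assms by simp
    then show ?thesis using False
      by (simp add: FG coords_def conj_lift_def xdeg_def ydeg_def coeff_bform_subst_diag 2 del: diff_Suc_1 diff_diff_left)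
  qed
qed

lemma coords_eqD:
  assumes "\<And>i. i < 2 * D + 2 \<Longrightarrow> coords D (F, G) i = coords D (F', G') i"
    and "degree F \<le> D" "degree G \<le> D" "degree F' \<le> D" "degree G' \<le> D"
  shows "F = F'" "G = G'"
proof -
  show "F = F'"
  proof (rule poly_eqI)
    fix n show "coeff F n = coeff F' n"
      using assms(1)[of n] assms(2,4) by (cases "n \<le> D") (auto simp: coords_def coeff_eq_0)
  qed
  show "G = G'"
  proof (rule poly_eqI)
    fix n show "coeff G n = coeff G' n"
      using assms(1)[of "n + D + 1"] assms(3,5) by (cases "n \<le> D") (auto simp: coords_def coeff_eq_0)
  qed
qed

section \<open>Resultants of binary forms\<close>

text \<open>A matrix is viewed as a list of N polynomials whose coefficients, from the top down, are
  its rows. Row operations on Sylvester matrices then become polynomial identities.\<close>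

definition coeff_mat :: "nat \<Rightarrow> (nat \<Rightarrow> 'a::comm_ring_1 poly) \<Rightarrow> 'a mat" where
  "coeff_mat N q = mat N N (\<lambda>(i, j). coeff (q i) (N - 1 - j))"

lemma coeff_mat_carrier [simp]: "coeff_mat N q \<in> carrier_mat N N"
  by (simp add: coeff_mat_def)

lemma sum_coeff_mat:
  assumes "i < N" "degree (q i) < N"
  shows "(\<Sum>j<N. smult (coeff_mat N q $$ (i, j)) (monom 1 (N - 1 - j))) = q i"
proof -
  have "(\<Sum>j<N. smult (coeff_mat N q $$ (i, j)) (monom 1 (N - 1 - j))) =
      (\<Sum>j<N. monom (coeff (q i) (N - Suc j)) (N - Suc j))"
    using assms by (intro sum.cong) (auto simp: coeff_mat_def smult_monom)
  also have "\<dots> = (\<Sum>j<N. monom (coeff (q i) j) j)"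
    by (rule sum.nat_diff_reindex)
  also have "\<dots> = (\<Sum>j\<le>N - 1. monom (coeff (q i) j) j)"
    using assms by (intro sum.cong) auto
  also have "\<dots> = q i"
    using assms by (intro poly_as_sum_of_monoms') simp
  finally show ?thesis .
qed

lemma det_coeff_mat_comp:
  assumes C: "C \<in> carrier_mat N N"
    and q: "\<And>i. i < N \<Longrightarrow> q i = (\<Sum>j<N. smult (C $$ (i, j)) (p j))"
  shows "det (coeff_mat N q) = det C * det (coeff_mat N p)"
proof -
  have "coeff_mat N q = C * coeff_mat N p"
  proof (rule eq_matI)
    fix i j assume "i < dim_row (C * coeff_mat N p)" "j < dim_col (C * coeff_mat N p)"
    then have ij: "i < N" "j < N" using C by (auto simp: coeff_mat_def)
    have "(C * coeff_mat N p) $$ (i, j) = (\<Sum>k<N. C $$ (i, k) * coeff (p k) (N - 1 - j))"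
      using C ij by (simp add: scalar_prod_def coeff_mat_def lessThan_atLeast0)
    then show "coeff_mat N q $$ (i, j) = (C * coeff_mat N p) $$ (i, j)"
      using ij by (simp add: coeff_mat_def q coeff_sum)
  qed (use C in \<open>auto simp: coeff_mat_def\<close>)
  then show ?thesis using C by (simp add: det_mult[of _ N])
qed

lemma det_coeff_mat_block:
  fixes p q :: "nat \<Rightarrow> 'a::idom poly"
  assumes A: "A \<in> carrier_mat m m" and B: "B \<in> carrier_mat n n"
    and q1: "\<And>i. i < m \<Longrightarrow> q i = (\<Sum>j<m. smult (A $$ (i, j)) (p j))"
    and q2: "\<And>i. i < n \<Longrightarrow> q (m + i) = (\<Sum>j<n. smult (B $$ (i, j)) (p (m + j)))"
  shows "det (coeff_mat (m + n) q) = det A * det B * det (coeff_mat (m + n) p)"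
proof -
  define C where "C = four_block_mat A (0\<^sub>m m n) (0\<^sub>m n m) B"
  have C: "C \<in> carrier_mat (m + n) (m + n)" using A B by (simp add: C_def)
  have "det C = det A * det B"
    unfolding C_def using A B by (intro det_four_block_mat_upper_right_zero) auto
  moreover have "det (coeff_mat (m + n) q) = det C * det (coeff_mat (m + n) p)"
  proof (rule det_coeff_mat_comp[OF C])
    fix i assume i: "i < m + n"
    have split: "(\<Sum>j<m + n. f j) = (\<Sum>j<m. f j) + (\<Sum>j<n. f (m + j))" for f :: "nat \<Rightarrow> 'a poly"
      using sum.atLeastLessThan_concat[of 0 m "m + n" f] sum.shift_bounds_nat_ivl[of f 0 m n]
      by (simp add: lessThan_atLeast0 add.commute)
    show "q i = (\<Sum>j<m + n. smult (C $$ (i, j)) (p j))"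
    proof (cases "i < m")
      case True
      have "(\<Sum>j<m. smult (C $$ (i, j)) (p j)) = (\<Sum>j<m. smult (A $$ (i, j)) (p j))"
        using True A B by (intro sum.cong) (auto simp: C_def)
      moreover have "(\<Sum>j<n. smult (C $$ (i, m + j)) (p (m + j))) = 0"
        using True A B by (intro sum.neutral) (auto simp: C_def)
      ultimately show ?thesis using True by (simp add: split q1)
    next
      case False
      then obtain k where k: "i = m + k" "k < n" using i by (metis add_less_cancel_left le_Suc_ex not_less)
      have "(\<Sum>j<m. smult (C $$ (i, j)) (p j)) = 0"
        using k A B by (intro sum.neutral) (auto simp: C_def)
      moreover have "(\<Sum>j<n. smult (C $$ (i, m + j)) (p (m + j))) = (\<Sum>j<n. smult (B $$ (k, j)) (p (m + j)))"
        using k A B by (intro sum.cong) (auto simp: C_def)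
      ultimately show ?thesis using k by (simp add: split q2)
    qed
  qed
  ultimately show ?thesis by simp
qed

text \<open>The Sylvester determinant of one linear form and P, hence the value of P at the zero
  (-l0, l1) of that form. The first column has entries only in its first and last row; one minor is
  the same matrix one size smaller, the other is triangular with diagonal l0.\<close>

lemma det_coeff_mat_linear:
  fixes P :: "'a::idom poly"
  shows "det (coeff_mat (Suc N) (\<lambda>i. if i < N then monom 1 (N - 1 - i) * [:l0, l1:] else P)) =
    bform_eval N P (- l0) l1"
proof (induction N)
  case 0
  show ?case by (simp add: coeff_mat_def bform_eval_def det_single)
next
  case (Suc N)
  let ?A = "coeff_mat (Suc (Suc N)) (\<lambda>i. if i < Suc N then monom 1 (Suc N - 1 - i) * [:l0, l1:] else P)"
  have A: "?A \<in> carrier_mat (Suc (Suc N)) (Suc (Suc N))" by simp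
  have ent: "?A $$ (i, j) = (if i < Suc N then if j = i then l1 else if j = Suc i then l0 else 0 else coeff P (Suc N - j))"
    if "i < Suc (Suc N)" "j < Suc (Suc N)" for i j
  proof (cases "i < Suc N")
    case True
    have e: "?A $$ (i, j) = (if Suc N - j < N - i then 0 else coeff [:l0, l1:] (Suc N - j - (N - i)))"
      using True that by (simp add: coeff_mat_def coeff_monom_mult del: mult_pCons_right coeff_pCons_Suc)
    consider "j < i" | "j = i" | "j = Suc i" | "Suc i < j" by linarith
    then show ?thesis
    proof cases
      case 1
      then have "Suc N - j - (N - i) \<ge> 2" using True by simp
      then have "coeff [:l0, l1:] (Suc N - j - (N - i)) = 0" by (intro coeff_eq_0) auto
      then show ?thesis unfolding e using 1 True by simp
    next
      case 2
      then have "Suc N - j - (N - i) = Suc 0" using True by simp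
      then show ?thesis unfolding e using 2 True by simp
    next
      case 3
      then have "Suc N - j - (N - i) = 0" by simp
      then show ?thesis unfolding e using 3 True by simp
    next
      case 4
      then have "Suc N - j < N - i" using that by simp
      then show ?thesis unfolding e using 4 True by simp
    qed
  next
    case False then show ?thesis using that by (simp add: coeff_mat_def)
  qed
  have "det ?A = (\<Sum>i<Suc (Suc N). ?A $$ (i, 0) * cofactor ?A i 0)"
    by (rule laplace_expansion_column[OF A]) simp
  also have "\<dots> = ?A $$ (0, 0) * cofactor ?A 0 0 + ?A $$ (Suc N, 0) * cofactor ?A (Suc N) 0"
  proof -
    have "(\<Sum>i<Suc (Suc N). ?A $$ (i, 0) * cofactor ?A i 0) =
        (\<Sum>i\<in>{0, Suc N}. ?A $$ (i, 0) * cofactor ?A i 0)"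
      by (rule sum.mono_neutral_right) (auto simp: ent)
    then show ?thesis by simp
  qed
  also have "mat_delete ?A 0 0 = coeff_mat (Suc N) (\<lambda>i. if i < N then monom 1 (N - 1 - i) * [:l0, l1:] else P)"
  proof (rule eq_matI)
    fix i j assume "i < dim_row (coeff_mat (Suc N) (\<lambda>i. if i < N then monom 1 (N - 1 - i) * [:l0, l1:] else P))"
      and "j < dim_col (coeff_mat (Suc N) (\<lambda>i. if i < N then monom 1 (N - 1 - i) * [:l0, l1:] else P))"
    then have ij: "i < Suc N" "j < Suc N" by (auto simp: coeff_mat_def)
    have "mat_delete ?A 0 0 $$ (i, j) = ?A $$ (Suc i, Suc j)"
      using ij mat_delete_index[OF A, of 0 0 i j] by (simp add: insert_index_def)
    also have "\<dots> = coeff_mat (Suc N) (\<lambda>i. if i < N then monom 1 (N - 1 - i) * [:l0, l1:] else P) $$ (i, j)"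
      using ij by (simp add: coeff_mat_def)
    finally show "mat_delete ?A 0 0 $$ (i, j) = coeff_mat (Suc N) (\<lambda>i. if i < N then monom 1 (N - 1 - i) * [:l0, l1:] else P) $$ (i, j)" .
  qed (simp_all add: mat_delete_def coeff_mat_def)
  then have "cofactor ?A 0 0 = bform_eval N P (- l0) l1" by (simp add: cofactor_def Suc.IH)
  also have "cofactor ?A (Suc N) 0 = (- 1) ^ Suc N * l0 ^ Suc N"
  proof -
    let ?B = "mat_delete ?A (Suc N) 0"
    have B: "?B \<in> carrier_mat (Suc N) (Suc N)" by (simp add: mat_delete_def coeff_mat_def)
    have entB: "?B $$ (i, j) = (if j = i then l0 else if Suc j = i then l1 else 0)"
      if "i < Suc N" "j < Suc N" for i j
      using that mat_delete_index[OF A, of "Suc N" 0 i j] by (auto simp: insert_index_def ent)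
    have "det ?B = prod_list (diag_mat ?B)"
      by (rule det_lower_triangular[OF _ B]) (use entB in auto)
    also have "diag_mat ?B = map (\<lambda>i. l0) [0..<Suc N]"
      using B entB unfolding diag_mat_def by (intro map_cong) auto
    also have "prod_list \<dots> = l0 ^ Suc N" by (simp add: map_replicate_const prod_list_replicate)
    finally show ?thesis by (simp add: cofactor_def)
  qed
  finally have "det ?A = l1 * bform_eval N P (- l0) l1 + coeff P (Suc N) * ((- 1) ^ Suc N * l0 ^ Suc N)"
    by (simp add: ent)
  also have "\<dots> = bform_eval (Suc N) P (- l0) l1"
  proof -
    have "l1 * bform_eval N P (- l0) l1 = (\<Sum>i\<le>N. coeff P i * (- l0) ^ i * l1 ^ (Suc N - i))"
      unfolding bform_eval_def sum_distrib_left by (intro sum.cong) (auto simp: Suc_diff_le)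
    then show ?thesis
      unfolding bform_eval_def[of "Suc N"] sum.atMost_Suc power_minus[of l0 "Suc N"] by simp
  qed
  finally show ?case .
qed

definition sylvester_row :: "nat \<Rightarrow> nat \<Rightarrow> 'a::comm_ring_1 poly \<Rightarrow> 'a poly \<Rightarrow> nat \<Rightarrow> 'a poly" where
  "sylvester_row m n F G i = (if i < n then monom 1 (n - 1 - i) * F else monom 1 (m - 1 - (i - n)) * G)"

text \<open>Two separate formal degrees are allowed because linear factors are split off F one at a
  time while the degree of G stays fixed.\<close>

definition bires :: "nat \<Rightarrow> nat \<Rightarrow> 'a::comm_ring_1 poly \<Rightarrow> 'a poly \<Rightarrow> 'a" where
  "bires m n F G = det (coeff_mat (n + m) (sylvester_row m n F G))"

lemma bform_res_eq_bires:
  assumes "degree F \<le> D" "degree G \<le> D"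
  shows "bform_res D F G = bires D D F G"
proof -
  have row: "coeff (monom 1 (D - Suc i) * H) (2 * D - Suc j) =
      (if i \<le> j \<and> j \<le> i + D then coeff H (D - (j - i)) else 0)"
    if "degree H \<le> D" "i < D" "j < 2 * D" for i j and H :: "'a poly"
  proof (cases "i \<le> j")
    case True
    then have "2 * D - Suc j - (D - Suc i) = D - (j - i)" if "j \<le> i + D" using that \<open>i < D\<close> by simp
    then show ?thesis using that True by (auto simp: coeff_monom_mult)
  next
    case False
    then have "degree H < 2 * D - Suc j - (D - Suc i)" using that by linarith
    then show ?thesis using False by (auto simp: coeff_monom_mult coeff_eq_0)
  qed
  have "coeff_mat (D + D) (sylvester_row D D F G) = mat (2 * D) (2 * D) (\<lambda>(i, j).
      if i < D then (if i \<le> j \<and> j \<le> i + D then coeff F (D - (j - i)) else 0)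
      else (if i - D \<le> j \<and> j \<le> i - D + D then coeff G (D - (j - (i - D))) else 0))"
    (is "_ = ?M")
  proof (rule eq_matI)
    fix i j assume "i < dim_row ?M" "j < dim_col ?M"
    then have ij: "i < 2 * D" "j < 2 * D" by auto
    then show "coeff_mat (D + D) (sylvester_row D D F G) $$ (i, j) = ?M $$ (i, j)"
      using row[OF assms(1), of i j] row[OF assms(2), of "i - D" j]
      by (cases "i < D") (simp_all add: coeff_mat_def sylvester_row_def flip: mult_2)
  qed (simp_all add: coeff_mat_def)
  then show ?thesis by (simp add: bform_res_def bires_def)
qed

text \<open>The determinant of one list q of polynomials is computed in two ways. Write l for the
  linear form. Relative to the Sylvester rows of (l F, G), the rows of q arise from the shifts of l
  and one form c, which costs c at the zero of l. Relative to the shifts of l followed by c G, they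
  arise from the Sylvester matrix of (F, G), which costs c G at that zero. The value of c
  cancels.\<close>

lemma bires_linear_factor:
  fixes F G :: "'a::idom poly"
  assumes F: "degree F \<le> m" and G: "degree G \<le> n" and l: "(l0, l1) \<noteq> (0, 0)"
  shows "bires (Suc m) n ([:l0, l1:] * F) G = bform_eval n G (- l0) l1 * bires m n F G"
proof -
  \<comment> \<open>A form of degree m that does not vanish at the zero (-l0, l1): Y^m if l1 is
    nonzero, X^m otherwise.\<close>
  define c :: "'a poly" where "c = (if l1 \<noteq> 0 then 1 else monom 1 m)"
  have deg_c: "degree c \<le> m" by (auto simp: c_def degree_monom_eq)
  have "bform_eval m 1 (- l0) l1 = l1 ^ m"
  proof -
    have "bform_eval m 1 (- l0) l1 = (\<Sum>i\<le>m. if i = 0 then l1 ^ m else 0)"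
      unfolding bform_eval_def by (intro sum.cong) auto
    then show ?thesis by simp
  qed
  moreover have "bform_eval m (monom 1 m) (- l0) l1 = (- l0) ^ m"
  proof -
    have "bform_eval m (monom 1 m) (- l0) l1 = (\<Sum>i\<le>m. if i = m then (- l0) ^ m else 0)"
      unfolding bform_eval_def by (intro sum.cong) auto
    then show ?thesis by simp
  qed
  ultimately have c0: "bform_eval m c (- l0) l1 \<noteq> 0" using l by (auto simp: c_def)
  define q where "q = (\<lambda>i. if i < n then monom 1 (n - 1 - i) * ([:l0, l1:] * F)
      else if i < n + m then monom 1 (m - 1 - (i - n)) * [:l0, l1:] * G else c * G)"
  define E where "E = (\<lambda>i. if i < m then monom 1 (m - 1 - i) * [:l0, l1:] else c)"
  have degE: "degree (E i) < Suc m" if "i < Suc m" for i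
  proof (cases "i < m")
    case True
    have "degree (monom 1 (m - 1 - i) * [:l0, l1:]) \<le> (m - 1 - i) + 1"
      by (intro order_trans[OF degree_mult_le] add_mono degree_monom_le) auto
    then show ?thesis using True by (simp add: E_def)
  qed (use deg_c in \<open>simp add: E_def\<close>)
  have "det (coeff_mat (n + Suc m) q) =
      det (1\<^sub>m n) * det (coeff_mat (Suc m) E) * det (coeff_mat (n + Suc m) (sylvester_row (Suc m) n ([:l0, l1:] * F) G))"
  proof (rule det_coeff_mat_block)
    fix i assume i: "i < n"
    have "(\<Sum>j<n. smult (1\<^sub>m n $$ (i, j)) (sylvester_row (Suc m) n ([:l0, l1:] * F) G j)) =
        (\<Sum>j<n. if j = i then sylvester_row (Suc m) n ([:l0, l1:] * F) G j else 0)"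
      using i by (intro sum.cong) auto
    then show "q i = (\<Sum>j<n. smult (1\<^sub>m n $$ (i, j)) (sylvester_row (Suc m) n ([:l0, l1:] * F) G j))"
      using i by (simp add: q_def sylvester_row_def)
  next
    fix i assume i: "i < Suc m"
    have "(\<Sum>j<Suc m. smult (coeff_mat (Suc m) E $$ (i, j)) (sylvester_row (Suc m) n ([:l0, l1:] * F) G (n + j))) =
        (\<Sum>j<Suc m. smult (coeff_mat (Suc m) E $$ (i, j)) (monom 1 (Suc m - 1 - j))) * G"
      unfolding sum_distrib_right by (intro sum.cong) (auto simp: sylvester_row_def)
    also have "\<dots> = E i * G" using i degE by (subst sum_coeff_mat) auto
    also have "\<dots> = q (n + i)" using i by (auto simp: E_def q_def)
    finally show "q (n + i) = (\<Sum>j<Suc m. smult (coeff_mat (Suc m) E $$ (i, j)) (sylvester_row (Suc m) n ([:l0, l1:] * F) G (n + j)))"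
      by simp
  qed simp_all
  moreover have "det (coeff_mat (Suc m) E) = bform_eval m c (- l0) l1"
    unfolding E_def by (rule det_coeff_mat_linear)
  ultimately have 1: "det (coeff_mat (n + Suc m) q) =
      bform_eval m c (- l0) l1 * bires (Suc m) n ([:l0, l1:] * F) G"
    by (simp add: bires_def)
  define p where "p = (\<lambda>i. if i < n + m then monom 1 (n + m - 1 - i) * [:l0, l1:] else c * G)"
  have degs: "degree (sylvester_row m n F G i) < n + m" if "i < n + m" for i
  proof (cases "i < n")
    case True
    have "degree (monom 1 (n - 1 - i) * F) \<le> (n - 1 - i) + m"
      by (intro order_trans[OF degree_mult_le] add_mono degree_monom_le F)
    then show ?thesis using True by (simp add: sylvester_row_def)
  next
    case False
    have "degree (monom 1 (m - 1 - (i - n)) * G) \<le> (m - 1 - (i - n)) + n"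
      by (intro order_trans[OF degree_mult_le] add_mono degree_monom_le G)
    then show ?thesis using False that by (simp add: sylvester_row_def)
  qed
  have "det (coeff_mat ((n + m) + 1) q) =
      det (coeff_mat (n + m) (sylvester_row m n F G)) * det (1\<^sub>m 1) * det (coeff_mat ((n + m) + 1) p)"
  proof (rule det_coeff_mat_block)
    fix i assume i: "i < n + m"
    have "(\<Sum>j<n + m. smult (coeff_mat (n + m) (sylvester_row m n F G) $$ (i, j)) (p j)) =
      (\<Sum>j<n + m. smult (coeff_mat (n + m) (sylvester_row m n F G) $$ (i, j)) (monom 1 (n + m - 1 - j))) * [:l0, l1:]"
      unfolding sum_distrib_right by (intro sum.cong) (auto simp: p_def simp del: mult_pCons_right)
    also have "\<dots> = sylvester_row m n F G i * [:l0, l1:]" using i degs by (subst sum_coeff_mat) auto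
    also have "\<dots> = q i" using i
      by (simp add: q_def sylvester_row_def mult_ac del: mult_pCons_right mult_pCons_left)
    finally show "q i = (\<Sum>j<n + m. smult (coeff_mat (n + m) (sylvester_row m n F G) $$ (i, j)) (p j))" by simp
  next
    fix i :: nat assume "i < 1"
    then show "q ((n + m) + i) = (\<Sum>j<1. smult (1\<^sub>m 1 $$ (i, j)) (p ((n + m) + j)))"
      by (simp add: q_def p_def)
  qed simp_all
  moreover have "det (coeff_mat ((n + m) + 1) p) = bform_eval (n + m) (c * G) (- l0) l1"
    using det_coeff_mat_linear[of "n + m" l0 l1 "c * G"] by (simp add: p_def)
  ultimately have 2: "det (coeff_mat (n + Suc m) q) =
      bform_eval m c (- l0) l1 * (bform_eval n G (- l0) l1 * bires m n F G)"
    using bform_eval_mult[OF deg_c G, of "- l0" l1] by (simp add: bires_def add.commute mult_ac)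
  from 1 2 c0 show ?thesis by simp
qed

lemma bires_const: "bires 0 n [:c:] G = c ^ n"
proof -
  have "coeff_mat n (sylvester_row 0 n [:c:] G) = c \<cdot>\<^sub>m 1\<^sub>m n"
    by (rule eq_matI) (auto simp: coeff_mat_def sylvester_row_def)
  then show ?thesis by (simp add: bires_def)
qed

text \<open>Algebraic closedness as a property of a type: for K it is among the hypotheses, for the
  residue field it has to be proved.\<close>

definition roots_exist :: "'a::field itself \<Rightarrow> bool" where
  "roots_exist _ \<longleftrightarrow> (\<forall>p :: 'a poly. degree p \<ge> 1 \<longrightarrow> (\<exists>x. poly p x = 0))"

lemma bform_factorization:
  fixes F :: "'a::field poly"
  assumes ac: "roots_exist TYPE('a)" and "degree F \<le> D"
  obtains c l0 l1 where "F = smult c (\<Prod>i<D. [:l0 i, l1 i:])" "\<And>i. (l0 i, l1 i) \<noteq> (0::'a, 0::'a)"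
proof -
  have "\<exists>c l0 l1. F = smult c (\<Prod>i<D. [:l0 i, l1 i:]) \<and> (\<forall>i. (l0 i, l1 i) \<noteq> (0::'a, 0::'a))"
    using assms(2)
  proof (induction D arbitrary: F)
    case 0
    then obtain c where "F = [:c:]" by (auto elim: degree_eq_zeroE)
    then show ?case by (intro exI[of _ c] exI[of _ "\<lambda>_. 1"]) simp
  next
    case (Suc D)
    have "\<exists>a b F'. (a, b) \<noteq> (0, 0) \<and> F = [:a, b:] * F' \<and> degree F' \<le> D"
    proof (cases "degree F \<le> D")
      case True
      \<comment> \<open>A drop in degree is a zero at infinity: the factor is Y, represented by the
        constant polynomial 1.\<close>
      then show ?thesis by (intro exI[of _ 1] exI[of _ 0] exI[of _ F]) simp
    next
      case False
      then obtain x where "poly F x = 0" using ac unfolding roots_exist_def by (metis One_nat_def le_SucE le_numeral_extra(4) not_less_eq_eq Suc.prems le0 le_trans not_less_eq_eq)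
      then obtain F' where F': "F = [:- x, 1:] * F'" by (auto simp: poly_eq_0_iff_dvd dvd_def)
      have "F' \<noteq> 0" using False F' by auto
      then have "degree F = 1 + degree F'" unfolding F' by (subst degree_mult_eq) auto
      then show ?thesis using Suc.prems F' by (intro exI[of _ "- x"] exI[of _ 1] exI[of _ F']) simp
    qed
    then obtain a b F' where *: "(a, b) \<noteq> (0, 0)" "F = [:a, b:] * F'" "degree F' \<le> D" by blast
    from Suc.IH[OF *(3)] obtain c l0 l1 where
      **: "F' = smult c (\<Prod>i<D. [:l0 i, l1 i:])" "\<forall>i. (l0 i, l1 i) \<noteq> (0::'a, 0::'a)" by blast
    show ?case
      by (rule exI[of _ c], rule exI[of _ "l0(D := a)"], rule exI[of _ "l1(D := b)"])
        (use * ** in \<open>auto simp: mult_ac\<close>)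
  qed
  then obtain c l0 l1 where *: "F = smult c (\<Prod>i<D. [:l0 i, l1 i:])" "\<forall>i. (l0 i, l1 i) \<noteq> (0::'a, 0::'a)"
    by blast
  then show ?thesis using that by blast
qed

lemma degree_prod_linear: "degree (\<Prod>i<D. [:l0 i, l1 i:]) \<le> D"
proof -
  have "degree (\<Prod>i<D. [:l0 i, l1 i:]) \<le> (\<Sum>i<D. degree [:l0 i, l1 i:])"
    by (rule degree_prod_sum_le[unfolded comp_def]) simp
  also have "\<dots> \<le> (\<Sum>i<D. 1)" by (rule sum_mono) simp
  finally show ?thesis by simp
qed

text \<open>Poisson's product formula, by splitting off one linear factor at a time. The composition
  formula and the criteria for vanishing are read off from it.\<close>

theorem bires_poisson:
  fixes G :: "'a::idom poly"
  assumes "degree G \<le> n" "\<And>i. i < m \<Longrightarrow> (l0 i, l1 i) \<noteq> (0, 0)"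
  shows "bires m n (smult c (\<Prod>i<m. [:l0 i, l1 i:])) G = c ^ n * (\<Prod>i<m. bform_eval n G (- l0 i) (l1 i))"
  using assms(2)
proof (induction m)
  case 0
  then show ?case by (simp add: bires_const)
next
  case (Suc m)
  have "degree (smult c (\<Prod>i<m. [:l0 i, l1 i:])) \<le> m"
    using degree_smult_le degree_prod_linear order_trans by blast
  from bires_linear_factor[OF this assms(1), of "l0 m" "l1 m"] Suc
  show ?case by (simp add: mult_ac)
qed

lemma bires_smult_left:
  fixes F G :: "'a::field poly"
  assumes ac: "roots_exist TYPE('a)" and F: "degree F \<le> m" and G: "degree G \<le> n"
  shows "bires m n (smult c F) G = c ^ n * bires m n F G"
proof -
  obtain c' l0 l1 where *: "F = smult c' (\<Prod>i<m. [:l0 i, l1 i:])" "\<And>i. (l0 i, l1 i) \<noteq> (0::'a, 0::'a)"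
    by (rule bform_factorization[OF ac F]) blast
  then have "smult c F = smult (c * c') (\<Prod>i<m. [:l0 i, l1 i:])" by simp
  with * bires_poisson[OF G, of m l0 l1] show ?thesis by (simp add: power_mult_distrib)
qed

lemma bires_mult_left:
  fixes F1 F2 G :: "'a::field poly"
  assumes ac: "roots_exist TYPE('a)" and F1: "degree F1 \<le> m1" and F2: "degree F2 \<le> m2" and G: "degree G \<le> n"
  shows "bires (m1 + m2) n (F1 * F2) G = bires m1 n F1 G * bires m2 n F2 G"
proof -
  obtain c l0 l1 where *: "F1 = smult c (\<Prod>i<m1. [:l0 i, l1 i:])" "\<And>i. (l0 i, l1 i) \<noteq> (0::'a, 0::'a)"
    by (rule bform_factorization[OF ac F1]) blast
  have deg: "degree (smult c (\<Prod>i<m. [:l0 i, l1 i:])) \<le> m" for m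
    using degree_smult_le degree_prod_linear order_trans by blast
  have "bires (m + m2) n (smult c (\<Prod>i<m. [:l0 i, l1 i:]) * F2) G =
      bires m n (smult c (\<Prod>i<m. [:l0 i, l1 i:])) G * bires m2 n F2 G" for m
  proof (induction m)
    case 0
    show ?case using bires_smult_left[OF ac F2 G, of c] by (simp add: bires_const)
  next
    case (Suc m)
    let ?H = "smult c (\<Prod>i<m. [:l0 i, l1 i:])"
    have "degree (?H * F2) \<le> m + m2"
      using deg[of m] F2 by (meson add_mono degree_mult_le le_trans)
    from bires_linear_factor[OF this G *(2)[of m]] bires_linear_factor[OF deg[of m] G *(2)[of m]] Suc
    show ?case by (simp add: mult_ac del: mult_pCons_left mult_pCons_right)
  qed
  then show ?thesis using *(1) by simp
qed

lemma bires_prod_left: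
  fixes G :: "'a::field poly"
  assumes ac: "roots_exist TYPE('a)" and M: "\<And>i. i < k \<Longrightarrow> degree (M i) \<le> m" and G: "degree G \<le> n"
  shows "bires (k * m) n (\<Prod>i<k. M i) G = (\<Prod>i<k. bires m n (M i) G)"
  using M
proof (induction k)
  case 0
  then show ?case using bires_const[of n 1 G] by (simp add: one_pCons)
next
  case (Suc k)
  have "degree (\<Prod>i<k. M i) \<le> (\<Sum>i<k. degree (M i))"
    by (rule degree_prod_sum_le[unfolded comp_def]) simp
  also have "\<dots> \<le> k * m"
    using sum_bounded_above[of "{..<k}" "\<lambda>i. degree (M i)" m] Suc.prems by simp
  finally have "degree (\<Prod>i<k. M i) \<le> k * m" .
  from bires_mult_left[OF ac Suc.prems[of k] this G] Suc show ?case by (simp add: mult_ac)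
qed

text \<open>The change of rows is the 2 by 2 matrix tensored with the identity of size E. Its blocks
  are scalar and commute, so its determinant is (ad - bc)^E.\<close>

lemma bires_mix:
  fixes A B :: "'a::idom poly"
  shows "bires E E (smult a A + smult b B) (smult c A + smult d B) = (a * d - b * c) ^ E * bires E E A B"
proof -
  define C where "C = four_block_mat (a \<cdot>\<^sub>m 1\<^sub>m E) (b \<cdot>\<^sub>m 1\<^sub>m E) (c \<cdot>\<^sub>m 1\<^sub>m E) (d \<cdot>\<^sub>m 1\<^sub>m E)"
  have C: "C \<in> carrier_mat (E + E) (E + E)" by (simp add: C_def)
  have "(c \<cdot>\<^sub>m 1\<^sub>m E) * (d \<cdot>\<^sub>m 1\<^sub>m E) = (d \<cdot>\<^sub>m 1\<^sub>m E) * (c \<cdot>\<^sub>m 1\<^sub>m E)"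
    by (rule eq_matI) (simp_all add: mult_smult_assoc_mat[of _ E E _ E] mult_smult_distrib[of _ E E _ E])
  then have "det C = det ((a \<cdot>\<^sub>m 1\<^sub>m E) * (d \<cdot>\<^sub>m 1\<^sub>m E) - (b \<cdot>\<^sub>m 1\<^sub>m E) * (c \<cdot>\<^sub>m 1\<^sub>m E))"
    unfolding C_def by (intro det_four_block_mat) auto
  also have "(a \<cdot>\<^sub>m 1\<^sub>m E) * (d \<cdot>\<^sub>m 1\<^sub>m E) - (b \<cdot>\<^sub>m 1\<^sub>m E) * (c \<cdot>\<^sub>m 1\<^sub>m E) = (a * d - b * c) \<cdot>\<^sub>m 1\<^sub>m E"
    by (rule eq_matI) (auto simp: mult_smult_assoc_mat[of _ E E _ E] mult_smult_distrib[of _ E E _ E])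
  also have "det \<dots> = (a * d - b * c) ^ E" by simp
  finally have detC: "det C = (a * d - b * c) ^ E" .
  have "det (coeff_mat (E + E) (sylvester_row E E (smult a A + smult b B) (smult c A + smult d B))) =
      det C * det (coeff_mat (E + E) (sylvester_row E E A B))"
  proof (rule det_coeff_mat_comp[OF C])
    fix i assume i: "i < E + E"
    define k where "k = (if i < E then i else i - E)"
    have k: "k < E" using i by (auto simp: k_def)
    have "(\<Sum>j<E + E. smult (C $$ (i, j)) (sylvester_row E E A B j)) =
        (\<Sum>j\<in>{k, k + E}. smult (C $$ (i, j)) (sylvester_row E E A B j))"
    proof (rule sum.mono_neutral_right)
      show "\<forall>j\<in>{..<E + E} - {k, k + E}. smult (C $$ (i, j)) (sylvester_row E E A B j) = 0"
        using i by (auto simp: C_def k_def)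
    qed (use k in auto)
    also have "\<dots> = smult (C $$ (i, k)) (sylvester_row E E A B k) + smult (C $$ (i, k + E)) (sylvester_row E E A B (k + E))"
      using k by simp
    also have "\<dots> = sylvester_row E E (smult a A + smult b B) (smult c A + smult d B) i"
      using i k by (auto simp: C_def k_def sylvester_row_def distrib_left)
    finally show "sylvester_row E E (smult a A + smult b B) (smult c A + smult d B) i =
        (\<Sum>j<E + E. smult (C $$ (i, j)) (sylvester_row E E A B j))" by simp
  qed
  then show ?thesis by (simp add: bires_def detC)
qed

lemma bires_smult:
  fixes F G :: "'a::idom poly"
  shows "bires D D (smult c F) (smult c G) = c ^ (2 * D) * bires D D F G"
  using bires_mix[of D c F 0 G 0 c] by (simp add: power_mult power2_eq_square)

text \<open>Factoring F turns F(A, B) into a product of combinations \<open>M i\<close> of A and B.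
  At a zero of \<open>M i\<close> the pair (A, B) is a multiple t of the zero of the i-th linear
  factor of F, so G(A, B) is t^D times a value of G; it remains to identify the product of the
  t's.\<close>

theorem bires_comp:
  fixes F G A B :: "'a::field poly"
  assumes ac: "roots_exist TYPE('a)" and F: "degree F \<le> D" and G: "degree G \<le> D"
    and A: "degree A \<le> E" and B: "degree B \<le> E"
  shows "bires (D * E) (D * E) (bform_subst D F A B) (bform_subst D G A B) =
    bires D D F G ^ E * bires E E A B ^ (D * D)"
proof -
  obtain c l0 l1 where *: "F = smult c (\<Prod>i<D. [:l0 i, l1 i:])" "\<And>i. (l0 i, l1 i) \<noteq> (0::'a, 0::'a)"
    by (rule bform_factorization[OF ac F]) blast
  let ?G = "bform_subst D G A B"
  have degG: "degree ?G \<le> D * E" by (rule degree_bform_subst[OF A B])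
  define M where "M = (\<lambda>i. smult (l1 i) A + smult (l0 i) B)"
  have degM: "degree (M i) \<le> E" for i
    unfolding M_def using A B by (meson degree_add_le degree_smult_le le_trans)
  have FM: "bform_subst D F A B = smult c (\<Prod>i<D. M i)"
    using bform_subst_prod[of D "\<lambda>i. [:l0 i, l1 i:]" 1 A B]
    by (simp add: *(1) bform_subst_smult bform_subst_linear M_def add.commute)
  have degPM: "degree (\<Prod>i<D. M i) \<le> D * E"
  proof -
    have "degree (\<Prod>i<D. M i) \<le> (\<Sum>i<D. degree (M i))"
      by (rule degree_prod_sum_le[unfolded comp_def]) simp
    also have "\<dots> \<le> D * E" using sum_bounded_above[of "{..<D}" "\<lambda>i. degree (M i)" E] degM by simp
    finally show ?thesis .
  qed
  have MG: "bires E (D * E) (M i) ?G = bires E E A B ^ D * bform_eval D G (- l0 i) (l1 i) ^ E" for i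
  proof -
    obtain e m0 m1 where m: "M i = smult e (\<Prod>k<E. [:m0 k, m1 k:])" "\<And>k. (m0 k, m1 k) \<noteq> (0::'a, 0::'a)"
      by (rule bform_factorization[OF ac degM]) blast
    \<comment> \<open>\<open>M i\<close> vanishes at its k-th zero, which says that the values of A
      and B there are proportional to (-l0 i, l1 i).\<close>
    have "\<exists>t. bform_eval E A (- m0 k) (m1 k) = t * (- l0 i) \<and> bform_eval E B (- m0 k) (m1 k) = t * l1 i"
      if "k < E" for k
    proof -
      let ?a = "bform_eval E A (- m0 k) (m1 k)" and ?b = "bform_eval E B (- m0 k) (m1 k)"
      have "bform_eval E (M i) (- m0 k) (m1 k) =
          e * (\<Prod>j<E. bform_eval (Suc 0) [:m0 j, m1 j:] (- m0 k) (m1 k))"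
        using bform_eval_prod[of E "\<lambda>k. [:m0 k, m1 k:]" "Suc 0"]
        by (simp add: m(1) bform_eval_smult)
      also have "(\<Prod>j<E. bform_eval (Suc 0) [:m0 j, m1 j:] (- m0 k) (m1 k)) = 0"
        using that by (intro prod_zero) (auto simp: bform_eval_linear intro!: bexI[of _ k])
      finally have "l1 i * ?a + l0 i * ?b = 0" by (simp add: M_def bform_eval_add bform_eval_smult)
      then have eq: "l0 i * ?b = - (l1 i * ?a)" by (simp add: eq_neg_iff_add_eq_0 add.commute)
      show ?thesis
      proof (cases "l1 i = 0")
        case True
        then show ?thesis using *(2)[of i] eq by (intro exI[of _ "- ?a / l0 i"]) auto
      next
        case False
        then show ?thesis using eq by (intro exI[of _ "?b / l1 i"]) (auto simp: field_simps)
      qed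
    qed
    then obtain t where t: "\<And>k. k < E \<Longrightarrow> bform_eval E A (- m0 k) (m1 k) = t k * (- l0 i)"
      "\<And>k. k < E \<Longrightarrow> bform_eval E B (- m0 k) (m1 k) = t k * l1 i" by metis
    obtain u0 u1 where u: "l1 i * u0 - l0 i * u1 = 1"
    proof (cases "l1 i = 0")
      case True
      then show ?thesis using *(2)[of i] that[of 0 "- 1 / l0 i"] by simp
    next
      case False
      then show ?thesis using that[of "1 / l1 i" 0] by simp
    qed
    let ?N = "smult u1 A + smult u0 B"
    have degN: "degree ?N \<le> E" using A B by (meson degree_add_le degree_smult_le le_trans)
    have "bires E E (M i) ?N = bires E E A B"
      unfolding M_def bires_mix by (simp add: u)
    moreover have "bires E E (M i) ?N = e ^ E * (\<Prod>k<E. bform_eval E ?N (- m0 k) (m1 k))"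
      unfolding m(1) by (rule bires_poisson[OF degN m(2)])
    moreover have "bform_eval E ?N (- m0 k) (m1 k) = t k" if "k < E" for k
    proof -
      have "bform_eval E ?N (- m0 k) (m1 k) = t k * (l1 i * u0 - l0 i * u1)"
        using that by (simp add: bform_eval_add bform_eval_smult t algebra_simps)
      then show ?thesis by (simp add: u)
    qed
    ultimately have res: "bires E E A B = e ^ E * (\<Prod>k<E. t k)" by simp
    have "bires E (D * E) (M i) ?G = e ^ (D * E) * (\<Prod>k<E. bform_eval (D * E) ?G (- m0 k) (m1 k))"
      unfolding m(1) by (rule bires_poisson[OF degG m(2)])
    also have "(\<Prod>k<E. bform_eval (D * E) ?G (- m0 k) (m1 k)) = (\<Prod>k<E. t k ^ D * bform_eval D G (- l0 i) (l1 i))"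
      by (rule prod.cong) (auto simp: bform_eval_subst[OF A B] t bform_eval_scale simp flip: mult_minus_right)
    also have "\<dots> = (\<Prod>k<E. t k) ^ D * bform_eval D G (- l0 i) (l1 i) ^ E"
      by (simp add: prod.distrib prod_power_distrib)
    finally show ?thesis by (simp add: res power_mult_distrib mult_ac flip: power_mult)
  qed
  have "bires (D * E) (D * E) (bform_subst D F A B) ?G = c ^ (D * E) * (\<Prod>i<D. bires E (D * E) (M i) ?G)"
    unfolding FM using bires_smult_left[OF ac degPM degG] bires_prod_left[OF ac degM degG] by simp
  also have "(\<Prod>i<D. bires E (D * E) (M i) ?G) =
      (bires E E A B ^ D) ^ D * (\<Prod>i<D. bform_eval D G (- l0 i) (l1 i)) ^ E"
    by (simp add: MG prod.distrib prod_power_distrib)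
  also have "c ^ (D * E) * \<dots> = bires D D F G ^ E * bires E E A B ^ (D * D)"
    using bires_poisson[OF G, of D l0 l1 c] *
    by (simp add: power_mult_distrib mult_ac flip: power_mult)
  finally show ?thesis .
qed

lemma bires_nz_imp_no_common_zero:
  fixes F G :: "'a::field poly"
  assumes ac: "roots_exist TYPE('a)" and F: "degree F \<le> D" and G: "degree G \<le> D" and D: "D \<ge> 1"
    and nz: "bires D D F G \<noteq> 0" and zF: "bform_eval D F x y = 0" and zG: "bform_eval D G x y = 0"
  shows "x = 0 \<and> y = 0"
proof (rule ccontr)
  assume xy: "\<not> (x = 0 \<and> y = 0)"
  obtain c l0 l1 where *: "F = smult c (\<Prod>i<D. [:l0 i, l1 i:])" "\<And>i. (l0 i, l1 i) \<noteq> (0::'a, 0::'a)"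
    by (rule bform_factorization[OF ac F]) blast
  have res: "bires D D F G = c ^ D * (\<Prod>i<D. bform_eval D G (- l0 i) (l1 i))"
    unfolding *(1) by (rule bires_poisson[OF G *(2)])
  have "c \<noteq> 0" using nz D by (auto simp: res)
  moreover have "bform_eval D F x y = c * (\<Prod>i<D. bform_eval (Suc 0) [:l0 i, l1 i:] x y)"
    using bform_eval_prod[of D "\<lambda>k. [:l0 k, l1 k:]" "Suc 0"] by (simp add: *(1) bform_eval_smult)
  ultimately obtain i where i: "i < D" "l0 i * y + l1 i * x = 0"
    using zF by (auto simp: bform_eval_linear)
  \<comment> \<open>The linear factor of F that vanishes at (x, y) has its zero proportional to (x,
    y), so G vanishes at that zero as well.\<close>
  have "\<exists>t. - l0 i = t * x \<and> l1 i = t * y"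
  proof (cases "x = 0")
    case True
    then show ?thesis using i xy by (intro exI[of _ "l1 i / y"]) auto
  next
    case False
    have "l1 i * x = - (l0 i * y)" using i by (simp add: eq_neg_iff_add_eq_0 add.commute)
    then show ?thesis using False by (intro exI[of _ "- l0 i / x"]) (auto simp: field_simps)
  qed
  then obtain t where "- l0 i = t * x" "l1 i = t * y" by blast
  then have "bform_eval D G (- l0 i) (l1 i) = 0" by (simp add: bform_eval_scale zG)
  then have "bires D D F G = 0" unfolding res using i by (auto intro!: prod_zero)
  with nz show False by simp
qed

lemma bform_eval_zero_imp_factor:
  fixes G :: "'a::field poly"
  assumes G: "degree G \<le> D" and l: "(l0, l1) \<noteq> (0, 0)" and D: "D \<ge> 1"
    and z: "bform_eval D G (- l0) l1 = 0"
  shows "\<exists>Q. degree Q \<le> D - 1 \<and> G = [:l0, l1:] * Q"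
proof (cases "l1 = 0")
  case True
  then have l0: "l0 \<noteq> 0" using l by simp
  have "bform_eval D G (- l0) l1 = (\<Sum>i\<le>D. if i = D then coeff G D * (- l0) ^ D else 0)"
    unfolding bform_eval_def True by (intro sum.cong) auto
  then have "coeff G D = 0" using z l0 by simp
  then have "degree G \<le> D - 1"
    using G D by (metis One_nat_def Suc_pred coeff_0 le_SucE leading_coeff_0_iff degree_0 less_eq_Suc_le zero_le)
  then show ?thesis using l0 True by (intro exI[of _ "smult (1 / l0) G"]) simp
next
  case False
  have "l1 ^ D * poly G (- l0 / l1) = bform_eval D G (l1 * (- l0 / l1)) (l1 * 1)"
    unfolding bform_eval_scale bform_eval_1[OF G] ..
  then have "poly G (- l0 / l1) = 0" using z False by simp
  then obtain Q where Q: "G = [:l0 / l1, 1:] * Q"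
    unfolding poly_eq_0_iff_dvd dvd_def by auto
  have e: "[:l0, l1:] = smult l1 [:l0 / l1, 1:]" using False by simp
  have "degree Q \<le> D - 1"
  proof (cases "Q = 0")
    case False
    then have "degree G = 1 + degree Q" unfolding Q by (subst degree_mult_eq) auto
    then show ?thesis using G by simp
  qed simp
  moreover have "G = [:l0, l1:] * smult (1 / l1) Q"
    unfolding e mult_smult_left mult_smult_right smult_smult using Q False by simp
  ultimately show ?thesis by (intro exI[of _ "smult (1 / l1) Q"]) simp
qed

lemma bform_coprime_imp_bires_nz:
  fixes F G :: "'a::field poly"
  assumes ac: "roots_exist TYPE('a)" and F: "degree F \<le> D" and G: "degree G \<le> D" and D: "D \<ge> 1"
    and cop: "bform_coprime D F G"
  shows "bires D D F G \<noteq> 0"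
proof
  assume z: "bires D D F G = 0"
  have contr: False if "(l0, l1) \<noteq> (0, 0)" "degree Q1 \<le> D - 1" "degree Q2 \<le> D - 1"
    "F = [:l0, l1:] * Q1" "G = [:l0, l1:] * Q2" for l0 l1 Q1 Q2
  proof -
    have "[:l0, l1:] \<noteq> 0" "degree [:l0, l1:] \<le> 1" using that(1) by auto
    then have "\<exists>e H Q1 Q2. 1 \<le> e \<and> e \<le> D \<and> H \<noteq> 0 \<and> degree H \<le> e \<and>
        degree Q1 \<le> D - e \<and> degree Q2 \<le> D - e \<and> F = H * Q1 \<and> G = H * Q2"
      using D that by (intro exI[of _ 1] exI[of _ "[:l0, l1:]"] exI[of _ Q1] exI[of _ Q2]) simp
    then show False using cop unfolding bform_coprime_def by blast
  qed
  obtain c l0 l1 where *: "F = smult c (\<Prod>i<D. [:l0 i, l1 i:])" "\<And>i. (l0 i, l1 i) \<noteq> (0::'a, 0::'a)"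
    by (rule bform_factorization[OF ac F]) blast
  have fac: "\<exists>Q. degree Q \<le> D - 1 \<and> H = [:m0 i, m1 i:] * Q"
    if "H = smult e (\<Prod>i<D. [:m0 i, m1 i:])" "\<And>i. (m0 i, m1 i) \<noteq> (0::'a, 0::'a)" "i < D" for H e m0 m1 i
  proof (rule bform_eval_zero_imp_factor)
    show "degree H \<le> D" using that(1) degree_smult_le degree_prod_linear order_trans by blast
    have "bform_eval D H (- m0 i) (m1 i) = e * (\<Prod>j<D. bform_eval (Suc 0) [:m0 j, m1 j:] (- m0 i) (m1 i))"
      using bform_eval_prod[of D "\<lambda>k. [:m0 k, m1 k:]" "Suc 0"] by (simp add: that(1) bform_eval_smult)
    also have "(\<Prod>j<D. bform_eval (Suc 0) [:m0 j, m1 j:] (- m0 i) (m1 i)) = 0"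
      using that by (intro prod_zero) (auto simp: bform_eval_linear intro!: bexI[of _ i])
    finally show "bform_eval D H (- m0 i) (m1 i) = 0" by simp
  qed (use that D in auto)
  show False
  proof (cases "F = 0")
    case True
    \<comment> \<open>The zero form is divisible by every linear form, so any factor of G is a
      common one.\<close>
    obtain e m0 m1 where m: "G = smult e (\<Prod>i<D. [:m0 i, m1 i:])" "\<And>i. (m0 i, m1 i) \<noteq> (0::'a, 0::'a)"
      by (rule bform_factorization[OF ac G]) blast
    obtain Q where "degree Q \<le> D - 1" "G = [:m0 0, m1 0:] * Q" using fac[OF m, of 0] D by auto
    then show False using contr[OF m(2)[of 0], of 0 Q] True by simp
  next
    case False
    then have "c \<noteq> 0" using * by simp
    moreover have "bires D D F G = c ^ D * (\<Prod>i<D. bform_eval D G (- l0 i) (l1 i))"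
      unfolding *(1) by (rule bires_poisson[OF G *(2)])
    ultimately obtain i where i: "i < D" "bform_eval D G (- l0 i) (l1 i) = 0" using z by auto
    obtain Q1 where "degree Q1 \<le> D - 1" "F = [:l0 i, l1 i:] * Q1" using fac[OF *(1,2) i(1)] by auto
    moreover obtain Q2 where "degree Q2 \<le> D - 1" "G = [:l0 i, l1 i:] * Q2"
      using bform_eval_zero_imp_factor[OF G *(2) D i(2)] by auto
    ultimately show False using contr[OF *(2)[of i]] by blast
  qed
qed

section \<open>Change of coefficients\<close>

definition coeffs_in :: "'a::zero set \<Rightarrow> 'a poly \<Rightarrow> bool" where
  "coeffs_in A p \<longleftrightarrow> (\<forall>i. coeff p i \<in> A)"

abbreviation map_pair :: "('a::zero \<Rightarrow> 'b::zero) \<Rightarrow> 'a poly \<times> 'a poly \<Rightarrow> 'b poly \<times> 'b poly" where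
  "map_pair h \<equiv> map_prod (map_poly h) (map_poly h)"

locale subring =
  fixes A :: "'a::comm_ring_1 set"
  assumes zero_in [simp]: "0 \<in> A" and one_in [simp]: "1 \<in> A"
    and add_in: "x \<in> A \<Longrightarrow> y \<in> A \<Longrightarrow> x + y \<in> A"
    and uminus_in: "x \<in> A \<Longrightarrow> - x \<in> A"
    and mult_in: "x \<in> A \<Longrightarrow> y \<in> A \<Longrightarrow> x * y \<in> A"
begin

lemma diff_in: "x \<in> A \<Longrightarrow> y \<in> A \<Longrightarrow> x - y \<in> A"
  using add_in[of x "- y"] uminus_in[of y] by simp

lemma sum_in: "(\<And>i. i \<in> S \<Longrightarrow> f i \<in> A) \<Longrightarrow> sum f S \<in> A"
  by (induction S rule: infinite_finite_induct) (auto intro: add_in)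

lemma power_in: "x \<in> A \<Longrightarrow> x ^ n \<in> A"
  by (induction n) (auto intro: mult_in)

lemma coeffs_in_0 [simp]: "coeffs_in A 0" by (simp add: coeffs_in_def)

lemma coeffs_in_1 [simp]: "coeffs_in A 1" by (simp add: coeffs_in_def)

lemma coeffs_in_add: "coeffs_in A p \<Longrightarrow> coeffs_in A q \<Longrightarrow> coeffs_in A (p + q)"
  by (simp add: coeffs_in_def add_in)

lemma coeffs_in_smult: "c \<in> A \<Longrightarrow> coeffs_in A p \<Longrightarrow> coeffs_in A (smult c p)"
  by (simp add: coeffs_in_def mult_in)

lemma coeffs_in_mult: "coeffs_in A p \<Longrightarrow> coeffs_in A q \<Longrightarrow> coeffs_in A (p * q)"
  by (auto simp: coeffs_in_def coeff_mult intro!: sum_in mult_in)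

lemma coeffs_in_power: "coeffs_in A p \<Longrightarrow> coeffs_in A (p ^ n)"
  by (induction n) (auto intro: coeffs_in_mult)

lemma coeffs_in_sum: "(\<And>i. i \<in> S \<Longrightarrow> coeffs_in A (f i)) \<Longrightarrow> coeffs_in A (sum f S)"
  by (induction S rule: infinite_finite_induct) (auto intro: coeffs_in_add)

lemma coeffs_in_pCons: "a \<in> A \<Longrightarrow> coeffs_in A p \<Longrightarrow> coeffs_in A (pCons a p)"
  by (auto simp: coeffs_in_def coeff_pCons split: nat.split)

lemma coeffs_in_bform_subst:
  "coeffs_in A F \<Longrightarrow> coeffs_in A P \<Longrightarrow> coeffs_in A Q \<Longrightarrow> coeffs_in A (bform_subst D F P Q)"
  unfolding bform_subst_def
  by (intro coeffs_in_sum coeffs_in_smult coeffs_in_mult coeffs_in_power) (auto simp: coeffs_in_def)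

text \<open>Coordinates of a conjugate are combinations of the old ones with coefficients in A. M
  will be a norm ball over the valuation ring, or an ideal of a ring of functions.\<close>

lemma coords_conj_lift_in_submodule:
  assumes M: "0 \<in> M" "\<And>x y. x \<in> M \<Longrightarrow> y \<in> M \<Longrightarrow> x + y \<in> M" "\<And>x r. x \<in> M \<Longrightarrow> r \<in> A \<Longrightarrow> r * x \<in> M"
    and g: "a \<in> A" "b \<in> A" "c \<in> A" "d \<in> A"
    and FG: "\<And>i. i < 2 * D + 2 \<Longrightarrow> coords D FG i \<in> M"
    and j: "j < 2 * D + 2"
  shows "coords D (conj_lift D (a, b, c, d) FG) j \<in> M"
proof -
  obtain F G where FG': "FG = (F, G)" by (cases FG)
  have M_sum: "(\<And>i. i \<in> S \<Longrightarrow> f i \<in> M) \<Longrightarrow> sum f S \<in> M" for S :: "nat set" and f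
    by (induction S rule: infinite_finite_induct) (auto intro: M)
  have sub: "coeff (bform_subst D H [:b, a:] [:d, c:]) k \<in> M" if "\<And>i. i \<le> D \<Longrightarrow> coeff H i \<in> M" for H k
    unfolding bform_subst_def coeff_sum coeff_smult
  proof (rule M_sum)
    fix i assume "i \<in> {..D}"
    moreover have "coeffs_in A ([:b, a:] ^ i * [:d, c:] ^ (D - i))"
      using g by (intro coeffs_in_mult coeffs_in_power coeffs_in_pCons) auto
    ultimately show "coeff H i * coeff ([:b, a:] ^ i * [:d, c:] ^ (D - i)) k \<in> M"
      using that[of i] M(3) by (simp add: coeffs_in_def mult.commute)
  qed
  have M_diff: "x * u - y * v \<in> M" if "u \<in> M" "v \<in> M" "x \<in> A" "y \<in> A" for x y u v
    using M(2)[OF M(3)[OF that(1,3)] M(3)[OF that(2) uminus_in[OF that(4)]]] by simp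
  have F: "coeff F i \<in> M" if "i \<le> D" for i
    using FG[of i] that by (simp add: FG' coords_def)
  have G: "coeff G i \<in> M" if "i \<le> D" for i
    using FG[of "i + D + 1"] that by (simp add: FG' coords_def)
  show ?thesis
    unfolding FG' coords_def conj_lift_def Let_def prod.case fst_conv snd_conv
    using sub[of F, OF F] sub[of G, OF G] g by (auto intro!: M_diff)
qed

end

text \<open>The map h is total but respects the operations only on A. For reduction A is the
  valuation ring; for embeddings and evaluations it is the whole domain.\<close>

locale subring_hom = subring A for A :: "'a::comm_ring_1 set" +
  fixes h :: "'a \<Rightarrow> 'b::comm_ring_1"
  assumes hom_one [simp]: "h 1 = 1"
    and hom_add: "x \<in> A \<Longrightarrow> y \<in> A \<Longrightarrow> h (x + y) = h x + h y"
    and hom_mult: "x \<in> A \<Longrightarrow> y \<in> A \<Longrightarrow> h (x * y) = h x * h y"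
begin

lemma hom_zero [simp]: "h 0 = 0"
  using hom_add[of 0 0] by simp

lemma hom_uminus: "x \<in> A \<Longrightarrow> h (- x) = - h x"
  using hom_add[of x "- x"] uminus_in[of x] by (simp add: eq_neg_iff_add_eq_0 add.commute)

lemma hom_diff: "x \<in> A \<Longrightarrow> y \<in> A \<Longrightarrow> h (x - y) = h x - h y"
  using hom_add[of x "- y"] uminus_in[of y] hom_uminus[of y] by simp

lemma hom_sum: "(\<And>i. i \<in> S \<Longrightarrow> f i \<in> A) \<Longrightarrow> h (sum f S) = (\<Sum>i\<in>S. h (f i))"
  by (induction S rule: infinite_finite_induct) (auto simp: hom_add sum_in)

lemma hom_power: "x \<in> A \<Longrightarrow> h (x ^ n) = h x ^ n"
  by (induction n) (auto simp: hom_mult power_in)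

lemma coeff_map_poly_hom [simp]: "coeff (map_poly h p) i = h (coeff p i)"
  by (simp add: coeff_map_poly)

lemma map_poly_hom_add: "coeffs_in A p \<Longrightarrow> coeffs_in A q \<Longrightarrow> map_poly h (p + q) = map_poly h p + map_poly h q"
  by (rule poly_eqI) (simp add: coeffs_in_def hom_add)

lemma map_poly_hom_diff: "coeffs_in A p \<Longrightarrow> coeffs_in A q \<Longrightarrow> map_poly h (p - q) = map_poly h p - map_poly h q"
  by (rule poly_eqI) (simp add: coeffs_in_def hom_diff)

lemma map_poly_hom_smult: "c \<in> A \<Longrightarrow> coeffs_in A p \<Longrightarrow> map_poly h (smult c p) = smult (h c) (map_poly h p)"
  by (rule poly_eqI) (simp add: coeffs_in_def hom_mult)

lemma map_poly_hom_mult: "coeffs_in A p \<Longrightarrow> coeffs_in A q \<Longrightarrow> map_poly h (p * q) = map_poly h p * map_poly h q"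
  by (rule poly_eqI) (simp add: coeffs_in_def hom_mult coeff_mult hom_sum mult_in)

lemma map_poly_hom_power: "coeffs_in A p \<Longrightarrow> map_poly h (p ^ n) = map_poly h p ^ n"
  by (induction n) (auto simp: map_poly_hom_mult coeffs_in_power)

lemma map_poly_hom_sum:
  "(\<And>i. i \<in> S \<Longrightarrow> coeffs_in A (f i)) \<Longrightarrow> map_poly h (sum f S) = (\<Sum>i\<in>S. map_poly h (f i))"
  by (induction S rule: infinite_finite_induct) (auto simp: map_poly_hom_add coeffs_in_sum)

lemma map_poly_hom_pCons: "map_poly h (pCons a p) = pCons (h a) (map_poly h p)"
  by (rule poly_eqI) (auto simp: coeff_pCons split: nat.split)

lemma map_poly_hom_bform_subst:
  assumes "coeffs_in A F" "coeffs_in A P" "coeffs_in A Q"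
  shows "map_poly h (bform_subst D F P Q) = bform_subst D (map_poly h F) (map_poly h P) (map_poly h Q)"
proof -
  have F: "coeff F i \<in> A" for i using assms by (simp add: coeffs_in_def)
  show ?thesis unfolding bform_subst_def using assms F
    by (simp add: map_poly_hom_sum coeffs_in_smult coeffs_in_mult coeffs_in_power
        map_poly_hom_smult map_poly_hom_mult map_poly_hom_power)
qed

lemma map_pair_conj_lift:
  assumes "coeffs_in A F" "coeffs_in A G" "a \<in> A" "b \<in> A" "c \<in> A" "d \<in> A"
  shows "map_pair h (conj_lift D (a, b, c, d) (F, G)) =
    conj_lift D (h a, h b, h c, h d) (map_poly h F, map_poly h G)"
  using assms
  by (simp add: conj_lift_def Let_def map_poly_hom_diff map_poly_hom_smult coeffs_in_smult
      coeffs_in_bform_subst coeffs_in_pCons map_poly_hom_bform_subst map_poly_hom_pCons)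

lemma coords_map_pair: "coords D (map_pair h FG) i = h (coords D FG i)"
  by (cases FG) (simp add: coords_def)

lemma hom_poly:
  assumes "coeffs_in A p" "x \<in> A"
  shows "h (poly p x) = poly (map_poly h p) (h x)"
proof -
  have "poly p y \<in> A" if "y \<in> A" for y
    using assms that by (auto simp: poly_altdef coeffs_in_def intro!: sum_in mult_in power_in)
  then show ?thesis using assms
  proof (induction p)
    case (pCons a p)
    have "a \<in> A" "coeffs_in A p"
      using pCons(4) by (force simp: coeffs_in_def coeff_pCons split: nat.splits dest: spec[of _ "Suc _"])+
    moreover have "poly p y \<in> A" if "y \<in> A" for y
      using \<open>coeffs_in A p\<close> that by (auto simp: poly_altdef coeffs_in_def intro!: sum_in mult_in power_in)
    ultimately show ?case using pCons
      by (simp add: map_poly_hom_pCons hom_add hom_mult mult_in)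
  qed simp
qed

lemma coeffs_in_iter_lift:
  assumes "coeffs_in A F" "coeffs_in A G"
  shows "coeffs_in A (fst (iter_lift D (F, G) n)) \<and> coeffs_in A (snd (iter_lift D (F, G) n))"
  by (induction n) (auto simp: assms coeffs_in_pCons coeffs_in_bform_subst split: prod.split)

lemma map_pair_iter_lift:
  assumes "coeffs_in A F" "coeffs_in A G"
  shows "map_pair h (iter_lift D (F, G) n) = iter_lift D (map_poly h F, map_poly h G) n"
proof (induction n)
  case 0
  show ?case by (simp add: map_poly_hom_pCons)
next
  case (Suc n)
  obtain P Q where PQ: "iter_lift D (F, G) n = (P, Q)" by (cases "iter_lift D (F, G) n")
  then have "coeffs_in A P" "coeffs_in A Q" using coeffs_in_iter_lift[OF assms, of D n] by auto
  moreover have "iter_lift D (map_poly h F, map_poly h G) n = (map_poly h P, map_poly h Q)"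
    using Suc PQ by simp
  ultimately show ?case using PQ assms by (simp add: map_poly_hom_bform_subst)
qed

end

lemma subring_UNIV: "subring UNIV" by unfold_locales auto

lemma degree_map_poly_le_bound: "h 0 = 0 \<Longrightarrow> degree p \<le> D \<Longrightarrow> degree (map_poly h p) \<le> D"
  by (rule degree_le) (auto simp: coeff_map_poly coeff_eq_0)

section \<open>The valued field\<close>

text \<open>The Gauss norm of a lift: normalization divides by a coefficient of this absolute
  value.\<close>

definition nrm :: "('a::field \<Rightarrow> real) \<Rightarrow> nat \<Rightarrow> 'a poly \<times> 'a poly \<Rightarrow> real" where
  "nrm absv D FG = Max (absv ` coeff_set D FG)"

lemma coeff_set_eq_coords: "coeff_set D FG = coords D FG ` {..<2 * D + 2}"
proof -
  have "coeff (snd FG) i \<in> coords D FG ` {..<2 * D + 2}" if "i \<le> D" for i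
    using that by (intro image_eqI[of _ _ "i + D + 1"]) (auto simp: coords_def)
  moreover have "coeff (fst FG) i \<in> coords D FG ` {..<2 * D + 2}" if "i \<le> D" for i
    using that by (intro image_eqI[of _ _ i]) (auto simp: coords_def)
  ultimately show ?thesis by (auto simp: coeff_set_def coords_def)
qed

lemma coords_smult: "coords D (smult c F, smult c G) i = c * coords D (F, G) i"
  by (simp add: coords_def)

locale valued_field =
  fixes absv :: "'a::field \<Rightarrow> real" and red :: "'a \<Rightarrow> 'k::field"
  assumes absv_axioms: "nonarch_complete_algclosed absv"
    and res_axioms: "residue_map absv red"
begin

lemma absv_nonneg [simp]: "absv x \<ge> 0"
  and absv_eq_0 [simp]: "absv x = 0 \<longleftrightarrow> x = 0"
  and absv_mult: "absv (x * y) = absv x * absv y"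
  and absv_add: "absv (x + y) \<le> max (absv x) (absv y)"
  and roots_exist: "roots_exist TYPE('a)"
  using absv_axioms unfolding nonarch_complete_algclosed_def roots_exist_def by blast+

lemma absv_0 [simp]: "absv 0 = 0" by simp

lemma absv_pos [simp]: "absv x > 0 \<longleftrightarrow> x \<noteq> 0"
  using absv_nonneg[of x] absv_eq_0[of x] by linarith

lemma absv_1 [simp]: "absv 1 = 1"
  using absv_mult[of 1 1] absv_eq_0[of 1] by simp

lemma absv_minus [simp]: "absv (- x) = absv x"
proof -
  have "absv (- 1) * absv (- 1) = 1" using absv_mult[of "- 1" "- 1"] by simp
  then have "absv (- 1) = 1" using absv_nonneg[of "- 1"]
    by (metis abs_of_nonneg abs_square_eq_1 power2_eq_square)
  then show ?thesis using absv_mult[of "- 1" x] by simp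
qed

lemma absv_power: "absv (x ^ n) = absv x ^ n"
  by (induction n) (auto simp: absv_mult)

lemma absv_inverse: "absv (inverse x) = inverse (absv x)"
proof (cases "x = 0")
  case False
  then have "absv x * absv (inverse x) = 1" by (simp flip: absv_mult)
  then show ?thesis by (simp add: inverse_unique)
qed simp

lemma absv_divide: "absv (x / y) = absv x / absv y"
  by (simp add: divide_inverse absv_mult absv_inverse)

lemma ex_nth_root:
  assumes "n > 0"
  shows "\<exists>y. y ^ n = (x::'a)"
proof -
  have "degree (monom 1 n + [:- x:]) = n"
    using assms by (subst degree_add_eq_left) (auto simp: degree_monom_eq)
  then obtain y where "poly (monom 1 n + [:- x:]) y = 0"
    using roots_exist assms unfolding roots_exist_def by (metis One_nat_def Suc_leI)
  then show ?thesis by (auto simp: poly_monom)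
qed

lemma ex_absv_gt_1: "\<exists>x. absv x > 1"
proof -
  obtain x where x: "absv x \<noteq> 0" "absv x \<noteq> 1"
    using absv_axioms unfolding nonarch_complete_algclosed_def by blast
  show ?thesis
  proof (cases "absv x > 1")
    case False
    with x have "absv x < 1" "absv x > 0" using absv_nonneg[of x] by linarith+
    then have "absv (inverse x) > 1" by (simp add: absv_inverse one_less_inverse)
    then show ?thesis by blast
  qed blast
qed

definition O_v :: "'a set" where "O_v = {x. absv x \<le> 1}"

lemma red_1: "red 1 = 1"
  and red_add: "absv x \<le> 1 \<Longrightarrow> absv y \<le> 1 \<Longrightarrow> red (x + y) = red x + red y"
  and red_mult: "absv x \<le> 1 \<Longrightarrow> absv y \<le> 1 \<Longrightarrow> red (x * y) = red x * red y"
  and red_eq_0_iff: "absv x \<le> 1 \<Longrightarrow> red x = 0 \<longleftrightarrow> absv x < 1"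
  and red_surj: "red ` {x. absv x \<le> 1} = UNIV"
  using res_axioms unfolding residue_map_def by blast+

sublocale red: subring_hom O_v red
proof
  fix x y assume "x \<in> O_v" "y \<in> O_v"
  then have xy: "absv x \<le> 1" "absv y \<le> 1" by (auto simp: O_v_def)
  then show "x + y \<in> O_v" using absv_add[of x y] by (simp add: O_v_def)
  show "x * y \<in> O_v" using xy by (simp add: O_v_def absv_mult mult_le_one)
  show "red (x + y) = red x + red y" "red (x * y) = red x * red y"
    using xy by (auto simp: red_add red_mult)
qed (auto simp: O_v_def red_1)

lemma red_lift: "\<exists>x. absv x \<le> 1 \<and> red x = y"
  using red_surj by (metis (mono_tags, lifting) UNIV_I imageE mem_Collect_eq)

text \<open>A polynomial over k is made monic and lifted to a monic integral polynomial. A root in K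
  is integral, since otherwise the leading term would dominate all others, and its reduction is a
  root over k.\<close>

lemma residue_roots_exist: "roots_exist TYPE('k)"
  unfolding roots_exist_def
proof (intro allI impI)
  fix p :: "'k poly" assume deg: "degree p \<ge> 1"
  define n where "n = degree p"
  define p1 where "p1 = smult (inverse (lead_coeff p)) p"
  have p0: "p \<noteq> 0" using deg by auto
  have p1: "coeff p1 n = 1" "degree p1 = n" using p0 by (simp_all add: p1_def n_def)
  obtain s where s: "\<And>y. absv (s y) \<le> 1" "\<And>y. red (s y) = y" using red_lift by metis
  define P where "P = (\<Sum>i<n. monom (s (coeff p1 i)) i) + monom 1 n"
  have cP: "coeff P i = (if i < n then s (coeff p1 i) else if i = n then 1 else 0)" for i
    by (auto simp: P_def coeff_sum)
  have Pin: "coeffs_in O_v P" by (auto simp: coeffs_in_def cP O_v_def s)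
  have "map_poly red P = p1"
    by (rule poly_eqI) (auto simp: cP s p1 coeff_eq_0 not_less)
  have degP: "degree P = n"
    by (rule antisym, rule degree_le) (auto simp: cP intro: le_degree)
  then have "degree P \<ge> 1" using deg by (simp add: n_def)
  then obtain x where x: "poly P x = 0" using roots_exist unfolding roots_exist_def by blast
  have "absv x \<le> 1"
  proof (rule ccontr)
    assume "\<not> absv x \<le> 1"
    then have x1: "absv x > 1" by simp
    have "x ^ n = - (\<Sum>i<n. coeff P i * x ^ i)"
      using x by (simp add: poly_altdef degP lessThan_Suc_atMost[symmetric] cP eq_neg_iff_add_eq_0 add.commute)
    then have "absv (x ^ n) = absv (\<Sum>i<n. coeff P i * x ^ i)" by simp
    also have "\<dots> \<le> absv x ^ (n - 1)"
    proof -
      have "absv (\<Sum>i\<in>S. coeff P i * x ^ i) \<le> absv x ^ (n - 1)" if "S \<subseteq> {..<n}" "finite S" for S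
        using that(2,1)
      proof (induction S rule: finite_induct)
        case (insert i S)
        have "absv (coeff P i * x ^ i) \<le> 1 * absv x ^ i"
          unfolding absv_mult absv_power by (intro mult_right_mono) (use insert in \<open>auto simp: cP s\<close>)
        also have "\<dots> \<le> absv x ^ (n - 1)" using insert x1 by (intro order_trans[OF _ power_increasing[of i "n - 1"]]) auto
        finally show ?case using insert absv_add[of "coeff P i * x ^ i" "\<Sum>i\<in>S. coeff P i * x ^ i"] by auto
      qed auto
      then show ?thesis by simp
    qed
    also have "\<dots> < absv x ^ n" using x1 deg by (intro power_strict_increasing) (auto simp: n_def)
    finally show False by (simp add: absv_power)
  qed
  then have "poly p1 (red x) = 0"
    using red.hom_poly[OF Pin, of x] x \<open>map_poly red P = p1\<close> by (simp add: O_v_def)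
  then show "\<exists>x. poly p x = 0" using p0 by (auto simp: p1_def)
qed

lemma qv_gt_1: "qv absv > 1"
proof (cases "\<exists>p::nat. p > 0 \<and> absv (of_nat p) < 1")
  case True
  let ?p = "LEAST p::nat. p > 0 \<and> absv (of_nat p) < 1"
  from True have "?p > 0 \<and> absv (of_nat ?p) < 1" by (rule LeastI_ex)
  moreover from this have "?p \<noteq> 1" by force
  ultimately have "1 < real ?p" by linarith
  then show ?thesis unfolding qv_def if_P[OF True] .
next
  case False
  then show ?thesis unfolding qv_def if_not_P[OF False] by simp
qed

section \<open>Gauss norms of lifts and the order of the resultant\<close>

abbreviation "N \<equiv> nrm absv"

lemma nrm_le_iff: "N D FG \<le> r \<longleftrightarrow> (\<forall>i<2 * D + 2. absv (coords D FG i) \<le> r)"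
  unfolding nrm_def coeff_set_eq_coords image_image by (subst Max_le_iff) auto

lemma nrm_less_iff: "N D FG < r \<longleftrightarrow> (\<forall>i<2 * D + 2. absv (coords D FG i) < r)"
  unfolding nrm_def coeff_set_eq_coords image_image by (subst Max_less_iff) auto

lemma nrm_ge: "i < 2 * D + 2 \<Longrightarrow> absv (coords D FG i) \<le> N D FG"
  using nrm_le_iff by blast

lemma nrm_attained: "\<exists>i<2 * D + 2. absv (coords D FG i) = N D FG"
proof -
  have "N D FG \<in> absv ` coeff_set D FG"
    unfolding nrm_def coeff_set_eq_coords by (intro Max_in) auto
  then show ?thesis by (auto simp: coeff_set_eq_coords)
qed

lemma nrm_nonneg: "N D FG \<ge> 0"
  using nrm_attained[of D FG] by (metis absv_nonneg)

lemma nrm_smult: "N D (smult c F, smult c G) = absv c * N D (F, G)"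
proof (rule antisym)
  show "N D (smult c F, smult c G) \<le> absv c * N D (F, G)"
    unfolding nrm_le_iff coords_smult absv_mult using nrm_ge by (auto intro: mult_left_mono)
  obtain i where "i < 2 * D + 2" "absv (coords D (F, G) i) = N D (F, G)" using nrm_attained by blast
  then show "absv c * N D (F, G) \<le> N D (smult c F, smult c G)"
    using nrm_ge[of i D "(smult c F, smult c G)"] by (simp add: coords_smult absv_mult)
qed

lemma nrm_pos:
  assumes "degree F \<le> D" "degree G \<le> D" "(F, G) \<noteq> (0, 0)"
  shows "N D (F, G) > 0"
proof (rule ccontr)
  assume "\<not> N D (F, G) > 0"
  then have "N D (F, G) \<le> 0" by simp
  then have "coords D (F, G) i = 0" if "i < 2 * D + 2" for i
    using that unfolding nrm_le_iff by (metis absv_eq_0 absv_nonneg antisym)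
  then have "coords D (F, G) i = coords D (0, 0) i" if "i < 2 * D + 2" for i
    using that by (simp add: coords_def[of D "(0, 0)"])
  then have "F = 0" "G = 0" using coords_eqD[of D F G 0 0] assms by simp_all
  with assms show False by simp
qed

lemma normalize_lift_eq:
  obtains c where "absv c = N D (F, G)" "normalize_lift absv D (F, G) = (smult (inverse c) F, smult (inverse c) G)"
proof -
  let ?P = "\<lambda>c. c \<in> coeff_set D (F, G) \<and> absv c = Max (absv ` coeff_set D (F, G))"
  have "\<exists>c. ?P c" using nrm_attained[of D "(F, G)"] by (auto simp: nrm_def coeff_set_eq_coords)
  then have "?P (SOME c. ?P c)" by (rule someI_ex)
  then show ?thesis by (intro that[of "SOME c. ?P c"]) (auto simp: nrm_def normalize_lift_def)
qed

text \<open>The resultant is homogeneous of degree 2D in the coefficients, so normalization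
  contributes 2D times the logarithm of the norm.\<close>

lemma Rlift_eq:
  assumes F: "degree F \<le> D" and G: "degree G \<le> D" and D: "D \<ge> 1" and nz: "bires D D F G \<noteq> 0"
  shows "Rlift absv D (F, G) = 2 * real D * log (qv absv) (N D (F, G)) - log (qv absv) (absv (bires D D F G))"
proof -
  have "(F, G) \<noteq> (0, 0)"
    using nz bires_smult[of D 0 0 0] D by (auto simp: zero_power)
  then have pos: "N D (F, G) > 0" by (rule nrm_pos[OF F G])
  obtain c where c: "absv c = N D (F, G)" "normalize_lift absv D (F, G) = (smult (inverse c) F, smult (inverse c) G)"
    by (rule normalize_lift_eq)
  have "bform_res D (smult (inverse c) F) (smult (inverse c) G) = inverse c ^ (2 * D) * bires D D F G"
    using bires_smult[of D "inverse c" F G] F G by (subst bform_res_eq_bires) auto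
  then have "Rlift absv D (F, G) = - log (qv absv) (inverse (N D (F, G)) ^ (2 * D) * absv (bires D D F G))"
    by (simp add: Rlift_def c(2) ord_def absv_mult absv_power absv_inverse c(1))
  also have "log (qv absv) (inverse (N D (F, G)) ^ (2 * D) * absv (bires D D F G)) =
      log (qv absv) (inverse (N D (F, G)) ^ (2 * D)) + log (qv absv) (absv (bires D D F G))"
    using pos nz by (subst log_mult) auto
  also have "log (qv absv) (inverse (N D (F, G)) ^ (2 * D)) = - (2 * real D * log (qv absv) (N D (F, G)))"
    using pos by (subst log_nat_power) (auto simp: log_inverse)
  finally show ?thesis by simp
qed

end

section \<open>Existence of a minimal conjugate\<close>

text \<open>A maximum of finitely many affine functions on the line is minimal where a falling and a rising one meet,
  namely for the pair whose crossing is highest.\<close>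

lemma max_affine_attains_min:
  fixes \<alpha> w :: "nat \<Rightarrow> real"
  assumes fin: "finite I" and neg: "\<exists>i\<in>I. w i < 0" and pos: "\<exists>j\<in>I. w j > 0"
  obtains i j where "i \<in> I" "j \<in> I" "w i < 0" "w j > 0"
    "\<And>l t. l \<in> I \<Longrightarrow> \<exists>l'\<in>I. \<alpha> l + w l * ((\<alpha> i - \<alpha> j) / (w j - w i)) \<le> \<alpha> l' + w l' * t"
proof -
  \<comment> \<open>The height at which the lines i and j cross; the abscissa of the crossing is
    (\<alpha> i - \<alpha> j) / (w j - w i).\<close>
  define v where "v = (\<lambda>(i, j). (w j * \<alpha> i - w i * \<alpha> j) / (w j - w i))"
  define P where "P = {(i, j). i \<in> I \<and> j \<in> I \<and> w i < 0 \<and> w j > 0}"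
  have "finite P" by (rule finite_subset[of _ "I \<times> I"]) (auto simp: P_def fin)
  moreover have "P \<noteq> {}" using neg pos by (auto simp: P_def)
  ultimately have "Max (v ` P) \<in> v ` P" by (intro Max_in) auto
  then obtain p where p: "p \<in> P" "v p = Max (v ` P)" by auto
  have p_max: "v q \<le> v p" if "q \<in> P" for q
    unfolding p(2) using that \<open>finite P\<close> by (intro Max_ge) auto
  obtain i j where ij: "p = (i, j)" by (cases p)
  have i: "i \<in> I" "w i < 0" and j: "j \<in> I" "w j > 0" using p(1) by (auto simp: P_def ij)
  define t0 where "t0 = (\<alpha> i - \<alpha> j) / (w j - w i)"
  have pos': "w j - w i > 0" using i j by simp
  have vi: "\<alpha> i = v (i, j) - w i * t0" and vj: "\<alpha> j = v (i, j) - w j * t0"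
  proof -
    have a: "v (i, j) * (w j - w i) = w j * \<alpha> i - w i * \<alpha> j" and b: "t0 * (w j - w i) = \<alpha> i - \<alpha> j"
      using pos' by (simp_all add: v_def t0_def)
    have "(\<alpha> i - (v (i, j) - w i * t0)) * (w j - w i) =
        \<alpha> i * (w j - w i) - v (i, j) * (w j - w i) + w i * (t0 * (w j - w i))" by (simp add: algebra_simps)
    also have "\<dots> = 0" unfolding a b by (simp add: algebra_simps)
    finally show "\<alpha> i = v (i, j) - w i * t0" using pos' by simp
    have "(\<alpha> j - (v (i, j) - w j * t0)) * (w j - w i) =
        \<alpha> j * (w j - w i) - v (i, j) * (w j - w i) + w j * (t0 * (w j - w i))" by (simp add: algebra_simps)
    also have "\<dots> = 0" unfolding a b by (simp add: algebra_simps)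
    finally show "\<alpha> j = v (i, j) - w j * t0" using pos' by simp
  qed
  have le: "\<alpha> l + w l * t0 \<le> v (i, j)" if l: "l \<in> I" "w l \<noteq> 0" for l
  proof (cases "w l > 0")
    case True
    have "(i, l) \<in> P" using True l i by (simp add: P_def)
    then have "v (i, l) \<le> v (i, j)" using p_max ij by blast
    then have "w l * \<alpha> i - w i * \<alpha> l \<le> v (i, j) * (w l - w i)"
      using True i unfolding v_def by (simp add: divide_le_eq)
    then have "(- w i) * (\<alpha> l + w l * t0) \<le> (- w i) * v (i, j)" unfolding vi by (simp add: algebra_simps)
    then show ?thesis using i by (simp add: mult_le_cancel_left)
  next
    case False
    then have "w l < 0" using l by simp
    then have "(l, j) \<in> P" using l j by (simp add: P_def)
    then have "v (l, j) \<le> v (i, j)" using p_max ij by blast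
    then have "w j * \<alpha> l - w l * \<alpha> j \<le> v (i, j) * (w j - w l)"
      using \<open>w l < 0\<close> j unfolding v_def by (simp add: divide_le_eq)
    then have "w j * (\<alpha> l + w l * t0) \<le> w j * v (i, j)" unfolding vj by (simp add: algebra_simps)
    then show ?thesis using j by (simp add: mult_le_cancel_left)
  qed
  have "\<exists>l'\<in>I. \<alpha> l + w l * t0 \<le> \<alpha> l' + w l' * t" if l: "l \<in> I" for l t
  proof (cases "w l = 0")
    case True
    then show ?thesis using l by (intro bexI[of _ l]) auto
  next
    case False
    show ?thesis
    proof (cases "t \<ge> t0")
      case True
      have "v (i, j) = \<alpha> j + w j * t0" using vj by simp
      also have "\<dots> \<le> \<alpha> j + w j * t" using True j by simp
      finally show ?thesis using le[OF l False] j by (intro bexI[of _ j]) auto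
    next
      case False
      have "v (i, j) = \<alpha> i + w i * t0" using vi by simp
      also have "\<dots> \<le> \<alpha> i + w i * t" using False i by simp
      finally show ?thesis using le[OF l \<open>w l \<noteq> 0\<close>] i by (intro bexI[of _ i]) auto
    qed
  qed
  then show ?thesis using i j by (intro that[of i j]) (auto simp: t0_def)
qed

lemma bform_subst_eq_pcompose:
  fixes F A :: "'a::comm_ring_1 poly"
  assumes "degree F \<le> D"
  shows "bform_subst D F A [:1:] = pcompose F A"
proof -
  have "bform_subst D F A [:1:] = (\<Sum>i\<le>D. smult (coeff F i) (A ^ i))"
    by (simp add: bform_subst_def flip: one_pCons)
  also have "\<dots> = (\<Sum>i\<le>degree F. smult (coeff F i) (A ^ i))"
    using assms by (intro sum.mono_neutral_right) (auto simp: coeff_eq_0)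
  also have "\<dots> = pcompose F A"
    by (simp add: pcompose_altdef poly_altdef coeff_map_poly degree_map_poly)
  finally show ?thesis .
qed

lemma bform_eval_1_0: "bform_eval D p 1 0 = coeff p D"
proof -
  have "bform_eval D p 1 0 = (\<Sum>i\<le>D. if i = D then coeff p D else 0)"
    unfolding bform_eval_def by (intro sum.cong) (auto simp: power_0_left)
  then show ?thesis by simp
qed

context valued_field
begin

lemma nrm_conj_integral_le:
  assumes "absv a \<le> 1" "absv b \<le> 1" "absv c \<le> 1" "absv d \<le> 1"
  shows "N D (conj_lift D (a, b, c, d) FG) \<le> N D FG"
proof -
  have "coords D (conj_lift D (a, b, c, d) FG) i \<in> {x. absv x \<le> N D FG}" if "i < 2 * D + 2" for i
  proof (rule red.coords_conj_lift_in_submodule[OF _ _ _ _ _ _ _ _ that])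
    fix x y assume "x \<in> {x. absv x \<le> N D FG}" "y \<in> {x. absv x \<le> N D FG}"
    then show "x + y \<in> {x. absv x \<le> N D FG}" using absv_add[of x y] by simp
  next
    fix x r assume "x \<in> {x. absv x \<le> N D FG}" "r \<in> O_v"
    then show "r * x \<in> {x. absv x \<le> N D FG}"
      using mult_mono[of "absv r" 1 "absv x" "N D FG"] by (simp add: absv_mult O_v_def)
  qed (use assms nrm_ge nrm_nonneg in \<open>auto simp: O_v_def\<close>)
  then show ?thesis by (simp add: nrm_le_iff)
qed

section \<open>Integral matrices do not change the norm; up to them a matrix is a disc\<close>

definition integral2 :: "'a \<times> 'a \<times> 'a \<times> 'a \<Rightarrow> bool" where
  "integral2 g \<longleftrightarrow> (case g of (a, b, c, d) \<Rightarrow> absv a \<le> 1 \<and> absv b \<le> 1 \<and> absv c \<le> 1 \<and> absv d \<le> 1)"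

text \<open>An integral matrix cannot increase the norm, and in determinant 1 its inverse is
  integral too.\<close>

lemma nrm_conj_integral:
  assumes k: "k \<in> sl2" "integral2 k" and FG: "degree F \<le> D" "degree G \<le> D"
  shows "N D (conj_lift D k (F, G)) = N D (F, G)"
proof (rule antisym)
  obtain a b c d where kk: "k = (a, b, c, d)" by (cases k)
  show "N D (conj_lift D k (F, G)) \<le> N D (F, G)"
    using k by (auto simp: kk integral2_def intro: nrm_conj_integral_le)
  have "(F, G) = conj_lift D (adj2 k) (conj_lift D k (F, G))"
    unfolding conj_lift_mmult mmult_adj2(1)[OF k(1)] using FG by (simp add: conj_lift_1)
  moreover have "N D (conj_lift D (adj2 k) (conj_lift D k (F, G))) \<le> N D (conj_lift D k (F, G))"
    using k by (auto simp: kk integral2_def intro!: nrm_conj_integral_le)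
  ultimately show "N D (F, G) \<le> N D (conj_lift D k (F, G))" by simp
qed

lemma nrm_conj_mmult_integral:
  assumes k: "k \<in> sl2" "integral2 k"
  shows "N D (conj_lift D (mmult g k) FG) = N D (conj_lift D g FG)"
proof -
  obtain F G where FG: "conj_lift D g FG = (F, G)" by (cases "conj_lift D g FG")
  have "degree F \<le> D" "degree G \<le> D" using degree_conj_lift[of D g FG] FG by auto
  from nrm_conj_integral[OF k this] show ?thesis by (simp add: FG flip: conj_lift_mmult)
qed

text \<open>The affine map z \<mapsto> e^2 z + \<beta>, written with determinant 1. It carries the
  unit disc to the disc around \<beta> of radius |e|^2.\<close>

definition upper :: "'a \<Rightarrow> 'a \<Rightarrow> 'a \<times> 'a \<times> 'a \<times> 'a" where
  "upper \<beta> e = (e, \<beta> / e, 0, 1 / e)"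

lemma upper_in_sl2: "e \<noteq> 0 \<Longrightarrow> upper \<beta> e \<in> sl2"
  by (simp add: upper_def sl2_def)

text \<open>Integral column operations clear the lower left entry, with the larger of c and d as
  pivot. Hence only conjugates by affine maps have to be considered for the norm.\<close>

lemma iwasawa:
  assumes g: "g \<in> sl2"
  obtains \<beta> e k where "e \<noteq> 0" "k \<in> sl2" "integral2 k" "mmult g k = upper \<beta> e"
proof -
  obtain a b c d where gg: "g = (a, b, c, d)" by (cases g)
  have det: "a * d - b * c = 1" using g by (simp add: gg sl2_def)
  show ?thesis
  proof (cases "absv c \<le> absv d")
    case True
    have d: "d \<noteq> 0"
    proof
      assume "d = 0"
      then have "absv c \<le> 0" using True by simp
      then have "absv c = 0" using absv_nonneg[of c] by linarith
      then have "c = 0" by simp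
      then show False using det \<open>d = 0\<close> by simp
    qed
    have "absv (c / d) \<le> 1" using True d by (simp add: absv_divide)
    moreover have "mmult g (1, 0, - (c / d), 1) = upper (b / d) (1 / d)"
      using d det by (simp add: gg upper_def field_simps)
    ultimately show ?thesis using d
      by (intro that[of "1 / d" "(1, 0, - (c / d), 1)" "b / d"]) (auto simp: sl2_def integral2_def)
  next
    case False
    then have c: "c \<noteq> 0" by auto
    have "absv (d / c) \<le> 1" using False c by (simp add: absv_divide)
    moreover have "mmult g (d / c, 1, - 1, 0) = upper (a / c) (1 / c)"
      using c det by (simp add: gg upper_def field_simps)
    ultimately show ?thesis using c
      by (intro that[of "1 / c" "(d / c, 1, - 1, 0)" "a / c"]) (auto simp: sl2_def integral2_def)
  qed
qed

text \<open>Only the disc matters: any of its points may serve as centre, the change of centre being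
  an integral translation on the right.\<close>

lemma nrm_upper_translate:
  assumes e: "e \<noteq> 0" and le: "absv (\<beta>' - \<beta>) \<le> absv e ^ 2"
  shows "N D (conj_lift D (upper \<beta>' e) FG) = N D (conj_lift D (upper \<beta> e) FG)"
proof -
  let ?\<eta> = "(\<beta>' - \<beta>) / e ^ 2"
  have "absv ?\<eta> \<le> 1" using le e by (simp add: absv_divide absv_power)
  then have "integral2 (1, ?\<eta>, 0, 1)" "(1, ?\<eta>, 0, 1) \<in> sl2" by (auto simp: integral2_def sl2_def)
  moreover have "upper \<beta>' e = mmult (upper \<beta> e) (1, ?\<eta>, 0, 1)"
    using e by (simp add: upper_def field_simps power2_eq_square)
  ultimately show ?thesis by (simp add: nrm_conj_mmult_integral)
qed

lemma absv_coords_upper: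
  assumes e: "e \<noteq> 0" and i: "i < 2 * D + 2"
  shows "absv (coords D (conj_lift D (upper \<beta> e) FG) i) =
    absv (coords D (conj_lift D (1, \<beta>, 0, 1) FG) i) * absv e ^ (2 * xdeg D i) / absv e ^ (D + 1)"
proof -
  have "upper \<beta> e = mmult (1, \<beta>, 0, 1) (e, 0, 0, 1 / e)" by (simp add: upper_def)
  then have "coords D (conj_lift D (upper \<beta> e) FG) i =
      e ^ xdeg D i * (1 / e) ^ ydeg D i * coords D (conj_lift D (1, \<beta>, 0, 1) FG) i"
    using i by (simp only: conj_lift_mmult[symmetric] coords_conj_diag)
  moreover have "absv e ^ xdeg D i * (1 / absv e) ^ ydeg D i = absv e ^ (2 * xdeg D i) / absv e ^ (D + 1)"
  proof -
    have "xdeg D i \<le> D + 1" using i by (auto simp: xdeg_def)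
    then have "absv e ^ (D + 1) = absv e ^ xdeg D i * absv e ^ ydeg D i"
      by (simp add: ydeg_def flip: power_add)
    moreover have "absv e ^ (2 * xdeg D i) = absv e ^ xdeg D i * absv e ^ xdeg D i"
      by (simp add: mult_2 power_add)
    moreover have "(1 / absv e) ^ ydeg D i = 1 / absv e ^ ydeg D i" by (simp add: power_one_over)
    ultimately show ?thesis using e by simp
  qed
  ultimately show ?thesis by (simp add: absv_mult absv_power absv_divide)
qed

text \<open>Without zeros at distance less than r from \<beta>, the value at \<beta> dominates all
  Taylor terms on the disc of radius r. Each root s contributes a factor (\<beta> - s) + (z -
  \<beta>) whose constant term has absolute value at least r; splitting off roots gives the
  induction.\<close>

lemma absv_taylor_coeff_le:
  fixes p :: "'a poly"
  assumes r: "r > 0" and roots: "\<And>s. p \<noteq> 0 \<Longrightarrow> poly p s = 0 \<Longrightarrow> absv (\<beta> - s) \<ge> r"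
  shows "absv (coeff (pcompose p [:\<beta>, 1:]) k) * r ^ k \<le> absv (poly p \<beta>)"
  using roots
proof (induction "degree p" arbitrary: p k)
  case 0
  then obtain c where "p = [:c:]" by (metis degree_eq_zeroE)
  then show ?case by (cases k) auto
next
  case (Suc n)
  have p0: "p \<noteq> 0" using Suc(2) by auto
  have "degree p \<ge> 1" using Suc(2) by simp
  then obtain s where s: "poly p s = 0" using roots_exist unfolding roots_exist_def by blast
  then obtain q where q: "p = [:- s, 1:] * q" by (auto simp: poly_eq_0_iff_dvd dvd_def)
  have q0: "q \<noteq> 0" using p0 q by auto
  then have "degree p = 1 + degree q" unfolding q by (subst degree_mult_eq) auto
  then have dq: "n = degree q" using Suc(2) by simp
  have rs: "r \<le> absv (\<beta> - s)" using Suc(3)[OF p0 s] .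
  have IH: "absv (coeff (pcompose q [:\<beta>, 1:]) k) * r ^ k \<le> absv (poly q \<beta>)" for k
    by (rule Suc(1)[OF dq]) (use Suc(3) p0 q in auto)
  have sh: "pcompose p [:\<beta>, 1:] = smult (\<beta> - s) (pcompose q [:\<beta>, 1:]) + pCons 0 (pcompose q [:\<beta>, 1:])"
  proof -
    have "pcompose [:- s, 1:] [:\<beta>, 1:] = [:\<beta> - s, 1:]" by (simp add: pcompose_pCons)
    then show ?thesis unfolding q pcompose_mult by simp
  qed
  have pv: "absv (poly p \<beta>) = absv (\<beta> - s) * absv (poly q \<beta>)"
    unfolding q by (simp add: absv_mult[symmetric] algebra_simps)
  have 1: "absv ((\<beta> - s) * coeff (pcompose q [:\<beta>, 1:]) k) * r ^ k \<le> absv (poly p \<beta>)"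
    unfolding pv absv_mult using mult_left_mono[OF IH[of k], of "absv (\<beta> - s)"] by (simp add: mult_ac)
  show ?case
  proof (cases k)
    case 0
    then show ?thesis using 1 by (simp add: sh)
  next
    case (Suc m)
    have "absv (coeff (pcompose q [:\<beta>, 1:]) m) * r ^ k = r * (absv (coeff (pcompose q [:\<beta>, 1:]) m) * r ^ m)"
      by (simp add: Suc)
    also have "\<dots> \<le> absv (\<beta> - s) * absv (poly q \<beta>)"
      using rs r IH[of m] by (intro mult_mono) auto
    finally have 2: "absv (coeff (pcompose q [:\<beta>, 1:]) m) * r ^ k \<le> absv (poly p \<beta>)" by (simp add: pv)
    have "absv (coeff (pcompose p [:\<beta>, 1:]) k) \<le>
        max (absv ((\<beta> - s) * coeff (pcompose q [:\<beta>, 1:]) k)) (absv (coeff (pcompose q [:\<beta>, 1:]) m))"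
      unfolding sh using absv_add by (simp add: Suc)
    then have "absv (coeff (pcompose p [:\<beta>, 1:]) k) * r ^ k \<le>
        max (absv ((\<beta> - s) * coeff (pcompose q [:\<beta>, 1:]) k)) (absv (coeff (pcompose q [:\<beta>, 1:]) m)) * r ^ k"
      using r by (intro mult_right_mono) auto
    also have "\<dots> \<le> absv (poly p \<beta>)" using 1 2 by (auto simp: max_def)
    finally show ?thesis .
  qed
qed

text \<open>The polynomial F - zG, which vanishes at the finite fixed points, transforms under
  translations by mere substitution, unlike F. The numerator of the conjugate is recovered by adding
  z times the translated G.\<close>

lemma coords_conj_translate:
  assumes F: "degree F \<le> D" and G: "degree G \<le> D" and i: "i < 2 * D + 2"
  shows "coords D (conj_lift D (1, \<beta>, 0, 1) (F, G)) i =
    (if i \<le> D then coeff (pcompose (F - [:0, 1:] * G) [:\<beta>, 1:]) i + (if i = 0 then 0 else coeff (pcompose G [:\<beta>, 1:]) (i - 1))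
     else coeff (pcompose G [:\<beta>, 1:]) (i - D - 1))"
proof -
  let ?F = "pcompose F [:\<beta>, 1:]" and ?G = "pcompose G [:\<beta>, 1:]"
  have "conj_lift D (1, \<beta>, 0, 1) (F, G) = (?F - smult \<beta> ?G, ?G)"
    using F G by (simp add: conj_lift_def Let_def bform_subst_eq_pcompose)
  moreover have "?F - smult \<beta> ?G = pcompose (F - [:0, 1:] * G) [:\<beta>, 1:] + pCons 0 ?G"
  proof -
    have "pcompose [:0, 1:] [:\<beta>, 1:] = [:\<beta>, 1:]" by (simp add: pcompose_pCons)
    then have "pcompose (F - [:0, 1:] * G) [:\<beta>, 1:] = ?F - [:\<beta>, 1:] * ?G"
      by (simp only: pcompose_diff pcompose_mult)
    then show ?thesis by simp
  qed
  ultimately show ?thesis by (auto simp: coords_def coeff_pCons split: nat.split)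
qed

text \<open>The norm is that of the pair (F - zG, G) on the disc of radius absv e squared around beta, with weights.
  Shrinking a disc that contains no zero of F - zG and of G leaves the sup norms unchanged,
  while the weights have negative exponents; hence only centres at such zeros matter.\<close>

lemma nrm_upper_root_centre:
  assumes F: "degree F \<le> D" and G: "degree G \<le> D" and D: "D \<ge> 1" and e: "e \<noteq> 0"
    and s: "\<And>s'. F - [:0, 1:] * G \<noteq> 0 \<Longrightarrow> poly (F - [:0, 1:] * G) s' = 0 \<Longrightarrow> absv (\<beta> - s) \<le> absv (\<beta> - s')"
      "\<And>s'. G \<noteq> 0 \<Longrightarrow> poly G s' = 0 \<Longrightarrow> absv (\<beta> - s) \<le> absv (\<beta> - s')"
  obtains e' where "e' \<noteq> 0"
    "N D (conj_lift D (upper s e') (F, G)) \<le> N D (conj_lift D (upper \<beta> e) (F, G))"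
proof (cases "absv (\<beta> - s) \<le> absv e ^ 2")
  case True
  then have "N D (conj_lift D (upper s e) (F, G)) = N D (conj_lift D (upper \<beta> e) (F, G))"
    using nrm_upper_translate[OF e, of \<beta> s] by simp
  then show ?thesis using that e by simp
next
  case False
  define r where "r = absv (\<beta> - s)"
  \<comment> \<open>The disc of radius |e|^2 does not reach the nearest zero s, so it is enlarged to
    the radius r = |\<beta> - s|. Then s lies in it and can replace \<beta> as centre.\<close>
  obtain e' where e': "e' ^ 2 = \<beta> - s" using ex_nth_root[of 2] by auto
  have r_e': "absv e' ^ 2 = r" unfolding r_def e'[symmetric] by (simp add: absv_power)
  have rpos: "r > 0" and big: "absv e ^ 2 < absv e' ^ 2"
    using False zero_le_power2[of "absv e"] unfolding r_e' r_def by linarith+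
  have e'0: "e' \<noteq> 0" using rpos r_e' by auto
  have ee': "absv e < absv e'" using big by (simp add: power_less_imp_less_base)
  let ?\<theta> = "F - [:0, 1:] * G"
  let ?t = "pcompose ?\<theta> [:\<beta>, 1:]" and ?g = "pcompose G [:\<beta>, 1:]"
  let ?T = "N D (conj_lift D (upper \<beta> e) (F, G))"
  have coord: "absv (coords D (conj_lift D (1, \<beta>, 0, 1) (F, G)) i) * absv e ^ (2 * xdeg D i) / absv e ^ (D + 1) \<le> ?T"
    if "i < 2 * D + 2" for i
    using nrm_ge[OF that, of "conj_lift D (upper \<beta> e) (F, G)"] absv_coords_upper[OF e that, of \<beta> "(F, G)"] by simp
  have t: "absv (coeff ?t k) * absv e' ^ (2 * k) / absv e' ^ (D + 1) \<le> ?T" for k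
  proof -
    have "absv (coeff ?t k) * absv e' ^ (2 * k) \<le> absv (poly ?\<theta> \<beta>)"
      using absv_taylor_coeff_le[OF rpos, of ?\<theta> \<beta> k] s(1) by (simp add: r_def[symmetric] power_mult r_e')
    then have "absv (coeff ?t k) * absv e' ^ (2 * k) / absv e' ^ (D + 1) \<le> absv (poly ?\<theta> \<beta>) / absv e' ^ (D + 1)"
      using e'0 by (intro divide_right_mono) auto
    also have "\<dots> \<le> absv (poly ?\<theta> \<beta>) / absv e ^ (D + 1)"
      using ee' e e'0 by (intro divide_left_mono power_mono mult_pos_pos zero_less_power) auto
    also have "\<dots> \<le> ?T"
      using coord[of 0] coords_conj_translate[OF F G, of 0 \<beta>] by (simp add: xdeg_def pcompose_coeff_0)
    finally show ?thesis .
  qed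
  have g: "absv (coeff ?g k) * absv e' ^ (2 * Suc k) / absv e' ^ (D + 1) \<le> ?T" for k
  proof -
    \<comment> \<open>The extra X-degree in the coordinates of G cancels two of the D + 1 factors.
      The exponent D - 1 that remains is nonnegative, so a larger disc still does not increase these
      terms.\<close>
    have split: "x * absv c ^ (2 * Suc m) / absv c ^ (D + 1) = x * absv c ^ (2 * m) / absv c ^ (D - 1)"
      if "c \<noteq> 0" for x c m
    proof -
      have 1: "absv c ^ (D + 1) = absv c ^ 2 * absv c ^ (D - 1)" using D by (simp flip: power_add)
      have 2: "absv c ^ (2 * Suc m) = absv c ^ 2 * absv c ^ (2 * m)" by (simp flip: power_add)
      show ?thesis unfolding 1 2 using that by (simp add: field_simps)
    qed
    have "absv (coeff ?g k) * absv e' ^ (2 * k) \<le> absv (poly G \<beta>)"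
      using absv_taylor_coeff_le[OF rpos, of G \<beta> k] s(2) by (simp add: r_def[symmetric] power_mult r_e')
    then have "absv (coeff ?g k) * absv e' ^ (2 * k) / absv e' ^ (D - 1) \<le> absv (poly G \<beta>) / absv e' ^ (D - 1)"
      using e'0 by (intro divide_right_mono) auto
    also have "\<dots> \<le> absv (poly G \<beta>) / absv e ^ (D - 1)"
      using ee' e e'0 by (intro divide_left_mono power_mono mult_pos_pos zero_less_power) auto
    also have "\<dots> = absv (poly G \<beta>) * absv e ^ (2 * Suc 0) / absv e ^ (D + 1)" using split[OF e, of _ 0] by simp
    also have "\<dots> \<le> ?T"
      using coord[of "D + 1"] coords_conj_translate[OF F G, of "D + 1" \<beta>] by (simp add: xdeg_def pcompose_coeff_0)
    finally show ?thesis unfolding split[OF e'0] .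
  qed
  have "N D (conj_lift D (upper \<beta> e') (F, G)) \<le> ?T"
    unfolding nrm_le_iff
  proof (intro allI impI)
    fix i assume i: "i < 2 * D + 2"
    let ?c = "coords D (conj_lift D (1, \<beta>, 0, 1) (F, G)) i"
    have "absv ?c * absv e' ^ (2 * xdeg D i) / absv e' ^ (D + 1) \<le> ?T"
    proof (cases "i \<le> D")
      case True
      show ?thesis
      proof (cases i)
        case 0
        then show ?thesis using t[of 0] coords_conj_translate[OF F G i, of \<beta>] by (simp add: xdeg_def)
      next
        case (Suc k)
        have "absv ?c \<le> max (absv (coeff ?t i)) (absv (coeff ?g k))"
          using coords_conj_translate[OF F G i, of \<beta>] True Suc absv_add by simp
        then have "absv ?c * absv e' ^ (2 * i) / absv e' ^ (D + 1) \<le>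
            max (absv (coeff ?t i)) (absv (coeff ?g k)) * absv e' ^ (2 * i) / absv e' ^ (D + 1)"
          by (intro divide_right_mono mult_right_mono) auto
        also have "\<dots> \<le> ?T" using t[of i] g[of k] Suc by (auto simp: max_def)
        finally show ?thesis using True by (simp add: xdeg_def)
      qed
    next
      case False
      then have "i - D = Suc (i - D - 1)" by simp
      then show ?thesis using False g[of "i - D - 1"] coords_conj_translate[OF F G i, of \<beta>]
        by (simp add: xdeg_def)
    qed
    then show "absv (coords D (conj_lift D (upper \<beta> e') (F, G)) i) \<le> ?T"
      using absv_coords_upper[OF e'0 i, of \<beta> "(F, G)"] by simp
  qed
  moreover have "N D (conj_lift D (upper s e') (F, G)) = N D (conj_lift D (upper \<beta> e') (F, G))"
    using nrm_upper_translate[OF e'0, of \<beta> s] by (simp add: r_e' r_def)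
  ultimately show ?thesis using that e'0 by simp
qed

text \<open>With the centre fixed, the logarithms of the coordinates are affine functions of ln |e|,
  so the norm is governed by a maximum of finitely many lines. Lines of both slopes occur because F
  and G have no common zero, and the optimal crossing is realised by an element of K.\<close>

lemma nrm_upper_attains_min:
  assumes F: "degree F \<le> D" and G: "degree G \<le> D" and D: "D \<ge> 2" and nz: "bires D D F G \<noteq> 0"
  obtains e where "e \<noteq> 0"
    "\<And>e'. e' \<noteq> 0 \<Longrightarrow> N D (conj_lift D (upper s e) (F, G)) \<le> N D (conj_lift D (upper s e') (F, G))"
proof -
  have ncz: "\<not> (bform_eval D F x y = 0 \<and> bform_eval D G x y = 0)" if "(x, y) \<noteq> (0, 0)" for x y
    using bires_nz_imp_no_common_zero[OF roots_exist F G _ nz, of x y] D that by auto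
  define c where "c = coords D (conj_lift D (1, s, 0, 1) (F, G))"
  define I where "I = {i. i < 2 * D + 2 \<and> c i \<noteq> 0}"
  define \<alpha> where "\<alpha> = (\<lambda>i. ln (absv (c i)))"
  define w where "w = (\<lambda>i. 2 * real (xdeg D i) - real (D + 1))"
  have fin: "finite I" by (simp add: I_def)
  let ?F = "bform_subst D F [:s, 1:] [:1:]" and ?G = "bform_subst D G [:s, 1:] [:1:]"
  have c: "c i = (if i \<le> D then coeff ?F i - s * coeff ?G i else coeff ?G (i - D - 1))" for i
    by (simp add: c_def coords_def conj_lift_def Let_def)
  have ev: "bform_eval D (bform_subst D H [:s, 1:] [:1:]) x y = bform_eval D H (s * y + x) y" for H x y
    using bform_eval_subst[of "[:s, 1:]" "Suc 0" "[:1:]" D H x y] by (simp add: bform_eval_linear bform_eval_def)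
  \<comment> \<open>Coordinates 0 and D + 1 are constant terms, that is, values at the centre s.
    They do not both vanish, and for D \<ge> 2 both weights, -(D + 1) and 1 - D, are
    negative.\<close>
  have "\<exists>i\<in>I. w i < 0"
  proof -
    have "coeff H 0 = bform_eval D H 0 1" for H :: "'a poly"
    proof -
      have "bform_eval D H 0 1 = (\<Sum>i\<le>D. if i = 0 then coeff H 0 else 0)"
        unfolding bform_eval_def by (intro sum.cong) (auto simp: power_0_left)
      then show ?thesis by simp
    qed
    then have "coeff ?F 0 = bform_eval D F s 1" "coeff ?G 0 = bform_eval D G s 1" by (simp_all add: ev)
    then have "c 0 \<noteq> 0 \<or> c (D + 1) \<noteq> 0" using ncz[of s 1] by (auto simp: c)
    then show ?thesis
    proof
      assume "c 0 \<noteq> 0" then show ?thesis by (intro bexI[of _ 0]) (auto simp: w_def xdeg_def I_def)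
    next
      assume "c (D + 1) \<noteq> 0" then show ?thesis using D by (intro bexI[of _ "D + 1"]) (auto simp: w_def xdeg_def I_def)
    qed
  qed
  \<comment> \<open>The same at infinity: coordinates D and 2D + 1 carry the leading coefficients,
    with weights D - 1 and D + 1.\<close>
  moreover have "\<exists>i\<in>I. w i > 0"
  proof -
    have "coeff ?F D = bform_eval D F 1 0" "coeff ?G D = bform_eval D G 1 0"
      using ev[of F 1 0] ev[of G 1 0] by (simp_all add: bform_eval_1_0)
    then have "c D \<noteq> 0 \<or> c (2 * D + 1) \<noteq> 0" using ncz[of 1 0] by (auto simp: c)
    then show ?thesis
    proof
      assume "c D \<noteq> 0" then show ?thesis using D by (intro bexI[of _ D]) (auto simp: w_def xdeg_def I_def)
    next
      assume "c (2 * D + 1) \<noteq> 0" then show ?thesis using D by (intro bexI[of _ "2 * D + 1"]) (auto simp: w_def xdeg_def I_def)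
    qed
  qed
  ultimately obtain i j where ij: "i \<in> I" "j \<in> I" "w i < 0" "w j > 0" and
    min: "\<And>l t. l \<in> I \<Longrightarrow> \<exists>l'\<in>I. \<alpha> l + w l * ((\<alpha> i - \<alpha> j) / (w j - w i)) \<le> \<alpha> l' + w l' * t"
    using max_affine_attains_min[OF fin, of w \<alpha>] by blast
  \<comment> \<open>The slopes of the two optimal lines differ by the positive integer m, so an m-th
    root of c i / c j has exactly the logarithm where the lines cross.\<close>
  define m where "m = 2 * (xdeg D j - xdeg D i)"
  have "xdeg D i < xdeg D j" using ij by (simp add: w_def)
  then have m: "m > 0" "real m = w j - w i" by (auto simp: m_def w_def of_nat_diff)
  obtain e where e: "e ^ m = c i / c j" using ex_nth_root[OF m(1)] by blast
  have cij: "c i \<noteq> 0" "c j \<noteq> 0" using ij by (auto simp: I_def)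
  then have e0: "e \<noteq> 0" using e m(1) by (auto simp: zero_power)
  have "real m * ln (absv e) = \<alpha> i - \<alpha> j"
    using arg_cong[OF e, of "\<lambda>x. ln (absv x)"] e0 cij
    by (simp add: absv_power absv_divide ln_realpow ln_div \<alpha>_def)
  then have lne: "ln (absv e) = (\<alpha> i - \<alpha> j) / (w j - w i)" using m by (simp add: field_simps)
  have ln_coord: "ln (absv (coords D (conj_lift D (upper s e') (F, G)) l)) = \<alpha> l + w l * ln (absv e')"
    if "l \<in> I" "e' \<noteq> 0" for l e'
  proof -
    have "l < 2 * D + 2" "c l \<noteq> 0" using that by (auto simp: I_def)
    then show ?thesis using that
      by (simp add: absv_coords_upper c_def[symmetric] ln_div ln_mult ln_realpow \<alpha>_def w_def algebra_simps)
  qed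
  have pos: "absv (coords D (conj_lift D (upper s e') (F, G)) l) > 0" if "l \<in> I" "e' \<noteq> 0" for l e'
  proof -
    have "l < 2 * D + 2" "c l \<noteq> 0" using that by (auto simp: I_def)
    then show ?thesis using that absv_coords_upper[of e' l D s "(F, G)"] by (simp add: c_def)
  qed
  have "N D (conj_lift D (upper s e) (F, G)) \<le> N D (conj_lift D (upper s e') (F, G))" if e': "e' \<noteq> 0" for e'
    unfolding nrm_le_iff[of D "conj_lift D (upper s e) (F, G)"]
  proof (intro allI impI)
    fix l assume l: "l < 2 * D + 2"
    show "absv (coords D (conj_lift D (upper s e) (F, G)) l) \<le> N D (conj_lift D (upper s e') (F, G))"
    proof (cases "l \<in> I")
      case True
      then obtain l' where l': "l' \<in> I" "\<alpha> l + w l * ln (absv e) \<le> \<alpha> l' + w l' * ln (absv e')"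
        using min[of l "ln (absv e')"] unfolding lne by blast
      then have "absv (coords D (conj_lift D (upper s e) (F, G)) l) \<le> absv (coords D (conj_lift D (upper s e') (F, G)) l')"
        using ln_coord True e0 e' pos by (metis ln_le_cancel_iff)
      also have "\<dots> \<le> N D (conj_lift D (upper s e') (F, G))" using l' by (intro nrm_ge) (auto simp: I_def)
      finally show ?thesis .
    next
      case False
      then have "absv (coords D (conj_lift D (upper s e) (F, G)) l) = 0"
        using absv_coords_upper[OF e0 l, of s "(F, G)"] l by (simp add: I_def c_def)
      then show ?thesis using nrm_nonneg by simp
    qed
  qed
  then show ?thesis using that e0 by blast
qed

text \<open>A minimising sequence of discs could a priori be nested with empty intersection. This is
  excluded because every disc can be replaced, without raising the norm, by one centred in the
  finite set S, and for each such centre the best radius is attained.\<close>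

theorem nrm_conj_attains_min:
  assumes F: "degree F \<le> D" and G: "degree G \<le> D" and D: "D \<ge> 2" and nz: "bires D D F G \<noteq> 0"
  obtains g where "g \<in> sl2" "\<And>h. h \<in> sl2 \<Longrightarrow> N D (conj_lift D g (F, G)) \<le> N D (conj_lift D h (F, G))"
proof -
  let ?\<theta> = "F - [:0, 1:] * G"
  define S where "S = {s. ?\<theta> \<noteq> 0 \<and> poly ?\<theta> s = 0} \<union> {s. G \<noteq> 0 \<and> poly G s = 0}"
  have "finite {s. p \<noteq> 0 \<and> poly p s = 0}" for p :: "'a poly"
    by (cases "p = 0") (auto intro: poly_roots_finite)
  then have finS: "finite S" unfolding S_def by blast
  \<comment> \<open>If G and F - zG had no zeros, both would be constant; then the coefficients of
    degree D of F and G vanish, a common zero at infinity.\<close>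
  have S0: "S \<noteq> {}"
  proof
    assume "S = {}"
    have const: "degree p = 0" if "\<And>s. p \<noteq> 0 \<Longrightarrow> poly p s \<noteq> 0" for p :: "'a poly"
      using roots_exist that unfolding roots_exist_def
      by (metis One_nat_def Suc_leI degree_0 gr0I)
    have "degree G = 0" "degree ?\<theta> = 0"
      using \<open>S = {}\<close> by (auto simp: S_def intro!: const)
    then have "coeff G D = 0" "coeff G (D - 1) = 0"
      using D by (auto simp: coeff_eq_0)
    moreover have "coeff ?\<theta> D = 0" using \<open>degree ?\<theta> = 0\<close> D by (intro coeff_eq_0) linarith
    moreover have "coeff ?\<theta> D = coeff F D - coeff G (D - 1)" using D by (cases D) auto
    ultimately have "coeff G D = 0" "coeff F D = 0" by auto
    then show False
      using bires_nz_imp_no_common_zero[OF roots_exist F G _ nz, of 1 0] D \<open>coeff G D = 0\<close>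
      by (simp add: bform_eval_1_0)
  qed
  have "\<exists>e. e \<noteq> 0 \<and> (\<forall>e'. e' \<noteq> 0 \<longrightarrow> N D (conj_lift D (upper s e) (F, G)) \<le> N D (conj_lift D (upper s e') (F, G)))" for s
    by (rule nrm_upper_attains_min[OF F G D nz, of s]) blast
  then obtain e where e: "\<And>s. e s \<noteq> 0"
    "\<And>s e'. e' \<noteq> 0 \<Longrightarrow> N D (conj_lift D (upper s (e s)) (F, G)) \<le> N D (conj_lift D (upper s e') (F, G))"
    by metis
  define f where "f = (\<lambda>s. N D (conj_lift D (upper s (e s)) (F, G)))"
  obtain s0 where s0: "s0 \<in> S" "\<And>s. s \<in> S \<Longrightarrow> f s0 \<le> f s"
    using ex_min_if_finite[of "f ` S"] finS S0 by (auto simp: not_less)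
  show ?thesis
  proof (rule that[of "upper s0 (e s0)"])
    show "upper s0 (e s0) \<in> sl2" by (rule upper_in_sl2[OF e(1)])
    fix h assume "h \<in> (sl2 :: ('a \<times> 'a \<times> 'a \<times> 'a) set)"
    then obtain \<beta> e1 k where k: "e1 \<noteq> 0" "k \<in> sl2" "integral2 k" "mmult h k = upper \<beta> e1"
      by (rule iwasawa)
    have "\<exists>s\<in>S. \<forall>s'\<in>S. absv (\<beta> - s) \<le> absv (\<beta> - s')"
      using ex_min_if_finite[of "(\<lambda>s. absv (\<beta> - s)) ` S"] finS S0 by (auto simp: not_less)
    then obtain s where s: "s \<in> S" "\<And>s'. s' \<in> S \<Longrightarrow> absv (\<beta> - s) \<le> absv (\<beta> - s')" by blast
    have D1: "D \<ge> 1" using D by simp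
    obtain e' where e': "e' \<noteq> 0" "N D (conj_lift D (upper s e') (F, G)) \<le> N D (conj_lift D (upper \<beta> e1) (F, G))"
      by (rule nrm_upper_root_centre[OF F G D1 k(1), of \<beta> s]) (use s(2) in \<open>auto simp: S_def\<close>)
    have "f s0 \<le> f s" using s0 s by blast
    also have "\<dots> \<le> N D (conj_lift D (upper s e') (F, G))" unfolding f_def by (rule e(2)[OF e'(1)])
    also note e'(2)
    also have "N D (conj_lift D (upper \<beta> e1) (F, G)) = N D (conj_lift D h (F, G))"
      using nrm_conj_mmult_integral[OF k(2,3), of D h "(F, G)"] k(4) by simp
    finally show "N D (conj_lift D (upper s0 (e s0)) (F, G)) \<le> N D (conj_lift D h (F, G))" by (simp add: f_def)
  qed
qed

end

section \<open>Unstable pairs\<close>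

text \<open>The numerical condition of the Hilbert--Mumford criterion: conjugation by diag(t, 1/t) multiplies the coordinate
  with index i by t to the power xdeg - ydeg.\<close>

definition unstable :: "nat \<Rightarrow> 'k::field poly \<times> 'k poly \<Rightarrow> bool" where
  "unstable D v \<longleftrightarrow> (\<exists>h\<in>sl2. \<forall>i<2 * D + 2. ydeg D i \<le> xdeg D i \<longrightarrow> coords D (conj_lift D h v) i = 0)"

section \<open>Cartan decomposition over subrings\<close>

fun entries_in :: "'a set \<Rightarrow> 'a \<times> 'a \<times> 'a \<times> 'a \<Rightarrow> bool" where
  "entries_in A (a, b, c, d) \<longleftrightarrow> a \<in> A \<and> b \<in> A \<and> c \<in> A \<and> d \<in> A"

lemma (in subring) entries_in_mmult: "entries_in A g \<Longrightarrow> entries_in A h \<Longrightarrow> entries_in A (mmult g h)"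
  by (cases g; cases h) (auto intro: add_in mult_in)

lemma (in subring) entries_in_adj2: "entries_in A g \<Longrightarrow> entries_in A (adj2 g)"
  by (cases g) (auto intro: uminus_in)

text \<open>If a divides the other entries, elimination with pivot a uses only quotients in A. The
  determinant gives a^2 (zd - zb zc) = 1, so 1/a lies in A if a does; otherwise comparability of a
  with 1 puts it there directly.\<close>

lemma cartan_dominant:
  fixes A :: "'a::field set"
  assumes "subring A" and det: "a * d - b * c = 1"
    and z: "zb \<in> A" "zc \<in> A" "zd \<in> A" "b = zb * a" "c = zc * a" "d = zd * a"
    and cmp: "\<exists>z\<in>A. a = z \<or> 1 = z * a"
  shows "a \<noteq> 0" "1 / a \<in> A"
    "(a, b, c, d) = mmult (mmult (1, 0, zc, 1) (a, 0, 0, 1 / a)) (1, zb, 0, 1)"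
proof -
  interpret subring A by fact
  show a: "a \<noteq> 0" using det z by auto
  have "a * a * (zd - zb * zc) = 1" using det by (simp add: z(4-6) algebra_simps)
  then have "1 / a = a * (zd - zb * zc)" using a by (simp add: field_simps)
  moreover have "zd - zb * zc \<in> A" using z by (intro diff_in mult_in)
  moreover from cmp obtain w where "w \<in> A" "a = w \<or> 1 = w * a" by blast
  moreover have "1 / a = w" if "1 = w * a" using that a by (simp add: field_simps)
  ultimately show "1 / a \<in> A" using mult_in by fastforce
  have "d = zc * a * zb + 1 / a" using a det by (simp add: z(4,5) field_simps)
  then show "(a, b, c, d) = mmult (mmult (1, 0, zc, 1) (a, 0, 0, 1 / a)) (1, zb, 0, 1)"
    by (simp add: z(4,5) mult.commute)
qed

text \<open>Comparability is asked only of the entries and 1. This covers the valuation ring of K as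
  well as a ring of functions to which finitely many quotients have been adjoined.\<close>

lemma cartan:
  fixes A :: "'a::field set"
  assumes A: "subring A" and det: "a * d - b * c = 1"
    and cmp: "\<And>x y. x \<in> {1, a, b, c, d} \<Longrightarrow> y \<in> {1, a, b, c, d} \<Longrightarrow> \<exists>z\<in>A. x = z * y \<or> y = z * x"
  obtains w \<beta> e U where "w \<in> {(1, 0, 0, 1), (0, - 1, 1, 0)}" "\<beta> \<in> A" "e \<noteq> 0" "1 / e \<in> A" "U \<in> sl2" "entries_in A U"
    "(a, b, c, d) = mmult (mmult (mmult w (1, 0, \<beta>, 1)) (e, 0, 0, 1 / e)) U"
proof -
  interpret subring A by fact
  define dom where "dom x y \<longleftrightarrow> (\<exists>z\<in>A. y = z * x)" for x y
  have total: "dom x y \<or> dom y x" if "x \<in> {1, a, b, c, d}" "y \<in> {1, a, b, c, d}" for x y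
    using cmp[OF that] by (auto simp: dom_def)
  have trans: "dom x z" if "dom x y" "dom y z" for x y z
  proof -
    from that obtain r s where "r \<in> A" "s \<in> A" "y = r * x" "z = s * y" by (auto simp: dom_def)
    then have "s * r \<in> A" "z = (s * r) * x" by (auto intro: mult_in simp: mult.assoc)
    then show ?thesis unfolding dom_def by blast
  qed
  \<comment> \<open>The pivot: an entry dividing all four, found by comparing within each row and
    then the two winners.\<close>
  have "\<exists>m\<in>{a, b, c, d}. dom m a \<and> dom m b \<and> dom m c \<and> dom m d"
  proof -
    obtain p where p: "p \<in> {a, b}" "dom p a" "dom p b" using total[of a b] total[of a a] total[of b b] by auto
    obtain q where q: "q \<in> {c, d}" "dom q c" "dom q d" using total[of c d] total[of c c] total[of d d] by auto
    from p(1) q(1) have "dom p q \<or> dom q p" using total[of p q] by auto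
    then show ?thesis
    proof
      assume "dom p q"
      then show ?thesis using p q trans[of p q] by (intro bexI[of _ p]) auto
    next
      assume "dom q p"
      then show ?thesis using p q trans[of q p] by (intro bexI[of _ q]) auto
    qed
  qed
  then obtain m where m: "m \<in> {a, b, c, d}" "dom m a" "dom m b" "dom m c" "dom m d" by blast
  have cmp1: "\<exists>z\<in>A. m = z \<or> 1 = z * m" using cmp[of m 1] m(1) by auto
  then have cmp2: "\<exists>z\<in>A. - m = z \<or> 1 = z * (- m)"
  proof -
    from cmp1 obtain z where "z \<in> A" "m = z \<or> 1 = z * m" by blast
    then show ?thesis using uminus_in[of z] by (intro bexI[of _ "- z"]) auto
  qed
  obtain za zb zc zd where z: "za \<in> A" "zb \<in> A" "zc \<in> A" "zd \<in> A" "a = za * m" "b = zb * m" "c = zc * m" "d = zd * m"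
    using m(2-5) unfolding dom_def by blast
  have sl: "(1, \<beta>, 0, 1) \<in> sl2" "(0, - 1, 1, 0 :: 'a) \<in> sl2" for \<beta> :: 'a by (auto simp: sl2_def)
  have ent: "\<And>\<beta>. \<beta> \<in> A \<Longrightarrow> entries_in A (1, \<beta>, 0, 1)" "entries_in A (0, - 1, 1, 0)"
    by (auto intro: uminus_in)
  \<comment> \<open>The Weyl element, applied on either side, moves the pivot to the upper left
    corner. On the right it is absorbed into U; on the left it has to be recorded as w.\<close>
  consider "m = a" | "m = b" | "m = c" | "m = d" using m(1) by auto
  then show ?thesis
  proof cases
    case 1
    note * = cartan_dominant[OF A det, of zb zc zd]
    have pre: "zb \<in> A" "zc \<in> A" "zd \<in> A" "b = zb * a" "c = zc * a" "d = zd * a" "\<exists>z\<in>A. a = z \<or> 1 = z * a"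
      using z(2-4,6-8) cmp1 by (simp_all add: 1)
    show ?thesis
    proof (rule that[of "(1, 0, 0, 1)" zc a "(1, zb, 0, 1)"])
      show "(a, b, c, d) = mmult (mmult (mmult (1, 0, 0, 1) (1, 0, zc, 1)) (a, 0, 0, 1 / a)) (1, zb, 0, 1)"
        using *(3)[OF pre] by simp
    qed (use pre(1,2) *(1,2)[OF pre] sl ent in simp_all)
  next
    case 2
    have "(- b) * c - a * (- d) = 1" using det by (simp add: algebra_simps)
    note * = cartan_dominant[OF A this, of "- za" zd "- zc"]
    have pre: "- za \<in> A" "zd \<in> A" "- zc \<in> A" "a = - za * - b" "- d = zd * - b" "c = - zc * - b" "\<exists>z\<in>A. - b = z \<or> 1 = z * - b"
      using z(1,3-5,7,8) uminus_in cmp2 by (simp_all add: 2)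
    show ?thesis
    proof (rule that[of "(1, 0, 0, 1)" zd "- b" "mmult (1, - za, 0, 1) (0, - 1, 1, 0)"])
      have "(a, b, c, d) = mmult (- b, a, - d, c) (0, - 1, 1, 0)" by simp
      also note *(3)[OF pre]
      finally show "(a, b, c, d) = mmult (mmult (mmult (1, 0, 0, 1) (1, 0, zd, 1)) (- b, 0, 0, 1 / - b)) (mmult (1, - za, 0, 1) (0, - 1, 1, 0))"
        by (simp only: mmult_assoc) simp
    qed (use pre(1,2) *(1,2)[OF pre] sl ent in \<open>simp_all add: mmult_in_sl2 entries_in_mmult del: mmult.simps entries_in.simps\<close>)
  next
    case 3
    have "c * (- b) - d * (- a) = 1" using det by (simp add: algebra_simps)
    note * = cartan_dominant[OF A this, of zd "- za" "- zb"]
    have pre: "zd \<in> A" "- za \<in> A" "- zb \<in> A" "d = zd * c" "- a = - za * c" "- b = - zb * c" "\<exists>z\<in>A. c = z \<or> 1 = z * c"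
      using z(1,2,4-6,8) uminus_in cmp1 by (simp_all add: 3)
    show ?thesis
    proof (rule that[of "(0, - 1, 1, 0)" "- za" c "(1, zd, 0, 1)"])
      have "(a, b, c, d) = mmult (0, - 1, 1, 0) (c, d, - a, - b)" by simp
      also note *(3)[OF pre]
      finally show "(a, b, c, d) = mmult (mmult (mmult (0, - 1, 1, 0) (1, 0, - za, 1)) (c, 0, 0, 1 / c)) (1, zd, 0, 1)"
        by (simp only: mmult_assoc)
    qed (use pre(1,2) *(1,2)[OF pre] sl ent in simp_all)
  next
    case 4
    have "(- d) * (- a) - c * b = 1" using det by (simp add: algebra_simps)
    note * = cartan_dominant[OF A this, of "- zc" "- zb" za]
    have pre: "- zc \<in> A" "- zb \<in> A" "za \<in> A" "c = - zc * - d" "b = - zb * - d" "- a = za * - d" "\<exists>z\<in>A. - d = z \<or> 1 = z * - d"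
      using z(1-3,5-7) uminus_in cmp2 by (simp_all add: 4)
    show ?thesis
    proof (rule that[of "(0, - 1, 1, 0)" "- zb" "- d" "mmult (1, - zc, 0, 1) (0, - 1, 1, 0)"])
      have "(a, b, c, d) = mmult (0, - 1, 1, 0) (mmult (- d, c, b, - a) (0, - 1, 1, 0))" by simp
      also note *(3)[OF pre]
      finally show "(a, b, c, d) = mmult (mmult (mmult (0, - 1, 1, 0) (1, 0, - zb, 1)) (- d, 0, 0, 1 / - d)) (mmult (1, - zc, 0, 1) (0, - 1, 1, 0))"
        by (simp only: mmult_assoc)
    qed (use pre(1,2) *(1,2)[OF pre] sl ent in \<open>simp_all add: mmult_in_sl2 entries_in_mmult del: mmult.simps entries_in.simps\<close>)
  qed
qed

context valued_field
begin

lemma integral2_iff: "integral2 g \<longleftrightarrow> entries_in O_v g"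
  by (cases g) (simp add: integral2_def O_v_def)

section \<open>Instability of the reduction in terms of norms over K\<close>

fun red2 :: "'a \<times> 'a \<times> 'a \<times> 'a \<Rightarrow> 'k \<times> 'k \<times> 'k \<times> 'k" where
  "red2 (a, b, c, d) = (red a, red b, red c, red d)"

lemma red2_in_sl2:
  assumes "g \<in> sl2" "integral2 g"
  shows "red2 g \<in> sl2"
proof -
  obtain a b c d where g: "g = (a, b, c, d)" by (cases g)
  have in_O: "a \<in> O_v" "b \<in> O_v" "c \<in> O_v" "d \<in> O_v" using assms by (auto simp: g integral2_def O_v_def)
  have "red (a * d - b * c) = red a * red d - red b * red c"
    using in_O by (simp add: red.hom_diff red.hom_mult red.mult_in)
  then show ?thesis using assms by (simp add: g sl2_def)
qed

text \<open>Arbitrary integral lifts of the entries have a determinant \<delta> with reduction 1;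
  dividing the first row by \<delta> corrects it without changing the reduction.\<close>

lemma sl2_lift:
  assumes "h \<in> sl2"
  obtains g where "g \<in> sl2" "integral2 g" "red2 g = h"
proof -
  obtain a b c d where h: "h = (a, b, c, d)" by (cases h)
  obtain s where s: "\<And>y. absv (s y) \<le> 1" "\<And>y. red (s y) = y" using red_lift by metis
  have s': "s y \<in> O_v" for y by (simp add: O_v_def s)
  define \<delta> where "\<delta> = s a * s d - s b * s c"
  have d_in: "\<delta> \<in> O_v" unfolding \<delta>_def by (intro red.diff_in red.mult_in s')
  have "red \<delta> = a * d - b * c"
    unfolding \<delta>_def by (simp add: red.hom_diff red.hom_mult red.mult_in s' s)
  then have red_d: "red \<delta> = 1" using assms by (simp add: h sl2_def)
  then have "absv \<delta> = 1" using d_in red_eq_0_iff[of \<delta>] by (auto simp: O_v_def)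
  then have d0: "\<delta> \<noteq> 0" and inv_in: "inverse \<delta> \<in> O_v" by (auto simp: O_v_def absv_inverse)
  have "red \<delta> * red (inverse \<delta>) = 1"
    using red.hom_mult[OF d_in inv_in] d0 by simp
  then have red_inv: "red (inverse \<delta>) = 1" using red_d by simp
  show ?thesis
  proof (rule that[of "(inverse \<delta> * s a, inverse \<delta> * s b, s c, s d)"])
    have "inverse \<delta> * s a * s d - inverse \<delta> * s b * s c = inverse \<delta> * \<delta>"
      by (simp add: \<delta>_def algebra_simps)
    then show "(inverse \<delta> * s a, inverse \<delta> * s b, s c, s d) \<in> sl2" using d0 by (simp add: sl2_def)
    show "integral2 (inverse \<delta> * s a, inverse \<delta> * s b, s c, s d)"
      using inv_in s' by (simp add: integral2_iff red.mult_in)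
    show "red2 (inverse \<delta> * s a, inverse \<delta> * s b, s c, s d) = h"
      using inv_in s' by (simp add: h red.hom_mult red_inv s)
  qed
qed

lemma coeffs_in_O_v:
  assumes "degree F \<le> D" "degree G \<le> D" "N D (F, G) \<le> 1"
  shows "coeffs_in O_v F" "coeffs_in O_v G"
proof -
  have "absv (coords D (F, G) i) \<le> 1" if "i < 2 * D + 2" for i using assms(3) that by (simp add: nrm_le_iff)
  note * = this
  have "absv (coeff F i) \<le> 1" for i
    using *[of i] assms(1) by (cases "i \<le> D") (auto simp: coords_def coeff_eq_0)
  then show "coeffs_in O_v F" by (simp add: coeffs_in_def O_v_def)
  have "absv (coeff G i) \<le> 1" for i
    using *[of "i + D + 1"] assms(2) by (cases "i \<le> D") (auto simp: coords_def coeff_eq_0)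
  then show "coeffs_in O_v G" by (simp add: coeffs_in_def O_v_def)
qed

lemma red_coords_conj:
  assumes FG: "degree F \<le> D" "degree G \<le> D" "N D (F, G) \<le> 1" and h: "integral2 h"
  shows "coords D (conj_lift D (red2 h) (map_pair red (F, G))) i = red (coords D (conj_lift D h (F, G)) i)"
proof -
  obtain a b c d where hh: "h = (a, b, c, d)" by (cases h)
  have "map_pair red (conj_lift D h (F, G)) = conj_lift D (red2 h) (map_pair red (F, G))"
    using h red.map_pair_conj_lift[OF coeffs_in_O_v[OF FG], of a b c d D] by (simp add: hh integral2_iff)
  then show ?thesis using red.coords_map_pair[of D "conj_lift D h (F, G)" i] by simp
qed

text \<open>If some conjugate has norm below 1, write g = h diag(e, 1/e) U by Cartan with |e| \<ge>
  1. U does not affect the norm, and the diagonal factor does not shrink coordinates with ydeg \<le>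
  xdeg, so those are below 1 already after h. Conversely, lift the destabilising matrix and follow
  it by diag(e, 1/e) with |e| slightly above 1.\<close>

theorem unstable_red_iff:
  assumes F: "degree F \<le> D" and G: "degree G \<le> D" and N1: "N D (F, G) \<le> 1"
  shows "unstable D (map_pair red (F, G)) \<longleftrightarrow> (\<exists>g\<in>sl2. N D (conj_lift D g (F, G)) < 1)"
proof
  assume "\<exists>g\<in>sl2. N D (conj_lift D g (F, G)) < 1"
  then obtain g where g: "g \<in> sl2" "N D (conj_lift D g (F, G)) < 1" by blast
  obtain a b c d where gg: "g = (a, b, c, d)" by (cases g)
  have det: "a * d - b * c = 1" using g by (simp add: gg sl2_def)
  have cmp: "\<exists>z\<in>O_v. x = z * y \<or> y = z * x" for x y
  proof (cases "absv x \<le> absv y")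
    case True
    show ?thesis
    proof (cases "y = 0")
      case False
      then show ?thesis using True by (intro bexI[of _ "x / y"]) (auto simp: O_v_def absv_divide)
    qed (auto intro: bexI[of _ 0])
  next
    case False
    then have "x \<noteq> 0" by auto
    then show ?thesis using False by (intro bexI[of _ "y / x"]) (auto simp: O_v_def absv_divide)
  qed
  obtain w \<beta> e U where C: "w \<in> {(1, 0, 0, 1), (0, - 1, 1, 0)}" "\<beta> \<in> O_v" "e \<noteq> 0" "1 / e \<in> O_v" "U \<in> sl2" "entries_in O_v U"
    "(a, b, c, d) = mmult (mmult (mmult w (1, 0, \<beta>, 1)) (e, 0, 0, 1 / e)) U"
    by (rule cartan[OF red.subring_axioms det cmp])
  define h where "h = mmult w (1, 0, \<beta>, 1)"
  have w: "w \<in> sl2" "entries_in O_v w" using C(1) by (auto simp: sl2_def O_v_def)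
  have "(1, 0, \<beta>, 1) \<in> sl2" "entries_in O_v (1, 0, \<beta>, 1)" using C(2) by (auto simp: sl2_def)
  then have h: "h \<in> sl2" "integral2 h"
    unfolding h_def integral2_iff using w mmult_in_sl2 red.entries_in_mmult by blast+
  have e1: "absv e \<ge> 1" using C(3,4) by (simp add: O_v_def absv_divide)
  have "N D (conj_lift D (mmult h (e, 0, 0, 1 / e)) (F, G)) < 1"
    using nrm_conj_mmult_integral[OF C(5), of D "mmult h (e, 0, 0, 1 / e)" "(F, G)"] C(6,7) g(2)
    by (simp add: integral2_iff gg h_def del: mmult.simps)
  then have small: "absv (e ^ xdeg D i * (1 / e) ^ ydeg D i * coords D (conj_lift D h (F, G)) i) < 1"
    if "i < 2 * D + 2" for i
    using that unfolding nrm_less_iff conj_lift_mmult[symmetric] by (simp add: coords_conj_diag)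
  have "red (coords D (conj_lift D h (F, G)) i) = 0" if i: "i < 2 * D + 2" "ydeg D i \<le> xdeg D i" for i
  proof -
    let ?c = "coords D (conj_lift D h (F, G)) i"
    have "absv (e ^ xdeg D i * (1 / e) ^ ydeg D i) = absv e ^ (xdeg D i - ydeg D i)"
      using C(3) i by (simp add: absv_mult absv_power absv_divide power_diff power_one_over)
    then have "absv e ^ (xdeg D i - ydeg D i) * absv ?c < 1"
      using small[OF i(1)] by (simp add: absv_mult)
    moreover have "absv ?c \<le> absv e ^ (xdeg D i - ydeg D i) * absv ?c"
      using mult_right_mono[OF one_le_power[OF e1], of "absv ?c"] by simp
    ultimately have "absv ?c < 1" by linarith
    then show ?thesis by (simp add: red_eq_0_iff)
  qed
  then show "unstable D (map_pair red (F, G))"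
    unfolding unstable_def using red2_in_sl2[OF h] red_coords_conj[OF F G N1 h(2)]
    by (intro bexI[of _ "red2 h"]) auto
next
  assume "unstable D (map_pair red (F, G))"
  then obtain h' where h': "h' \<in> sl2" "\<And>i. i < 2 * D + 2 \<Longrightarrow> ydeg D i \<le> xdeg D i \<Longrightarrow> coords D (conj_lift D h' (map_pair red (F, G))) i = 0"
    unfolding unstable_def by blast
  obtain h where h: "h \<in> sl2" "integral2 h" "red2 h = h'" by (rule sl2_lift[OF h'(1)])
  let ?c = "coords D (conj_lift D h (F, G))"
  have c1: "absv (?c i) \<le> 1" if "i < 2 * D + 2" for i
    using nrm_ge[OF that, of "conj_lift D h (F, G)"] nrm_conj_integral[OF h(1,2) F G] N1 by linarith
  have c2: "absv (?c i) < 1" if "i < 2 * D + 2" "ydeg D i \<le> xdeg D i" for i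
    using h'(2)[OF that] red_coords_conj[OF F G N1 h(2), of i] c1[OF that(1)] by (simp add: h(3) red_eq_0_iff)
  define \<rho> where "\<rho> = Max (insert 0 ((\<lambda>i. absv (?c i)) ` {i. i < 2 * D + 2 \<and> ydeg D i \<le> xdeg D i}))"
  have \<rho>: "0 \<le> \<rho>" "\<rho> < 1" "\<And>i. i < 2 * D + 2 \<Longrightarrow> ydeg D i \<le> xdeg D i \<Longrightarrow> absv (?c i) \<le> \<rho>"
    unfolding \<rho>_def using c2 by (auto intro!: Max_ge)
  obtain x where x: "absv x > 1" using ex_absv_gt_1 by blast
  have "(\<lambda>n. absv x ^ (D + 1) * \<rho> ^ n) \<longlonglongrightarrow> absv x ^ (D + 1) * 0"
    using \<rho> by (intro tendsto_mult tendsto_const LIMSEQ_power_zero) auto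
  then have "\<forall>\<^sub>F n in sequentially. absv x ^ (D + 1) * \<rho> ^ n < 1"
    by (rule order_tendstoD) simp
  then obtain n0 where n0: "\<And>n. n \<ge> n0 \<Longrightarrow> absv x ^ (D + 1) * \<rho> ^ n < 1"
    unfolding eventually_sequentially by blast
  define n where "n = Suc n0"
  \<comment> \<open>The coordinates with ydeg \<le> xdeg are at most \<rho> < 1 and grow by at most
    |e|^(D + 1). A root of high order of an element of absolute value above 1 brings |e| close
    enough to 1.\<close>
  obtain e where e: "e ^ n = x" using ex_nth_root[of n x] by (auto simp: n_def)
  have e1: "absv e > 1"
  proof (rule ccontr)
    assume "\<not> absv e > 1"
    then have "absv e ^ n \<le> 1" by (intro power_le_one) auto
    then show False using x e by (simp flip: absv_power)
  qed
  then have e0: "e \<noteq> 0" by auto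
  have small: "absv e ^ (D + 1) * \<rho> < 1"
  proof (rule ccontr)
    assume "\<not> absv e ^ (D + 1) * \<rho> < 1"
    then have "1 \<le> (absv e ^ (D + 1) * \<rho>) ^ n" by (intro one_le_power) simp
    also have "\<dots> = absv (e ^ n) ^ (D + 1) * \<rho> ^ n"
      by (simp add: power_mult_distrib absv_power mult.commute flip: power_mult power_Suc)
    also have "\<dots> < 1" using n0[of n] e by (simp add: n_def)
    finally show False by simp
  qed
  have "N D (conj_lift D (mmult h (e, 0, 0, 1 / e)) (F, G)) < 1"
    unfolding nrm_less_iff
  proof (intro allI impI)
    fix i assume i: "i < 2 * D + 2"
    have eq: "absv (coords D (conj_lift D (mmult h (e, 0, 0, 1 / e)) (F, G)) i) =
        absv e ^ xdeg D i / absv e ^ ydeg D i * absv (?c i)"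
      unfolding conj_lift_mmult[symmetric] using i
      by (simp add: coords_conj_diag absv_mult absv_power absv_divide power_one_over)
    show "absv (coords D (conj_lift D (mmult h (e, 0, 0, 1 / e)) (F, G)) i) < 1"
    proof (cases "ydeg D i \<le> xdeg D i")
      case True
      have "absv e ^ xdeg D i / absv e ^ ydeg D i = absv e ^ (xdeg D i - ydeg D i)"
        using True e0 by (simp add: power_diff)
      also have "\<dots> \<le> absv e ^ (D + 1)"
        using e1 i by (intro power_increasing) (auto simp: xdeg_def)
      finally have "absv e ^ xdeg D i / absv e ^ ydeg D i * absv (?c i) \<le> absv e ^ (D + 1) * \<rho>"
        using \<rho>(3)[OF i True] by (intro mult_mono) auto
      then show ?thesis using small eq by linarith
    next
      case False
      have "absv e ^ xdeg D i / absv e ^ ydeg D i < 1"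
        using False e1 e0 by (simp add: power_strict_increasing)
      then have "absv e ^ xdeg D i / absv e ^ ydeg D i * absv (?c i) < 1"
        using c1[OF i] mult_left_mono[OF c1[OF i], of "absv e ^ xdeg D i / absv e ^ ydeg D i"] by simp
      then show ?thesis using eq by simp
    qed
  qed
  moreover have "mmult h (e, 0, 0, 1 / e) \<in> sl2"
    using h(1) e0 by (intro mmult_in_sl2) (auto simp: sl2_def)
  ultimately show "\<exists>g\<in>sl2. N D (conj_lift D g (F, G)) < 1" by blast
qed

end

text \<open>Over a finite field, 1 plus the product of all X - a has no zero.\<close>

lemma roots_exist_imp_infinite:
  assumes "roots_exist TYPE('k::field)"
  shows "infinite (UNIV :: 'k set)"
proof
  assume fin: "finite (UNIV :: 'k set)"
  define p where "p = (\<Prod>a\<in>(UNIV :: 'k set). [:- a, 1:])"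
  have "degree p = (\<Sum>a\<in>(UNIV :: 'k set). degree [:- a, 1:])"
    unfolding p_def by (rule degree_prod_eq_sum_degree) auto
  then have "degree p = card (UNIV :: 'k set)" by simp
  then have dp: "degree p \<ge> 1" using fin by (simp add: Suc_leI card_gt_0_iff)
  then have "degree (p + 1) = degree p" by (intro degree_add_eq_left) simp
  then obtain x where "poly (p + 1) x = 0" using assms dp unfolding roots_exist_def by metis
  moreover have "poly p x = 0" unfolding p_def poly_prod using fin by (intro prod_zero) (auto intro: bexI[of _ x])
  ultimately show False by simp
qed

lemma poly_eqI_infinite:
  fixes p q :: "'k::field poly"
  assumes "infinite {x. poly p x = poly q x}"
  shows "p = q"
proof -
  have "{x. poly p x = poly q x} = {x. poly (p - q) x = 0}" by auto
  then have "p - q = 0" using assms poly_roots_finite[of "p - q"] by auto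
  then show ?thesis by simp
qed

section \<open>The easy half of Hilbert--Mumford\<close>

lemma prod_power_scale:
  "(\<Prod>i<M. (t ^ n i * x i) ^ \<alpha> i) = (\<Prod>i<M. x i ^ \<alpha> i) * (t :: 'a::comm_monoid_mult) ^ (\<Sum>i<M. n i * \<alpha> i)"
  by (simp only: power_mult_distrib prod.distrib power_sum power_mult mult.commute[of "\<Prod>i<M. x i ^ \<alpha> i"])

text \<open>After a destabilising conjugation, diag(1/t, t) multiplies every nonzero coordinate by a
  positive power of t. An invariant of positive degree is then a polynomial in t without constant
  term, yet constant for t \<noteq> 0, hence 0.\<close>

theorem semistable_imp_not_unstable:
  fixes F G :: "'k::field poly"
  assumes inf: "infinite (UNIV :: 'k set)" and F: "degree F \<le> D" and G: "degree G \<le> D" and ss: "semistable D (F, G)"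
  shows "\<not> unstable D (F, G)"
proof
  assume "unstable D (F, G)"
  then obtain h where h: "h \<in> sl2" "\<And>i. i < 2 * D + 2 \<Longrightarrow> ydeg D i \<le> xdeg D i \<Longrightarrow> coords D (conj_lift D h (F, G)) i = 0"
    unfolding unstable_def by blast
  obtain F' G' where FG': "conj_lift D h (F, G) = (F', G')" by (cases "conj_lift D h (F, G)")
  have deg': "degree F' \<le> D" "degree G' \<le> D" using degree_conj_lift[of D h "(F, G)"] FG' by auto
  from ss obtain m S c where *: "m > 0 \<and> finite S \<and>
        (\<forall>\<alpha>\<in>S. (\<forall>i\<ge>2 * D + 2. \<alpha> i = 0) \<and> (\<Sum>i<2 * D + 2. \<alpha> i) = m) \<and>
        (\<forall>g\<in>sl2. \<forall>F G. degree F \<le> D \<longrightarrow> degree G \<le> D \<longrightarrow>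
            mp_eval (2 * D + 2) S c (coords D (conj_lift D g (F, G)))
              = mp_eval (2 * D + 2) S c (coords D (F, G))) \<and>
        mp_eval (2 * D + 2) S c (coords D (F, G)) \<noteq> 0"
    unfolding semistable_def by (elim exE)
  then have S: "m > 0" "finite S" "\<And>\<alpha>. \<alpha> \<in> S \<Longrightarrow> (\<Sum>i<2 * D + 2. \<alpha> i) = m"
    and nz: "mp_eval (2 * D + 2) S c (coords D (F, G)) \<noteq> 0" by auto
  have inv: "mp_eval (2 * D + 2) S c (coords D (conj_lift D g (F, G))) = mp_eval (2 * D + 2) S c (coords D (F, G))"
    if "g \<in> sl2" "degree F \<le> D" "degree G \<le> D" for g F G
    using * that by blast
  let ?c = "coords D (F', G')"
  \<comment> \<open>The subtraction is truncated: where ydeg \<le> xdeg it yields 0, which is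
    harmless because those coordinates vanish.\<close>
  define n where "n = (\<lambda>i. ydeg D i - xdeg D i)"
  define co where "co = (\<lambda>\<alpha>. c \<alpha> * (\<Prod>i<2 * D + 2. ?c i ^ \<alpha> i))"
  define p where "p = (\<Sum>\<alpha>\<in>S. monom (co \<alpha>) (\<Sum>i<2 * D + 2. n i * \<alpha> i))"
  let ?v = "mp_eval (2 * D + 2) S c (coords D (F, G))"
  have "poly p t = ?v" if t: "t \<noteq> 0" for t
  proof -
    have "(1 / t, 0, 0, t) \<in> sl2" using t by (simp add: sl2_def)
    then have "mp_eval (2 * D + 2) S c (coords D (conj_lift D (1 / t, 0, 0, t) (F', G'))) = ?v"
      using inv[OF _ deg'] inv[OF h(1) F G] by (simp add: FG')
    moreover have "coords D (conj_lift D (1 / t, 0, 0, t) (F', G')) i = t ^ n i * ?c i" if i: "i < 2 * D + 2" for i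
    proof (cases "ydeg D i \<le> xdeg D i")
      case True
      then show ?thesis using h(2)[OF i True] i by (simp add: coords_conj_diag FG')
    next
      case False
      then have "(1 / t) ^ xdeg D i * t ^ ydeg D i = t ^ n i"
        using t by (simp add: n_def power_diff power_one_over)
      then show ?thesis using i by (simp add: coords_conj_diag)
    qed
    ultimately have "?v = (\<Sum>\<alpha>\<in>S. c \<alpha> * (\<Prod>i<2 * D + 2. (t ^ n i * ?c i) ^ \<alpha> i))"
      by (simp add: mp_eval_def)
    also have "\<dots> = (\<Sum>\<alpha>\<in>S. co \<alpha> * t ^ (\<Sum>i<2 * D + 2. n i * \<alpha> i))"
      unfolding co_def prod_power_scale by (simp only: mult_ac)
    finally show ?thesis by (simp add: p_def poly_sum poly_monom)
  qed
  then have "UNIV - {0} \<subseteq> {t. poly p t = poly [:?v:] t}" by auto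
  moreover have "infinite (UNIV - {0 :: 'k})" using inf by simp
  ultimately have "p = [:?v:]" by (intro poly_eqI_infinite) (metis finite_subset)
  then have "coeff p 0 = ?v" by simp
  moreover have "coeff p 0 = 0"
    unfolding p_def coeff_sum
  proof (rule sum.neutral, rule ballI)
    fix \<alpha> assume \<alpha>: "\<alpha> \<in> S"
    show "coeff (monom (co \<alpha>) (\<Sum>i<2 * D + 2. n i * \<alpha> i)) 0 = 0"
    proof (cases "(\<Sum>i<2 * D + 2. n i * \<alpha> i) = 0")
      case True
      \<comment> \<open>A monomial of t-exponent 0 still has positive degree m, so it contains a
        variable with n i = 0, and that coordinate vanishes.\<close>
      have "\<exists>i<2 * D + 2. \<alpha> i \<noteq> 0"
      proof (rule ccontr)
        assume "\<not> ?thesis"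
        then have "(\<Sum>i<2 * D + 2. \<alpha> i) = 0" by simp
        then show False using S(3)[OF \<alpha>] S(1) by simp
      qed
      then obtain i where i: "i < 2 * D + 2" "\<alpha> i \<noteq> 0" by blast
      have "\<forall>j\<in>{..<2 * D + 2}. n j * \<alpha> j = 0"
        using True unfolding sum_eq_0_iff[OF finite_lessThan] .
      then have "n i * \<alpha> i = 0" using i(1) by blast
      then have "n i = 0" using i(2) by simp
      then have "?c i = 0" using h(2)[OF i(1)] by (simp add: n_def FG')
      then have "?c i ^ \<alpha> i = 0" using i(2) by simp
      then have "(\<Prod>i<2 * D + 2. ?c i ^ \<alpha> i) = 0"
        using i(1) by (intro prod_zero[OF finite_lessThan]) blast
      then have "co \<alpha> = 0" unfolding co_def by (simp only: mult_zero_right)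
      then show ?thesis by (simp only: monom_0 coeff_0 monom_eq_0)
    next
      case False
      then show ?thesis by (simp only: coeff_monom if_False)
    qed
  qed
  ultimately show False using nz by simp
qed

section \<open>Ideals not containing 1\<close>

definition proper_ideal :: "'a::field set \<Rightarrow> 'a set \<Rightarrow> bool" where
  "proper_ideal A I \<longleftrightarrow> subring A \<and> 0 \<in> I \<and> (\<forall>x\<in>I. \<forall>y\<in>I. x + y \<in> I) \<and> (\<forall>r\<in>A. \<forall>x\<in>I. r * x \<in> I) \<and> 1 \<notin> I"

text \<open>Chevalley's cancellation. Let w be the constant term of q. Multiplying q(1/z) = 1 by z^n
  expresses (1 - w) z^n through lower powers of z with coefficients in I, and this replaces the top
  term of p.\<close>

lemma adjoin_reduce_degree:
  fixes A :: "'a::field set"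
  assumes A: "subring A" and I: "0 \<in> I" "\<And>x y. x \<in> I \<Longrightarrow> y \<in> I \<Longrightarrow> x + y \<in> I" "\<And>r x. r \<in> A \<Longrightarrow> x \<in> I \<Longrightarrow> r * x \<in> I" "I \<subseteq> A"
    and z: "z \<noteq> 0" and p: "coeffs_in I p" "poly p z = 1" and q: "coeffs_in I q" "poly q (1 / z) = 1"
    and n: "degree p \<ge> 1" "degree q \<le> degree p"
  shows "\<exists>r. coeffs_in I r \<and> poly r z = 1 \<and> degree r < degree p"
proof -
  interpret subring A by fact
  define n where "n = degree p"
  define u where "u = coeff p n"
  define w where "w = coeff q 0"
  define s where "s = (\<Sum>j\<in>{1..n}. monom (coeff q j) (n - j))"
  \<comment> \<open>The element 1 - w may fail to be a unit, so p is multiplied by it and w added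
    back: the value at z is (1 - w)(1 - u z^n) + u (1 - w) z^n + w = 1.\<close>
  define r where "r = smult (1 - w) (p - monom u n) + smult u s + [:w:]"
  have pI: "coeff p i \<in> I" and qI: "coeff q i \<in> I" for i using p q by (auto simp: coeffs_in_def)
  have "u \<in> I" "w \<in> I" using pI qI by (auto simp: u_def w_def)
  then have uA: "u \<in> A" and wA: "1 - w \<in> A" using I(4) by (auto intro: diff_in)
  have sI: "coeff s i \<in> I" for i
  proof -
    have "(\<Sum>j\<in>T. if n - j = i then coeff q j else 0) \<in> I" for T :: "nat set"
      by (induction T rule: infinite_finite_induct) (auto intro: I qI)
    then show ?thesis by (simp add: s_def coeff_sum)
  qed
  have "coeffs_in I r"
    unfolding coeffs_in_def
  proof
    fix i
    have "coeff (p - monom u n) i \<in> I" using pI[of i] I(1) by (auto simp: u_def)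
    then have "(1 - w) * coeff (p - monom u n) i + u * coeff s i \<in> I" using I wA uA sI by blast
    moreover have "coeff [:w:] i \<in> I" using qI[of 0] I(1) by (auto simp: w_def coeff_pCons split: nat.split)
    ultimately show "coeff r i \<in> I" unfolding r_def coeff_add coeff_smult by (rule I(2))
  qed
  moreover have "poly r z = 1"
  proof -
    have "z ^ n = z ^ n * poly q (1 / z)" using q by simp
    also have "poly q (1 / z) = (\<Sum>j\<le>n. coeff q j * (1 / z) ^ j)"
      unfolding poly_altdef using n by (intro sum.mono_neutral_left) (auto simp: n_def coeff_eq_0)
    also have "z ^ n * \<dots> = (\<Sum>j\<le>n. coeff q j * z ^ (n - j))"
      unfolding sum_distrib_left using z by (intro sum.cong) (auto simp: power_diff power_one_over)
    also have "\<dots> = coeff q 0 * z ^ n + (\<Sum>j\<in>{1..n}. coeff q j * z ^ (n - j))"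
      by (simp add: sum.atLeast_Suc_atMost atMost_atLeast0)
    finally have "(\<Sum>j\<in>{1..n}. coeff q j * z ^ (n - j)) = z ^ n - w * z ^ n"
      by (simp add: w_def eq_diff_eq add.commute)
    then have "poly s z = z ^ n - w * z ^ n" by (simp add: s_def poly_sum poly_monom)
    then have "u * poly s z = u * z ^ n - u * (w * z ^ n)" by (simp add: right_diff_distrib)
    then show ?thesis using p by (simp add: r_def poly_monom algebra_simps)
  qed
  moreover have "degree r < n"
  proof -
    have n1: "n \<ge> 1" using n by (simp add: n_def)
    have "degree r \<le> n - 1"
    proof (rule degree_le, intro allI impI)
      fix i assume i: "n - 1 < i"
      have "coeff (p - monom u n) i = 0"
        using i by (cases "i = n") (auto simp: u_def n_def coeff_eq_0)
      moreover have "coeff s i = 0"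
        unfolding s_def coeff_sum using i by (intro sum.neutral) auto
      moreover have "coeff [:w:] i = 0" using i n1 by (cases i) auto
      ultimately show "coeff r i = 0" unfolding r_def coeff_add coeff_smult by simp
    qed
    then show ?thesis using n1 by linarith
  qed
  ultimately show ?thesis unfolding n_def by blast
qed

lemma one_in_adjoin_both:
  fixes A :: "'a::field set"
  assumes A: "subring A" and I: "0 \<in> I" "\<And>x y. x \<in> I \<Longrightarrow> y \<in> I \<Longrightarrow> x + y \<in> I" "\<And>r x. r \<in> A \<Longrightarrow> x \<in> I \<Longrightarrow> r * x \<in> I" "I \<subseteq> A"
    and z: "z \<noteq> 0" and p: "coeffs_in I p" "poly p z = 1" and q: "coeffs_in I q" "poly q (1 / z) = 1"
  shows "1 \<in> I"
  using p q
proof (induction "degree p + degree q" arbitrary: p q rule: less_induct)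
  case less
  have const: "1 \<in> I" if "degree r = 0" "poly r y = 1" "coeffs_in I r" for r y
  proof -
    obtain c where "r = [:c:]" using \<open>degree r = 0\<close> by (metis degree_eq_zeroE)
    then show ?thesis using that by (force simp: coeffs_in_def dest: spec[of _ 0])
  qed
  consider "degree p = 0" | "degree q = 0" | "degree p \<ge> 1" "degree q \<le> degree p" | "degree q \<ge> 1" "degree p \<le> degree q"
    by linarith
  then show ?case
  proof cases
    case 3
    obtain r where "coeffs_in I r" "poly r z = 1" "degree r < degree p"
      using adjoin_reduce_degree[OF A I z less(2-5) 3] by blast
    then show ?thesis using less(1)[of r q] less(4,5) by simp
  next
    case 4
    have "1 / z \<noteq> 0" "poly p (1 / (1 / z)) = 1" using z less by auto
    then obtain r where "coeffs_in I r" "poly r (1 / z) = 1" "degree r < degree q"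
      using adjoin_reduce_degree[OF A I _ less(4,5) less(2) _ 4] by blast
    then show ?thesis using less(1)[of p r] less(2,3) by simp
  qed (use const less in blast)+
qed

text \<open>The extension step in Chevalley's construction of valuation rings: the ideal generated
  by I stays proper in A[z] or in A[1/z], since relations p(z) = 1 and q(1/z) = 1 together would
  reduce to 1 in I.\<close>

lemma proper_ideal_adjoin:
  fixes A :: "'a::field set"
  assumes AI: "proper_ideal A I" "I \<subseteq> A" and z: "z \<noteq> 0"
  shows "\<exists>A' I'. proper_ideal A' I' \<and> I' \<subseteq> A' \<and> A \<subseteq> A' \<and> I \<subseteq> I' \<and> (z \<in> A' \<or> 1 / z \<in> A')"
proof -
  have A: "subring A" and I: "0 \<in> I" "\<And>x y. x \<in> I \<Longrightarrow> y \<in> I \<Longrightarrow> x + y \<in> I" "\<And>r x. r \<in> A \<Longrightarrow> x \<in> I \<Longrightarrow> r * x \<in> I"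
    and one: "1 \<notin> I" using AI(1) unfolding proper_ideal_def by auto
  interpret subring A by fact
  \<comment> \<open>\<open>adj y B\<close> is B[y]: all values at y of polynomials with coefficients
    in B.\<close>
  define adj where "adj = (\<lambda>(y :: 'a) B. (\<lambda>p. poly p y) ` {p. coeffs_in B p})"
  have sumI: "(\<And>i. i \<in> T \<Longrightarrow> f i \<in> I) \<Longrightarrow> sum f T \<in> I" for f and T :: "nat set"
    by (induction T rule: infinite_finite_induct) (auto intro: I)
  have main: "proper_ideal (adj y A) (adj y I) \<and> adj y I \<subseteq> adj y A \<and> A \<subseteq> adj y A \<and> I \<subseteq> adj y I \<and> y \<in> adj y A"
    if "1 \<notin> adj y I" for y
  proof -
    have const: "B \<subseteq> adj y B" if "0 \<in> B" for B
    proof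
      fix b assume "b \<in> B"
      then show "b \<in> adj y B" unfolding adj_def using that
        by (intro image_eqI[of _ _ "[:b:]"]) (auto simp: coeffs_in_def coeff_pCons split: nat.split)
    qed
    have "subring (adj y A)"
    proof
      show "0 \<in> adj y A" "1 \<in> adj y A" using const[of A] by auto
      fix a b assume "a \<in> adj y A" "b \<in> adj y A"
      then obtain p q where pq: "coeffs_in A p" "coeffs_in A q" "a = poly p y" "b = poly q y" by (auto simp: adj_def)
      show "a + b \<in> adj y A" unfolding adj_def using pq by (intro image_eqI[of _ _ "p + q"]) (auto intro: coeffs_in_add)
      show "a * b \<in> adj y A" unfolding adj_def using pq by (intro image_eqI[of _ _ "p * q"]) (auto intro: coeffs_in_mult)
      show "- a \<in> adj y A" unfolding adj_def using pq
        by (intro image_eqI[of _ _ "- p"]) (auto simp: coeffs_in_def intro: uminus_in)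
    qed
    moreover have "a + b \<in> adj y I" if "a \<in> adj y I" "b \<in> adj y I" for a b
    proof -
      from that obtain p q where pq: "coeffs_in I p" "coeffs_in I q" "a = poly p y" "b = poly q y" by (auto simp: adj_def)
      then show ?thesis unfolding adj_def by (intro image_eqI[of _ _ "p + q"]) (auto simp: coeffs_in_def I)
    qed
    moreover have "a * b \<in> adj y I" if "a \<in> adj y A" "b \<in> adj y I" for a b
    proof -
      from that obtain p q where pq: "coeffs_in A p" "coeffs_in I q" "a = poly p y" "b = poly q y" by (auto simp: adj_def)
      then have "coeffs_in I (p * q)" by (auto simp: coeffs_in_def coeff_mult intro!: sumI I)
      then show ?thesis unfolding adj_def using pq by (intro image_eqI[of _ _ "p * q"]) auto
    qed
    moreover have "y \<in> adj y A" unfolding adj_def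
      by (intro image_eqI[of _ _ "[:0, 1:]"]) (auto simp: coeffs_in_def coeff_pCons split: nat.split)
    moreover have "adj y I \<subseteq> adj y A" using AI(2) by (force simp: adj_def coeffs_in_def)
    ultimately show ?thesis using that const[of A] const[of I] I(1) unfolding proper_ideal_def by auto
  qed
  have "1 \<notin> adj z I \<or> 1 \<notin> adj (1 / z) I"
  proof (rule ccontr)
    assume "\<not> ?thesis"
    then obtain p q where "coeffs_in I p" "poly p z = 1" "coeffs_in I q" "poly q (1 / z) = 1"
      unfolding adj_def by force
    then show False using one_in_adjoin_both[OF A I AI(2) z] one by blast
  qed
  then show ?thesis using main[of z] main[of "1 / z"] by blast
qed

text \<open>Finitely many extension steps take the place of a valuation ring containing A: the
  Cartan decomposition compares only five elements.\<close>

lemma proper_ideal_adjoin_list: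
  fixes A :: "'a::field set"
  assumes "proper_ideal A I" "I \<subseteq> A" "\<forall>z\<in>set zs. z \<noteq> 0"
  shows "\<exists>A' I'. proper_ideal A' I' \<and> I' \<subseteq> A' \<and> A \<subseteq> A' \<and> I \<subseteq> I' \<and> (\<forall>z\<in>set zs. z \<in> A' \<or> 1 / z \<in> A')"
  using assms
proof (induction zs arbitrary: A I)
  case Nil
  then show ?case by (intro exI[of _ A] exI[of _ I]) auto
next
  case (Cons z zs)
  obtain A1 I1 where 1: "proper_ideal A1 I1" "I1 \<subseteq> A1" "A \<subseteq> A1" "I \<subseteq> I1" "z \<in> A1 \<or> 1 / z \<in> A1"
    using proper_ideal_adjoin[OF Cons(2,3), of z] Cons(4) by auto
  obtain A2 I2 where 2: "proper_ideal A2 I2" "I2 \<subseteq> A2" "A1 \<subseteq> A2" "I1 \<subseteq> I2" "\<forall>z\<in>set zs. z \<in> A2 \<or> 1 / z \<in> A2"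
    using Cons(1)[OF 1(1,2)] Cons(4) by auto
  show ?case by (rule exI[of _ A2], rule exI[of _ I2]) (use 1 2 in auto)
qed

section \<open>The coordinates of a generic conjugate generate the unit ideal\<close>

lemma unstable_conj:
  assumes "unstable D (conj_lift D h v)" "h \<in> sl2"
  shows "unstable D v"
proof -
  obtain h' where "h' \<in> sl2" "\<forall>i<2 * D + 2. ydeg D i \<le> xdeg D i \<longrightarrow> coords D (conj_lift D h' (conj_lift D h v)) i = 0"
    using assms(1) unfolding unstable_def by blast
  then show ?thesis unfolding unstable_def conj_lift_mmult
    using assms(2) mmult_in_sl2 by blast
qed

lemma hom_eval: "subring_hom UNIV (\<lambda>p. poly p (x::'a::comm_ring_1))"
  by (intro subring_hom.intro subring_UNIV subring_hom_axioms.intro) auto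

text \<open>A Nullstellensatz in one variable. The polynomials p over k with p(\<beta>) in I form a
  proper ideal J of k[X], so they have a common zero r. Specialising \<beta> to r turns membership
  in I into vanishing, and the lower unipotent matrix with entry r destabilises (F, G).\<close>

lemma not_unstable_lower_unipotent:
  fixes F G :: "'k::field poly" and \<iota> :: "'k \<Rightarrow> 'l::field"
  assumes ac: "roots_exist TYPE('k)" and \<iota>: "subring_hom UNIV \<iota>"
    and nu: "\<not> unstable D (F, G)"
    and AI: "proper_ideal A I" "range \<iota> \<subseteq> A" "\<beta> \<in> A"
    and co: "\<And>i. i < 2 * D + 2 \<Longrightarrow> ydeg D i \<le> xdeg D i \<Longrightarrow> coords D (conj_lift D (1, 0, \<beta>, 1) (map_poly \<iota> F, map_poly \<iota> G)) i \<in> I"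
  shows False
proof -
  interpret \<iota>: subring_hom UNIV \<iota> by fact
  have I: "0 \<in> I" "\<And>x y. x \<in> I \<Longrightarrow> y \<in> I \<Longrightarrow> x + y \<in> I" "\<And>r x. r \<in> A \<Longrightarrow> x \<in> I \<Longrightarrow> r * x \<in> I"
    and one: "1 \<notin> I" and A: "subring A" using AI(1) unfolding proper_ideal_def by auto
  interpret subring A by fact
  have all: "coeffs_in UNIV p" for p :: "'b::zero poly" by (simp add: coeffs_in_def)
  define ev where "ev = (\<lambda>p. poly (map_poly \<iota> p) \<beta>)"
  have ev: "subring_hom UNIV ev"
    by (intro subring_hom.intro subring_UNIV subring_hom_axioms.intro)
      (auto simp: ev_def \<iota>.map_poly_hom_add \<iota>.map_poly_hom_mult all)
  interpret ev: subring_hom UNIV ev by fact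
  have evA: "ev p \<in> A" for p
    unfolding ev_def poly_altdef using AI by (intro sum_in mult_in power_in) auto
  let ?FX = "map_poly (\<lambda>x. [:x:]) F" and ?GX = "map_poly (\<lambda>x. [:x:]) G"
  define E where "E = coords D (conj_lift D (1, 0, [:0, 1:], 1) (?FX, ?GX))"
  have ev_E: "ev (E i) = coords D (conj_lift D (1, 0, \<beta>, 1) (map_poly \<iota> F, map_poly \<iota> G)) i" for i
  proof -
    have "map_poly ev (map_poly (\<lambda>x. [:x:]) H) = map_poly \<iota> H" for H :: "'k poly"
      by (rule poly_eqI) (simp add: coeff_map_poly ev_def \<iota>.map_poly_hom_pCons)
    moreover have "ev [:0, 1:] = \<beta>" by (simp add: ev_def \<iota>.map_poly_hom_pCons)
    ultimately show ?thesis
      unfolding E_def ev.coords_map_pair[symmetric] using ev.map_pair_conj_lift[OF all all, of 1 0 "[:0, 1:]" 1 D ?FX ?GX] by simp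
  qed
  have poly_E: "poly (E i) r = coords D (conj_lift D (1, 0, r, 1) (F, G)) i" for i r
  proof -
    interpret er: subring_hom UNIV "\<lambda>p. poly p r" by (rule hom_eval)
    have "map_poly (\<lambda>p. poly p r) (map_poly (\<lambda>x. [:x:]) H) = H" for H :: "'k poly"
      by (rule poly_eqI) (simp add: coeff_map_poly)
    then show ?thesis
      unfolding E_def er.coords_map_pair[symmetric] using er.map_pair_conj_lift[OF all all, of 1 0 "[:0, 1:]" 1 D ?FX ?GX] by simp
  qed
  define J where "J = {p. ev p \<in> I}"
  have EJ: "E i \<in> J" if "i < 2 * D + 2" "ydeg D i \<le> xdeg D i" for i
    using co[OF that] by (simp add: J_def ev_E)
  have J_diff: "p - q * r \<in> J" if "p \<in> J" "r \<in> J" for p q r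
  proof -
    have "p - q * r = p + (- q) * r" by simp
    then have "ev (p - q * r) = ev p + ev (- q) * ev r" by (simp only: ev.hom_add ev.hom_mult UNIV_I)
    then show ?thesis using that I evA by (simp add: J_def)
  qed
  \<comment> \<open>If J is zero any r will do. Otherwise an element of least degree generates J,
    and it is not constant because 1 is not in I.\<close>
  have "\<exists>r. \<forall>p\<in>J. poly p r = 0"
  proof (cases "J \<subseteq> {0}")
    case True
    then have "poly p r = 0" if "p \<in> J" for p r using that by auto
    then show ?thesis by blast
  next
    case False
    then obtain p where p: "p \<in> J" "p \<noteq> 0" "\<And>q. q \<in> J \<Longrightarrow> q \<noteq> 0 \<Longrightarrow> degree p \<le> degree q"
    proof -
      from False obtain p0 where "p0 \<in> J \<and> p0 \<noteq> 0" by auto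
      then have "\<exists>p. (p \<in> J \<and> p \<noteq> 0) \<and> (\<forall>q. q \<in> J \<and> q \<noteq> 0 \<longrightarrow> degree p \<le> degree q)"
        by (rule ex_has_least_nat)
      then show ?thesis using that by blast
    qed
    have dvd: "p dvd q" if "q \<in> J" for q
    proof -
      have "q mod p = q - (q div p) * p" by (simp add: minus_div_mult_eq_mod)
      then have "q mod p \<in> J" using J_diff[OF that p(1)] by simp
      then have "q mod p = 0" using p(3)[of "q mod p"] degree_mod_less[OF p(2), of q] by force
      then show ?thesis by (simp add: mod_eq_0_iff_dvd)
    qed
    have "degree p \<ge> 1"
    proof (rule ccontr)
      assume "\<not> degree p \<ge> 1"
      then obtain c where c: "p = [:c:]" "c \<noteq> 0" using p(2) by (metis degree_eq_zeroE less_one not_le pCons_0_0)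
      have "ev ([:inverse c:] * p) \<in> I" unfolding ev.hom_mult[OF UNIV_I UNIV_I] using p(1) I evA by (simp add: J_def)
      moreover have "[:inverse c:] * p = 1" using c by (simp add: one_pCons)
      ultimately show False using one by simp
    qed
    then obtain r where "poly p r = 0" using ac unfolding roots_exist_def by blast
    then show ?thesis using dvd by (metis dvd_trans poly_eq_0_iff_dvd)
  qed
  then obtain r where r: "\<And>p. p \<in> J \<Longrightarrow> poly p r = 0" by blast
  have "unstable D (F, G)"
    unfolding unstable_def
  proof (rule bexI[of _ "(1, 0, r, 1)"], intro allI impI)
    fix i assume "i < 2 * D + 2" "ydeg D i \<le> xdeg D i"
    then have "poly (E i) r = 0" by (intro r EJ)
    then show "coords D (conj_lift D (1, 0, r, 1) (F, G)) i = 0" by (simp add: poly_E)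
  qed (simp add: sl2_def)
  with nu show False by simp
qed

text \<open>After adjoining quotients of the entries, g has a Cartan decomposition over the enlarged
  ring. U can be undone inside that ring, and the diagonal factor as well on the coordinates that
  matter. A Weyl element and a lower unipotent matrix remain, which is the previous lemma.\<close>

lemma not_unstable_conj_coords:
  fixes F G :: "'k::field poly" and \<iota> :: "'k \<Rightarrow> 'l::field"
  assumes ac: "roots_exist TYPE('k)" and \<iota>: "subring_hom UNIV \<iota>"
    and nu: "\<not> unstable D (F, G)"
    and AI: "proper_ideal A I" "I \<subseteq> A" "range \<iota> \<subseteq> A"
    and g: "g \<in> sl2"
    and co: "\<And>i. i < 2 * D + 2 \<Longrightarrow> coords D (conj_lift D g (map_poly \<iota> F, map_poly \<iota> G)) i \<in> I"
  shows False
proof -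
  interpret \<iota>: subring_hom UNIV \<iota> by fact
  have all: "coeffs_in UNIV p" for p :: "'b::zero poly" by (simp add: coeffs_in_def)
  obtain a b c d where gg: "g = (a, b, c, d)" by (cases g)
  have det: "a * d - b * c = 1" using g by (simp add: gg sl2_def)
  define E where "E = [1, a, b, c, d]"
  define zs where "zs = filter (\<lambda>z. z \<noteq> 0) (concat (map (\<lambda>x. map (\<lambda>y. x / y) E) E))"
  have "\<forall>z\<in>set zs. z \<noteq> 0" by (simp add: zs_def)
  from proper_ideal_adjoin_list[OF AI(1,2) this] obtain A' I' where
    A': "proper_ideal A' I'" "I' \<subseteq> A'" "A \<subseteq> A'" "I \<subseteq> I'" "\<forall>z\<in>set zs. z \<in> A' \<or> 1 / z \<in> A'" by blast
  have I: "0 \<in> I'" "\<And>x y. x \<in> I' \<Longrightarrow> y \<in> I' \<Longrightarrow> x + y \<in> I'" "\<And>r x. r \<in> A' \<Longrightarrow> x \<in> I' \<Longrightarrow> r * x \<in> I'"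
    and A: "subring A'" using A'(1) unfolding proper_ideal_def by auto
  interpret subring A' by fact
  have cmp: "\<exists>z\<in>A'. x = z * y \<or> y = z * x" if "x \<in> {1, a, b, c, d}" "y \<in> {1, a, b, c, d}" for x y
  proof (cases "x = 0 \<or> y = 0")
    case True
    then show ?thesis by (intro bexI[of _ 0]) auto
  next
    case False
    have "x \<in> set E" "y \<in> set E" using that by (auto simp: E_def)
    then have "x / y \<in> set zs" unfolding zs_def using False by auto
    then have "x / y \<in> A' \<or> y / x \<in> A'" using A'(5) by fastforce
    then show ?thesis
    proof
      assume "x / y \<in> A'" then show ?thesis using False by (intro bexI[of _ "x / y"]) auto
    next
      assume "y / x \<in> A'" then show ?thesis using False by (intro bexI[of _ "y / x"]) auto
    qed
  qed
  obtain w \<beta> e U where C: "w \<in> {(1, 0, 0, 1), (0, - 1, 1, 0)}" "\<beta> \<in> A'" "e \<noteq> 0" "1 / e \<in> A'" "U \<in> sl2" "entries_in A' U"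
    "(a, b, c, d) = mmult (mmult (mmult w (1, 0, \<beta>, 1)) (e, 0, 0, 1 / e)) U"
    by (rule cartan[OF A det cmp])
  let ?v = "(map_poly \<iota> F, map_poly \<iota> G)"
  let ?h = "mmult w (1, 0, \<beta>, 1)"
  obtain u1 u2 u3 u4 where U: "adj2 U = (u1, u2, u3, u4)" by (cases "adj2 U")
  have u: "u1 \<in> A'" "u2 \<in> A'" "u3 \<in> A'" "u4 \<in> A'" using entries_in_adj2[OF C(6)] by (auto simp: U)
  have "mmult g (adj2 U) = mmult (mmult ?h (e, 0, 0, 1 / e)) (mmult U (adj2 U))"
    unfolding gg C(7) by (simp only: mmult_assoc)
  also have "\<dots> = mmult ?h (e, 0, 0, 1 / e)"
    unfolding mmult_adj2(1)[OF C(5)] by (cases "mmult ?h (e, 0, 0, 1 / e)") simp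
  finally have eq: "conj_lift D (mmult ?h (e, 0, 0, 1 / e)) ?v = conj_lift D (adj2 U) (conj_lift D g ?v)"
    by (simp only: conj_lift_mmult)
  have co1: "coords D (conj_lift D (mmult ?h (e, 0, 0, 1 / e)) ?v) i \<in> I'" if "i < 2 * D + 2" for i
    unfolding eq U
    by (rule coords_conj_lift_in_submodule[OF I(1,2) _ u _ that]) (use I(3) co A'(4) in auto)
  \<comment> \<open>On these coordinates the diagonal factor acts by a nonnegative power of e, which
    is cancelled using that 1/e lies in the ring.\<close>
  have co2: "coords D (conj_lift D ?h ?v) i \<in> I'" if i: "i < 2 * D + 2" "ydeg D i \<le> xdeg D i" for i
  proof -
    have "e ^ xdeg D i * (1 / e) ^ ydeg D i * coords D (conj_lift D ?h ?v) i \<in> I'"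
      using co1[OF i(1)] i by (simp only: conj_lift_mmult[symmetric] coords_conj_diag)
    moreover have "e ^ xdeg D i * (1 / e) ^ ydeg D i = e ^ (xdeg D i - ydeg D i)"
      using C(3) i by (simp add: power_diff power_one_over)
    ultimately have "(1 / e) ^ (xdeg D i - ydeg D i) * (e ^ (xdeg D i - ydeg D i) * coords D (conj_lift D ?h ?v) i) \<in> I'"
      using I(3)[OF power_in[OF C(4)]] by simp
    then show ?thesis using C(3) by (simp add: power_one_over)
  qed
  \<comment> \<open>The Weyl element has entries 0, 1 and -1, so it comes from k and can be applied
    to (F, G) itself.\<close>
  obtain w' :: "'k \<times> 'k \<times> 'k \<times> 'k" where w': "w' \<in> sl2" "conj_lift D w ?v = map_pair \<iota> (conj_lift D w' (F, G))"
  proof -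
    have h: "\<iota> (- 1) = - 1" using \<iota>.hom_uminus[of 1] by simp
    from C(1) consider "w = (1, 0, 0, 1)" | "w = (0, - 1, 1, 0)" by auto
    then show ?thesis
    proof cases
      case 1
      then show ?thesis using that[of "(1, 0, 0, 1)"] \<iota>.map_pair_conj_lift[OF all all, of 1 0 0 1 D F G]
        by (simp add: sl2_def)
    next
      case 2
      then show ?thesis using that[of "(0, - 1, 1, 0)"] \<iota>.map_pair_conj_lift[OF all all, of 0 "- 1" 1 0 D F G]
        by (simp add: sl2_def h)
    qed
  qed
  obtain F' G' where FG': "conj_lift D w' (F, G) = (F', G')" by (cases "conj_lift D w' (F, G)")
  have "\<not> unstable D (F', G')" using nu unstable_conj[OF _ w'(1)] FG' by metis
  then show False
  proof (rule not_unstable_lower_unipotent[OF ac \<iota> _ A'(1) _ C(2)])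
    show "range \<iota> \<subseteq> A'" using AI(3) A'(3) by blast
    fix i assume "i < 2 * D + 2" "ydeg D i \<le> xdeg D i"
    then show "coords D (conj_lift D (1, 0, \<beta>, 1) (map_poly \<iota> F', map_poly \<iota> G')) i \<in> I'"
      using co2 w'(2) by (simp add: FG' flip: conj_lift_mmult)
  qed
qed

section \<open>Polynomial functions of the coordinates\<close>

text \<open>Exponents vanish from M on, matching the monomials in \<open>semistable\<close>;
  \<open>polyfun_mp_eval\<close> converts back to that format once closure under products and
  determinants has been used.\<close>

inductive polyfun :: "nat \<Rightarrow> ((nat \<Rightarrow> 'k::comm_ring_1) \<Rightarrow> 'k) \<Rightarrow> bool" for M where
  mono: "(\<And>i. i \<ge> M \<Longrightarrow> \<alpha> i = 0) \<Longrightarrow> polyfun M (\<lambda>x. c * (\<Prod>i<M. x i ^ \<alpha> i))"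
| add: "polyfun M f \<Longrightarrow> polyfun M g \<Longrightarrow> polyfun M (\<lambda>x. f x + g x)"

lemma polyfun_const: "polyfun M (\<lambda>x. c)"
  using polyfun.mono[of M "\<lambda>_. 0" c] by simp

lemma polyfun_coord:
  assumes "i < M"
  shows "polyfun M (\<lambda>x :: nat \<Rightarrow> 'a::comm_ring_1. x i)"
proof -
  have *: "(\<Prod>j<M. x j ^ (if j = i then 1 else 0)) = x i" for x :: "nat \<Rightarrow> 'a"
  proof -
    have "(\<Prod>j<M. x j ^ (if j = i then 1 else 0)) = (\<Prod>j<M. if j = i then x j else 1)"
      by (intro prod.cong) auto
    then show ?thesis using assms by simp
  qed
  have "polyfun M (\<lambda>x :: nat \<Rightarrow> 'a. 1 * (\<Prod>j<M. x j ^ (if j = i then 1 else 0)))"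
    by (rule polyfun.mono) (use assms in auto)
  then show ?thesis unfolding * by simp
qed

lemma polyfun_mult:
  assumes "polyfun M f" "polyfun M g"
  shows "polyfun M (\<lambda>x. f x * g x)"
  using assms(1)
proof induction
  case (mono \<alpha> c)
  show ?case using assms(2)
  proof induction
    case (mono \<beta> e)
    have "polyfun M (\<lambda>x. c * e * (\<Prod>i<M. x i ^ (\<alpha> i + \<beta> i)))"
      by (rule polyfun.mono) (use mono \<open>\<And>i. M \<le> i \<Longrightarrow> \<alpha> i = 0\<close> in auto)
    then show ?case by (simp add: power_add prod.distrib mult_ac)
  next
    case (add f g)
    then show ?case using polyfun.add[OF add(3,4)] by (simp add: distrib_left)
  qed
next
  case (add f h)
  then show ?case using polyfun.add[OF add(3,4)] by (simp add: distrib_right)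
qed

lemma polyfun_sum: "(\<And>i. i \<in> S \<Longrightarrow> polyfun M (f i)) \<Longrightarrow> polyfun M (\<lambda>x. \<Sum>i\<in>S. f i x)"
  by (induction S rule: infinite_finite_induct) (auto intro: polyfun_const polyfun.add)

lemma polyfun_prod: "(\<And>i. i \<in> S \<Longrightarrow> polyfun M (f i)) \<Longrightarrow> polyfun M (\<lambda>x. \<Prod>i\<in>S. f i x)"
  by (induction S rule: infinite_finite_induct) (auto intro: polyfun_const polyfun_mult)

lemma polyfun_det:
  assumes "\<And>i j. i < n \<Longrightarrow> j < n \<Longrightarrow> polyfun M (S i j)"
  shows "polyfun M (\<lambda>x. det (mat n n (\<lambda>(i, j). S i j x)))"
proof -
  have "det (mat n n (\<lambda>(i, j). S i j x)) = (\<Sum>p\<in>{p. p permutes {0..<n}}. signof p * (\<Prod>i<n. S i (p i) x))" for x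
  proof -
    have "(\<Prod>i = 0..<n. mat n n (\<lambda>(i, j). S i j x) $$ (i, p i)) = (\<Prod>i<n. S i (p i) x)"
      if "p permutes {0..<n}" for p
      using that by (intro prod.cong) (auto simp: permutes_in_image[of p "{0..<n}", simplified])
    then show ?thesis by (simp add: det_def)
  qed
  moreover have "polyfun M (\<lambda>x. \<Sum>p\<in>{p. p permutes {0..<n}}. signof p * (\<Prod>i<n. S i (p i) x))"
  proof (intro polyfun_sum polyfun_mult polyfun_const polyfun_prod assms)
    fix p i assume "p \<in> {p. p permutes {0..<n}}" "i \<in> {..<n}"
    then show "p i < n" by (auto simp: permutes_in_image[of p "{0..<n}", simplified])
  qed auto
  ultimately show ?thesis by simp
qed

lemma polyfun_mp_eval:
  assumes "polyfun M f"
  obtains S c where "finite S" "\<And>\<alpha> i. \<alpha> \<in> S \<Longrightarrow> i \<ge> M \<Longrightarrow> \<alpha> i = 0" "f = mp_eval M S c"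
proof -
  have "\<exists>S c. finite S \<and> (\<forall>\<alpha>\<in>S. \<forall>i\<ge>M. \<alpha> i = 0) \<and> f = mp_eval M S c"
    using assms
  proof induction
    case (mono \<alpha> c)
    then show ?case by (intro exI[of _ "{\<alpha>}"] exI[of _ "\<lambda>_. c"]) (auto simp: mp_eval_def)
  next
    case (add f g)
    then obtain S c T e where S: "finite S" "\<forall>\<alpha>\<in>S. \<forall>i\<ge>M. \<alpha> i = 0" "f = mp_eval M S c"
      and T: "finite T" "\<forall>\<alpha>\<in>T. \<forall>i\<ge>M. \<alpha> i = 0" "g = mp_eval M T e" by blast
    have restrict: "mp_eval M S' c' x = (\<Sum>\<alpha>\<in>S \<union> T. (if \<alpha> \<in> S' then c' \<alpha> else 0) * (\<Prod>i<M. x i ^ \<alpha> i))"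
      if "S' \<subseteq> S \<union> T" for S' c' x
      unfolding mp_eval_def using that S T by (intro sum.mono_neutral_cong_left) auto
    let ?c = "\<lambda>\<alpha>. (if \<alpha> \<in> S then c \<alpha> else 0) + (if \<alpha> \<in> T then e \<alpha> else 0)"
    have "(\<lambda>x. f x + g x) = mp_eval M (S \<union> T) ?c"
      unfolding S(3) T(3) by (rule ext) (simp add: restrict mp_eval_def[of M "S \<union> T"] sum.distrib distrib_right)
    then show ?case using S T by (intro exI[of _ "S \<union> T"] exI[of _ ?c]) auto
  qed
  then show ?thesis using that by blast
qed

section \<open>A polynomial that is 1 on the orbit\<close>

text \<open>The generic element (a, b, c, (1 + bc)/a) of SL2 lives over the field of rational functions in a, b, c.
  Elements of that field with denominators a power of a can be specialised, and I consists of those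
  that come from polynomials without constant term in the coordinates of the generic conjugate.\<close>

theorem ex_polyfun_one_on_orbit:
  fixes F G :: "'k::field poly"
  assumes ac: "roots_exist TYPE('k)" and nu: "\<not> unstable D (F, G)"
  obtains f where "polyfun (2 * D + 2) f" "f (\<lambda>_. 0) = 0"
    "\<And>a b c. a \<noteq> 0 \<Longrightarrow> f (coords D (conj_lift D (a, b, c, (1 + b * c) / a) (F, G))) = 1"
proof -
  define k3 :: "'k \<Rightarrow> 'k poly poly poly" where "k3 = (\<lambda>x. [:[:[:x:]:]:])"
  define vA vB vC :: "'k poly poly poly" where "vA = [:[:[:0, 1:]:]:]" and "vB = [:[:0, 1:]:]" and "vC = [:0, 1:]"
  \<comment> \<open>The ring is k[a][b][c], with a innermost, so evaluation substitutes c first and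
    a last.\<close>
  define ev :: "'k \<Rightarrow> 'k \<Rightarrow> 'k \<Rightarrow> 'k poly poly poly \<Rightarrow> 'k" where
    "ev = (\<lambda>a b c P. poly (poly (poly P [:[:c:]:]) [:b:]) a)"
  have ev_hom: "subring_hom UNIV (ev a b c)" for a b c
    by (intro subring_hom.intro subring_UNIV subring_hom_axioms.intro) (auto simp: ev_def)
  have ev_simps: "ev a b c vA = a" "ev a b c vB = b" "ev a b c vC = c" "ev a b c (k3 x) = x"
    "ev a b c (p + q) = ev a b c p + ev a b c q" "ev a b c (p * q) = ev a b c p * ev a b c q"
    "ev a b c (p ^ n) = ev a b c p ^ n" "ev a b c 1 = 1" "ev a b c 0 = 0" "ev a b c (- p) = - ev a b c p" for a b c p q n x
    by (auto simp: ev_def vA_def vB_def vC_def k3_def)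
  have k3_hom: "subring_hom UNIV k3"
    by (intro subring_hom.intro subring_UNIV subring_hom_axioms.intro) (auto simp: k3_def one_pCons)
  have tf_hom: "subring_hom UNIV (to_fract :: 'k poly poly poly \<Rightarrow> _)"
    by (intro subring_hom.intro subring_UNIV subring_hom_axioms.intro) auto
  define \<iota> where "\<iota> = (\<lambda>x. to_fract (k3 x))"
  interpret k3: subring_hom UNIV k3 by (rule k3_hom)
  have \<iota>_hom: "subring_hom UNIV \<iota>"
    by (intro subring_hom.intro subring_UNIV subring_hom_axioms.intro)
      (auto simp: \<iota>_def k3.hom_add k3.hom_mult)
  interpret tf: subring_hom UNIV "to_fract :: 'k poly poly poly \<Rightarrow> _" by (rule tf_hom)
  interpret \<iota>: subring_hom UNIV \<iota> by (rule \<iota>_hom)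
  have all: "coeffs_in UNIV p" for p :: "'b::zero poly" by (simp add: coeffs_in_def)
  define ta tb tc where "ta = to_fract vA" and "tb = to_fract vB" and "tc = to_fract vC"
  have ta0: "ta \<noteq> 0" by (simp add: ta_def vA_def)
  let ?g = "(ta, tb, tc, (1 + tb * tc) / ta)"
  let ?v = "(map_poly \<iota> F, map_poly \<iota> G)"
  define co where "co = (\<lambda>a b c. coords D (conj_lift D (a, b, c, (1 + b * c) / a) (F, G)))"
  \<comment> \<open>\<open>Q x f\<close> says that f represents the rational function x: after
    clearing a power of a, every specialisation of x is the value of f at the specialised conjugate.
    An identity over the function field thereby becomes one at every point of the orbit with a
    \<noteq> 0.\<close>
  define Q where "Q = (\<lambda>x f. polyfun (2 * D + 2) f \<and> (\<exists>n P. x * ta ^ n = to_fract P \<and>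
      (\<forall>a b c. a \<noteq> 0 \<longrightarrow> ev a b c P = a ^ n * f (co a b c))))"
  define A where "A = {x. \<exists>f. Q x f}"
  define I where "I = {x. \<exists>f. Q x f \<and> f (\<lambda>_. 0) = 0}"
  have Q_add: "Q (x + y) (\<lambda>u. f u + h u)" if "Q x f" "Q y h" for x y f h
  proof -
    from that obtain n P m P' where 1: "x * ta ^ n = to_fract P" "\<forall>a b c. a \<noteq> 0 \<longrightarrow> ev a b c P = a ^ n * f (co a b c)"
      and 2: "y * ta ^ m = to_fract P'" "\<forall>a b c. a \<noteq> 0 \<longrightarrow> ev a b c P' = a ^ m * h (co a b c)" by (auto simp: Q_def)
    have "(x + y) * ta ^ (n + m) = (x * ta ^ n) * ta ^ m + (y * ta ^ m) * ta ^ n" by (simp add: power_add algebra_simps)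
    also have "\<dots> = to_fract (P * vA ^ m + P' * vA ^ n)" unfolding 1 2 by (simp add: ta_def tf.hom_power)
    finally have "(x + y) * ta ^ (n + m) = to_fract (P * vA ^ m + P' * vA ^ n)" .
    moreover have "\<forall>a b c. a \<noteq> 0 \<longrightarrow> ev a b c (P * vA ^ m + P' * vA ^ n) = a ^ (n + m) * (f (co a b c) + h (co a b c))"
      using 1 2 by (simp add: ev_simps power_add algebra_simps)
    ultimately show ?thesis using that unfolding Q_def by (blast intro: polyfun.add)
  qed
  have Q_mult: "Q (x * y) (\<lambda>u. f u * h u)" if "Q x f" "Q y h" for x y f h
  proof -
    from that obtain n P m P' where 1: "x * ta ^ n = to_fract P" "\<forall>a b c. a \<noteq> 0 \<longrightarrow> ev a b c P = a ^ n * f (co a b c)"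
      and 2: "y * ta ^ m = to_fract P'" "\<forall>a b c. a \<noteq> 0 \<longrightarrow> ev a b c P' = a ^ m * h (co a b c)" by (auto simp: Q_def)
    have "(x * y) * ta ^ (n + m) = (x * ta ^ n) * (y * ta ^ m)" by (simp add: power_add algebra_simps)
    also have "\<dots> = to_fract (P * P')" unfolding 1 2 by simp
    finally have "(x * y) * ta ^ (n + m) = to_fract (P * P')" .
    moreover have "\<forall>a b c. a \<noteq> 0 \<longrightarrow> ev a b c (P * P') = a ^ (n + m) * (f (co a b c) * h (co a b c))"
      using 1 2 by (simp add: ev_simps power_add algebra_simps)
    ultimately show ?thesis using that unfolding Q_def by (blast intro: polyfun_mult)
  qed
  have Q_const: "Q (\<iota> x) (\<lambda>_. x)" for x
    unfolding Q_def by (intro conjI polyfun_const exI[of _ 0] exI[of _ "k3 x"]) (auto simp: \<iota>_def ev_simps)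
  have Q_coord: "Q (coords D (conj_lift D ?g ?v) i) (\<lambda>u. u i)" if i: "i < 2 * D + 2" for i
  proof -
    \<comment> \<open>The generic matrix multiplied by a has polynomial entries; the scalar a
      multiplies every coordinate by a^(D + 1), because xdeg + ydeg = D + 1.\<close>
    let ?P = "coords D (conj_lift D (vA * vA, vA * vB, vA * vC, 1 + vB * vC) (map_poly k3 F, map_poly k3 G)) i"
    have deg: "xdeg D i + ydeg D i = D + 1" using i by (auto simp: xdeg_def ydeg_def)
    have "map_poly to_fract (map_poly k3 H) = map_poly \<iota> H" for H
      by (rule poly_eqI) (simp add: \<iota>_def coeff_map_poly)
    then have "to_fract ?P = coords D (conj_lift D (ta * ta, ta * tb, ta * tc, 1 + tb * tc) ?v) i"
      unfolding tf.coords_map_pair[symmetric]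
      using tf.map_pair_conj_lift[OF all all, of "vA * vA" "vA * vB" "vA * vC" "1 + vB * vC" D "map_poly k3 F" "map_poly k3 G"]
      by (simp add: ta_def tb_def tc_def)
    also have "(ta * ta, ta * tb, ta * tc, 1 + tb * tc) = mmult ?g (ta, 0, 0, ta)" using ta0 by (simp add: mult.commute)
    also have "coords D (conj_lift D (mmult ?g (ta, 0, 0, ta)) ?v) i = ta ^ (D + 1) * coords D (conj_lift D ?g ?v) i"
      unfolding conj_lift_mmult[symmetric] coords_conj_diag[OF i] deg[symmetric] power_add ..
    finally have 1: "coords D (conj_lift D ?g ?v) i * ta ^ (D + 1) = to_fract ?P" by (simp add: mult.commute)
    have "ev a b c ?P = a ^ (D + 1) * co a b c i" if a: "a \<noteq> 0" for a b c
    proof -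
      interpret e: subring_hom UNIV "ev a b c" by (rule ev_hom)
      have "map_poly (ev a b c) (map_poly k3 H) = H" for H
        by (rule poly_eqI) (simp add: coeff_map_poly ev_simps)
      then have "ev a b c ?P = coords D (conj_lift D (a * a, a * b, a * c, 1 + b * c) (F, G)) i"
        unfolding e.coords_map_pair[symmetric]
        using e.map_pair_conj_lift[OF all all, of "vA * vA" "vA * vB" "vA * vC" "1 + vB * vC" D "map_poly k3 F" "map_poly k3 G"]
        by (simp add: ev_simps)
      also have "(a * a, a * b, a * c, 1 + b * c) = mmult (a, b, c, (1 + b * c) / a) (a, 0, 0, a)" using a by (simp add: mult.commute)
      also have "coords D (conj_lift D (mmult (a, b, c, (1 + b * c) / a) (a, 0, 0, a)) (F, G)) i = a ^ (D + 1) * co a b c i"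
        unfolding conj_lift_mmult[symmetric] coords_conj_diag[OF i] deg[symmetric] power_add co_def ..
      finally show ?thesis .
    qed
    then show ?thesis unfolding Q_def using 1 polyfun_coord[OF i] by blast
  qed
  have "1 \<in> I"
  proof (rule ccontr)
    assume "1 \<notin> I"
    have "subring A"
    proof
      show "0 \<in> A" "1 \<in> A" using Q_const[of 0] Q_const[of 1] by (auto simp: A_def)
      fix x y assume xy: "x \<in> A" "y \<in> A"
      then show "x + y \<in> A" "x * y \<in> A" using Q_add Q_mult unfolding A_def by blast+
      have "\<iota> (- 1) = - 1" using \<iota>.hom_uminus[of 1] by simp
      then show "- x \<in> A" using xy Q_mult[OF Q_const[of "- 1"]] unfolding A_def by auto
    qed
    moreover have "0 \<in> I" using Q_const[of 0] by (auto simp: I_def)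
    moreover have "x + y \<in> I" if "x \<in> I" "y \<in> I" for x y
    proof -
      from that obtain f h where "Q x f" "f (\<lambda>_. 0) = 0" "Q y h" "h (\<lambda>_. 0) = 0" by (auto simp: I_def)
      then show ?thesis using Q_add[of x f y h] unfolding I_def by auto
    qed
    moreover have "r * x \<in> I" if "r \<in> A" "x \<in> I" for r x
    proof -
      from that obtain f h where "Q r f" "Q x h" "h (\<lambda>_. 0) = 0" by (auto simp: I_def A_def)
      then show ?thesis using Q_mult[of r f x h] unfolding I_def by auto
    qed
    ultimately have "proper_ideal A I" using \<open>1 \<notin> I\<close> unfolding proper_ideal_def by blast
    moreover have "I \<subseteq> A" by (auto simp: I_def A_def)
    moreover have "range \<iota> \<subseteq> A" using Q_const by (auto simp: A_def)
    moreover have "?g \<in> sl2" using ta0 by (simp add: sl2_def)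
    moreover have "coords D (conj_lift D ?g ?v) i \<in> I" if "i < 2 * D + 2" for i
      using Q_coord[OF that] unfolding I_def by auto
    ultimately show False by (rule not_unstable_conj_coords[OF ac \<iota>_hom nu])
  qed
  then obtain f n P where f: "polyfun (2 * D + 2) f" "f (\<lambda>_. 0) = 0" "1 * ta ^ n = to_fract P"
    "\<And>a b c. a \<noteq> 0 \<Longrightarrow> ev a b c P = a ^ n * f (co a b c)" by (auto simp: I_def Q_def)
  have "to_fract P = to_fract (vA ^ n)" using f(3) by (simp add: ta_def tf.hom_power)
  then have P: "P = vA ^ n" by simp
  show ?thesis
  proof (rule that[OF f(1,2)])
    fix a b c :: 'k assume a: "a \<noteq> 0"
    then show "f (coords D (conj_lift D (a, b, c, (1 + b * c) / a) (F, G))) = 1"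
      using f(4)[OF a, of b c] by (simp add: P ev_simps co_def)
  qed
qed

section \<open>Bihomogeneous covariants\<close>

text \<open>The vectors x and y will be the columns of the conjugating matrix. Right multiplication
  by diag(t, s) scales them by t and s, so \<open>xdeg\<close> and \<open>ydeg\<close> turn into
  bidegrees.\<close>

inductive bihom :: "nat \<Rightarrow> nat \<Rightarrow> nat \<Rightarrow> ((nat \<Rightarrow> 'k::comm_ring_1) \<Rightarrow> 'k \<Rightarrow> 'k \<Rightarrow> 'k \<Rightarrow> 'k \<Rightarrow> 'k) \<Rightarrow> bool" for M p q where
  mono: "polyfun M f \<Longrightarrow> i \<le> p \<Longrightarrow> j \<le> q \<Longrightarrow>
    bihom M p q (\<lambda>u x1 x2 y1 y2. f u * x1 ^ i * x2 ^ (p - i) * y1 ^ j * y2 ^ (q - j))"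
| add: "bihom M p q s \<Longrightarrow> bihom M p q t \<Longrightarrow> bihom M p q (\<lambda>u x1 x2 y1 y2. s u x1 x2 y1 y2 + t u x1 x2 y1 y2)"

lemma bihom_polyfun: "polyfun M f \<Longrightarrow> bihom M 0 0 (\<lambda>u x1 x2 y1 y2. f u)"
  using bihom.mono[of M f 0 0 0 0] by simp

lemma bihom_0: "bihom M p q (\<lambda>u x1 x2 y1 y2. 0)"
  using bihom.mono[OF polyfun_const[of M 0], of 0 p 0 q] by simp

lemma bihom_vars:
  "bihom M 1 0 (\<lambda>u x1 x2 y1 y2. x1)" "bihom M 1 0 (\<lambda>u x1 x2 y1 y2. x2)"
  "bihom M 0 1 (\<lambda>u x1 x2 y1 y2. y1)" "bihom M 0 1 (\<lambda>u x1 x2 y1 y2. y2)"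
  using bihom.mono[OF polyfun_const[of M 1], of 1 1 0 0] bihom.mono[OF polyfun_const[of M 1], of 0 1 0 0]
    bihom.mono[OF polyfun_const[of M 1], of 0 0 1 1] bihom.mono[OF polyfun_const[of M 1], of 0 0 0 1] by simp_all

lemma bihom_mult:
  assumes "bihom M p q s" "bihom M p' q' t"
  shows "bihom M (p + p') (q + q') (\<lambda>u x1 x2 y1 y2. s u x1 x2 y1 y2 * t u x1 x2 y1 y2)"
  using assms(1)
proof induction
  case (mono f i j)
  show ?case using assms(2)
  proof induction
    case (mono h k l)
    have e: "p + p' - (i + k) = (p - i) + (p' - k)" "q + q' - (j + l) = (q - j) + (q' - l)"
      using mono \<open>i \<le> p\<close> \<open>j \<le> q\<close> by auto
    have "bihom M (p + p') (q + q') (\<lambda>u x1 x2 y1 y2. (f u * h u) * x1 ^ (i + k) * x2 ^ (p + p' - (i + k)) * y1 ^ (j + l) * y2 ^ (q + q' - (j + l)))"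
      by (rule bihom.mono) (use mono \<open>i \<le> p\<close> \<open>j \<le> q\<close> \<open>polyfun M f\<close> in \<open>auto intro: polyfun_mult\<close>)
    then show ?case unfolding e power_add by (simp only: mult_ac)
  next
    case (add s t)
    then show ?case using bihom.add[OF add(3,4)] by (simp add: distrib_left)
  qed
next
  case (add s t)
  then show ?case using bihom.add[OF add(3,4)] by (simp add: distrib_right)
qed

lemma bihom_sum: "(\<And>i. i \<in> S \<Longrightarrow> bihom M p q (s i)) \<Longrightarrow> bihom M p q (\<lambda>u x1 x2 y1 y2. \<Sum>i\<in>S. s i u x1 x2 y1 y2)"
  by (induction S rule: infinite_finite_induct) (auto intro: bihom_0 bihom.add)

lemma bihom_power: "bihom M p q s \<Longrightarrow> bihom M (p * n) (q * n) (\<lambda>u x1 x2 y1 y2. s u x1 x2 y1 y2 ^ n)"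
proof (induction n)
  case 0
  show ?case using bihom_polyfun[OF polyfun_const[of M 1]] by simp
next
  case (Suc n)
  then show ?case using bihom_mult[OF Suc(2) Suc(1)] by simp
qed

lemma bihom_prod:
  fixes n :: nat
  shows "(\<And>i. i < n \<Longrightarrow> bihom M (p i) (q i) (s i)) \<Longrightarrow>
    bihom M (\<Sum>i<n. p i) (\<Sum>i<n. q i) (\<lambda>u x1 x2 y1 y2. \<Prod>i<n. s i u x1 x2 y1 y2)"
proof (induction n)
  case 0
  show ?case using bihom_polyfun[OF polyfun_const[of M 1]] by simp
next
  case (Suc n)
  then have "bihom M (\<Sum>i<n. p i) (\<Sum>i<n. q i) (\<lambda>u x1 x2 y1 y2. \<Prod>i<n. s i u x1 x2 y1 y2)" by simp
  from bihom_mult[OF this Suc(2)[of n]] show ?case by simp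
qed

lemma bihom_scale:
  assumes "polyfun M f" "bihom M p q s"
  shows "bihom M p q (\<lambda>u x1 x2 y1 y2. f u * s u x1 x2 y1 y2)"
  using bihom_mult[OF bihom_polyfun[OF assms(1)] assms(2)] by simp

lemma bihom_diff:
  assumes "bihom M p q s" "bihom M p q t"
  shows "bihom M p q (\<lambda>u x1 x2 y1 y2. s u x1 x2 y1 y2 - t u x1 x2 y1 y2)"
  using bihom.add[OF assms(1) bihom_scale[OF polyfun_const[of M "- 1"] assms(2)]] by simp

definition bih :: "nat \<Rightarrow> (nat \<Rightarrow> nat \<Rightarrow> 'k::comm_ring_1) \<Rightarrow> 'k \<Rightarrow> 'k \<Rightarrow> 'k \<Rightarrow> 'k \<Rightarrow> 'k" where
  "bih n S x1 x2 y1 y2 = (\<Sum>i\<le>n. \<Sum>j\<le>n. S i j * x1 ^ i * x2 ^ (n - i) * y1 ^ j * y2 ^ (n - j))"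

lemma bihom_coeffs:
  assumes "bihom M n n s"
  obtains S where "\<And>i j. polyfun M (S i j)" "\<And>u x1 x2 y1 y2. s u x1 x2 y1 y2 = bih n (\<lambda>i j. S i j u) x1 x2 y1 y2"
proof -
  have "\<exists>S. (\<forall>i j. polyfun M (S i j)) \<and> (\<forall>u x1 x2 y1 y2. s u x1 x2 y1 y2 = bih n (\<lambda>i j. S i j u) x1 x2 y1 y2)"
    using assms
  proof induction
    case (mono f k l)
    have "bih n (\<lambda>i j. if i = k \<and> j = l then f u else 0) x1 x2 y1 y2 =
        f u * x1 ^ k * x2 ^ (n - k) * y1 ^ l * y2 ^ (n - l)" for u x1 x2 y1 y2
    proof -
      have "bih n (\<lambda>i j. if i = k \<and> j = l then f u else 0) x1 x2 y1 y2 =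
          (\<Sum>i\<le>n. \<Sum>j\<le>n. if i = k then if j = l then f u * x1 ^ i * x2 ^ (n - i) * y1 ^ j * y2 ^ (n - j) else 0 else 0)"
        unfolding bih_def by (intro sum.cong refl) auto
      also have "\<dots> = (\<Sum>i\<le>n. if i = k then \<Sum>j\<le>n. if j = l then f u * x1 ^ i * x2 ^ (n - i) * y1 ^ j * y2 ^ (n - j) else 0 else 0)"
        by (intro sum.cong refl) auto
      finally show ?thesis using mono by (simp only: sum.delta[OF finite_atMost]) simp
    qed
    moreover have "polyfun M (\<lambda>u. if i = k \<and> j = l then f u else 0)" for i j
    proof (cases "i = k \<and> j = l")
      case True
      then show ?thesis using mono by simp
    next
      case False
      show ?thesis unfolding if_not_P[OF False] by (rule polyfun_const)
    qed
    ultimately show ?case by (intro exI[of _ "\<lambda>i j u. if i = k \<and> j = l then f u else 0"]) auto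
  next
    case (add s t)
    then obtain S T where "\<forall>i j. polyfun M (S i j)" "\<forall>u x1 x2 y1 y2. s u x1 x2 y1 y2 = bih n (\<lambda>i j. S i j u) x1 x2 y1 y2"
      "\<forall>i j. polyfun M (T i j)" "\<forall>u x1 x2 y1 y2. t u x1 x2 y1 y2 = bih n (\<lambda>i j. T i j u) x1 x2 y1 y2" by blast
    then show ?case
      by (intro exI[of _ "\<lambda>i j u. S i j u + T i j u"]) (auto simp: bih_def sum.distrib distrib_right intro: polyfun.add)
  qed
  then show ?thesis using that by blast
qed

text \<open>Over an infinite field agreement on a dense set is enough. The conditions say that the
  matrix with columns (x, 1) and (y, 1) has nonzero determinant x - y and nonzero upper left entry,
  as the generic shape of SL2 elements used for the orbit requires.\<close>

lemma bih_eqD: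
  fixes S T :: "nat \<Rightarrow> nat \<Rightarrow> 'k::field"
  assumes inf: "infinite (UNIV :: 'k set)"
    and eq: "\<And>x y. x \<noteq> 0 \<Longrightarrow> x \<noteq> y \<Longrightarrow> bih n S x 1 y 1 = bih n T x 1 y 1"
    and ij: "i \<le> n" "j \<le> n"
  shows "S i j = T i j"
proof -
  have co: "coeff (\<Sum>j\<le>n. monom (f j) j) j = f j" if "j \<le> n" for f :: "nat \<Rightarrow> 'k" and j
    using that by (simp add: coeff_sum)
  have 1: "(\<Sum>i\<le>n. S i j * x ^ i) = (\<Sum>i\<le>n. T i j * x ^ i)" if x: "x \<noteq> 0" and j: "j \<le> n" for x j
  proof -
    define p where "p = (\<lambda>S :: nat \<Rightarrow> nat \<Rightarrow> 'k. \<Sum>j\<le>n. monom (\<Sum>i\<le>n. S i j * x ^ i) j)"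
    have poly_p: "poly (p S) y = bih n S x 1 y 1" for S y
      unfolding p_def bih_def by (subst sum.swap) (simp add: poly_sum poly_monom sum_distrib_right)
    have "UNIV - {x} \<subseteq> {y. poly (p S) y = poly (p T) y}" using eq[OF x] by (auto simp: poly_p)
    moreover have "infinite (UNIV - {x})" using inf by simp
    ultimately have "p S = p T" by (intro poly_eqI_infinite) (metis finite_subset)
    then have "coeff (p S) j = coeff (p T) j" by simp
    then show ?thesis using j by (simp add: p_def co)
  qed
  define p where "p = (\<lambda>S :: nat \<Rightarrow> nat \<Rightarrow> 'k. \<Sum>i\<le>n. monom (S i j) i)"
  have "UNIV - {0} \<subseteq> {x. poly (p S) x = poly (p T) x}" using 1 ij(2) by (auto simp: p_def poly_sum poly_monom)
  moreover have "infinite (UNIV - {0 :: 'k})" using inf by simp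
  ultimately have "p S = p T" by (intro poly_eqI_infinite) (metis finite_subset)
  then have "coeff (p S) i = coeff (p T) i" by simp
  then show ?thesis using ij by (simp add: p_def co)
qed

definition pair_of :: "nat \<Rightarrow> (nat \<Rightarrow> 'k::comm_ring_1) \<Rightarrow> 'k poly \<times> 'k poly" where
  "pair_of D u = (\<Sum>l\<le>D. monom (u l) l, \<Sum>l\<le>D. monom (u (l + D + 1)) l)"

lemma pair_of_coords:
  assumes "degree F \<le> D" "degree G \<le> D"
  shows "pair_of D (coords D (F, G)) = (F, G)"
  using poly_as_sum_of_monoms'[OF assms(1)] poly_as_sum_of_monoms'[OF assms(2)]
  by (simp add: pair_of_def coords_def)

text \<open>Each linear factor contributes either its X-coefficient, a coordinate of x, or its
  constant term, a coordinate of y.\<close>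

lemma bihom_linear_power_coeff:
  assumes "k \<le> l + m"
  shows "bihom M k (l + m - k) (\<lambda>u x1 x2 y1 y2. coeff ([:y1, x1:] ^ l * [:y2, x2:] ^ m) k)"
proof -
  define hp where "hp = (\<lambda>n (P :: 'a \<Rightarrow> 'a \<Rightarrow> 'a \<Rightarrow> 'a \<Rightarrow> 'a poly).
     (\<forall>k\<le>n. bihom M k (n - k) (\<lambda>u x1 x2 y1 y2. coeff (P x1 x2 y1 y2) k)) \<and> (\<forall>x1 x2 y1 y2. degree (P x1 x2 y1 y2) \<le> n))"
  have step: "hp (Suc n) (\<lambda>x1 x2 y1 y2. [:b x1 x2 y1 y2, a x1 x2 y1 y2:] * P x1 x2 y1 y2)"
    if P: "hp n P" and a: "bihom M 1 0 (\<lambda>u :: nat \<Rightarrow> 'a. a)" and b: "bihom M 0 1 (\<lambda>u :: nat \<Rightarrow> 'a. b)" for n P a b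
  proof -
    have deg: "degree (P x1 x2 y1 y2) \<le> n" for x1 x2 y1 y2 using P by (simp add: hp_def)
    have bP: "bihom M k (Suc n - k) (\<lambda>u x1 x2 y1 y2. b x1 x2 y1 y2 * coeff (P x1 x2 y1 y2) k)" if "k \<le> n" for k
      using bihom_mult[OF b, of k "n - k" "\<lambda>u x1 x2 y1 y2. coeff (P x1 x2 y1 y2) k"] P that by (simp add: hp_def Suc_diff_le)
    have aP: "bihom M (Suc k) (n - k) (\<lambda>u x1 x2 y1 y2. a x1 x2 y1 y2 * coeff (P x1 x2 y1 y2) k)" if "k \<le> n" for k
      using bihom_mult[OF a, of k "n - k" "\<lambda>u x1 x2 y1 y2. coeff (P x1 x2 y1 y2) k"] P that by (simp add: hp_def)
    have "bihom M k (Suc n - k) (\<lambda>u x1 x2 y1 y2. coeff ([:b x1 x2 y1 y2, a x1 x2 y1 y2:] * P x1 x2 y1 y2) k)" if k: "k \<le> Suc n" for k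
    proof (cases k)
      case 0
      then show ?thesis using bP[of 0] by simp
    next
      case (Suc k')
      show ?thesis
      proof (cases "k \<le> n")
        case True
        then show ?thesis using bihom.add[OF bP[OF True]] aP[of k'] Suc by simp
      next
        case False
        then have kn: "k = Suc n" using k by simp
        then have "coeff (P x1 x2 y1 y2) k = 0" for x1 x2 y1 y2 using deg[of x1 x2 y1 y2] by (simp add: coeff_eq_0)
        then show ?thesis using aP[of n] kn by simp
      qed
    qed
    moreover have "degree ([:b x1 x2 y1 y2, a x1 x2 y1 y2:] * P x1 x2 y1 y2) \<le> Suc n" for x1 x2 y1 y2
      using degree_mult_le[of "[:b x1 x2 y1 y2, a x1 x2 y1 y2:]" "P x1 x2 y1 y2"] deg[of x1 x2 y1 y2]
        degree_pCons_le[of "b x1 x2 y1 y2" "[:a x1 x2 y1 y2:]"] by (simp del: mult_pCons_left)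
    ultimately show ?thesis unfolding hp_def by blast
  qed
  have "hp m (\<lambda>x1 x2 y1 y2. [:y2, x2:] ^ m)" for m
  proof (induction m)
    case 0
    show ?case using bihom_polyfun[OF polyfun_const[of M 1]] by (simp add: hp_def)
  next
    case (Suc m)
    show ?case using step[OF Suc bihom_vars(2,4)] by simp
  qed
  then have "hp (l + m) (\<lambda>x1 x2 y1 y2. [:y1, x1:] ^ l * [:y2, x2:] ^ m)" for l m
  proof (induction l)
    case (Suc l)
    show ?case using step[OF Suc(1)[OF Suc(2)] bihom_vars(1,3)] by (simp only: power_Suc mult.assoc add_Suc)
  qed simp
  then show ?thesis using assms by (auto simp: hp_def)
qed

lemma bihom_coords:
  assumes i: "i < 2 * D + 2"
  shows "bihom (2 * D + 2) (xdeg D i) (ydeg D i) (\<lambda>(u :: nat \<Rightarrow> 'a::comm_ring_1) x1 x2 y1 y2. coords D (conj_lift D (x1, y1, x2, y2) (pair_of D u)) i)"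
proof -
  have sub: "bihom (2 * D + 2) k (D - k) (\<lambda>(u :: nat \<Rightarrow> 'a) x1 x2 y1 y2. coeff (bform_subst D (\<Sum>l\<le>D. monom (u (l + e)) l) [:y1, x1:] [:y2, x2:]) k)"
    if k: "k \<le> D" and e: "e \<le> D + 1" for k e
  proof -
    have eq: "coeff (bform_subst D (\<Sum>l\<le>D. monom (u (l + e)) l) [:y1, x1:] [:y2, x2:]) k =
        (\<Sum>l\<le>D. u (l + e) * coeff ([:y1, x1:] ^ l * [:y2, x2:] ^ (D - l)) k)" for u :: "nat \<Rightarrow> 'a" and x1 x2 y1 y2
      unfolding bform_subst_def coeff_sum by (intro sum.cong) auto
    show ?thesis unfolding eq
    proof (intro bihom_sum bihom_scale polyfun_coord)
      fix l assume l: "l \<in> {..D}"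
      then show "l + e < 2 * D + 2" using e by simp
      show "bihom (2 * D + 2) k (D - k) (\<lambda>u x1 x2 y1 y2. coeff ([:y1, x1:] ^ l * [:y2, x2:] ^ (D - l)) k)"
        using bihom_linear_power_coeff[of k l "D - l" "2 * D + 2"] l k by simp
    qed
  qed
  show ?thesis
  proof (cases "i \<le> D")
    case True
    have "ydeg D i = 1 + (D - i)" using True by (simp add: ydeg_def xdeg_def)
    then have "bihom (2 * D + 2) (xdeg D i) (ydeg D i) (\<lambda>(u :: nat \<Rightarrow> 'a) x1 x2 y1 y2.
        y2 * coeff (bform_subst D (\<Sum>l\<le>D. monom (u l) l) [:y1, x1:] [:y2, x2:]) i -
        y1 * coeff (bform_subst D (\<Sum>l\<le>D. monom (u (l + D + 1)) l) [:y1, x1:] [:y2, x2:]) i)"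
      using bihom_diff[OF bihom_mult[OF bihom_vars(4) sub[OF True, of 0]] bihom_mult[OF bihom_vars(3) sub[OF True, of "D + 1"]]] True
      by (simp add: xdeg_def add.assoc)
    then show ?thesis using True by (simp add: pair_of_def conj_lift_def coords_def Let_def)
  next
    case False
    define j where "j = i - D - 1"
    have j: "j \<le> D" "xdeg D i = 1 + j" "ydeg D i = D - j" using False i by (auto simp: j_def ydeg_def xdeg_def)
    have "bihom (2 * D + 2) (xdeg D i) (ydeg D i) (\<lambda>(u :: nat \<Rightarrow> 'a) x1 x2 y1 y2.
        x1 * coeff (bform_subst D (\<Sum>l\<le>D. monom (u (l + D + 1)) l) [:y1, x1:] [:y2, x2:]) j -
        x2 * coeff (bform_subst D (\<Sum>l\<le>D. monom (u l) l) [:y1, x1:] [:y2, x2:]) j)"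
      using bihom_diff[OF bihom_mult[OF bihom_vars(1) sub[OF j(1), of "D + 1"]] bihom_mult[OF bihom_vars(2) sub[OF j(1), of 0]]]
      by (simp add: j(2,3) add.assoc)
    then show ?thesis using False by (simp add: pair_of_def conj_lift_def coords_def Let_def j_def)
  qed
qed

text \<open>In characteristic p take n = q - 1 with q a power of p. The inner entries of row q of
  Pascal's triangle vanish mod p, so neighbours in row q - 1 are negatives of each other, and the
  row starts with 1.\<close>

lemma ex_binomials_nonzero:
  "\<exists>n\<ge>N. \<forall>i\<le>n. of_nat (n choose i) \<noteq> (0 :: 'k::field)"
proof (cases "CHAR('k) = 0")
  case True
  then have "of_nat m \<noteq> (0 :: 'k)" if "m > 0" for m using that by (simp add: of_nat_eq_0_iff_char_dvd)
  then show ?thesis by (intro exI[of _ N]) auto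
next
  case False
  define p where "p = CHAR('k)"
  have p: "prime p" unfolding p_def using False by (intro prime_CHAR_semidom) simp
  define q where "q = p ^ (N + 1)"
  have p2: "p \<ge> 2" using p by (rule prime_ge_2_nat)
  have "N + 1 < 2 ^ (N + 1)" by (rule less_exp)
  also have "2 ^ (N + 1) \<le> q" unfolding q_def using p2 by (intro power_mono) auto
  finally have qN: "N + 1 < q" .
  have dvd: "p dvd (q choose i)" if i: "0 < i" "i < q" for i
  proof (rule ccontr)
    assume "\<not> p dvd (q choose i)"
    then have "coprime q (q choose i)" unfolding q_def using p by (simp add: prime_imp_coprime)
    moreover have "q dvd i * (q choose i)" using times_binomial_minus1_eq[OF i(1), of q] by simp
    ultimately have "q dvd i" by (simp add: coprime_dvd_mult_left_iff)
    then show False using i by (auto dest: dvd_imp_le)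
  qed
  have "of_nat ((q - 1) choose i) \<noteq> (0 :: 'k)" if "i \<le> q - 1" for i
    using that
  proof (induction i)
    case (Suc i)
    have "q = Suc (q - 1)" using qN by simp
    then have "(q choose Suc i) = ((q - 1) choose i) + ((q - 1) choose Suc i)" by (metis binomial_Suc_Suc)
    moreover have "of_nat (q choose Suc i) = (0 :: 'k)"
      using dvd[of "Suc i"] Suc.prems qN unfolding of_nat_eq_0_iff_char_dvd p_def by simp
    ultimately have "of_nat ((q - 1) choose i) + of_nat ((q - 1) choose Suc i) = (0 :: 'k)" by (metis of_nat_add)
    then show ?case using Suc by force
  qed simp
  then show ?thesis using qN by (intro exI[of _ "q - 1"]) auto
qed

section \<open>Invariants separating a semistable pair from zero\<close>

text \<open>Comparison of coefficients in t. It serves to isolate the part of torus weight 0, and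
  later the homogeneous components of an invariant.\<close>

lemma graded_components_eq:
  fixes e :: "'b \<Rightarrow> 'k::field" and e' :: "'c \<Rightarrow> 'k"
  assumes inf: "infinite (UNIV :: 'k set)" and fin: "finite S" "finite T"
    and eq: "\<And>t. t \<noteq> 0 \<Longrightarrow> (\<Sum>\<alpha>\<in>S. e \<alpha> * t ^ w \<alpha>) = (\<Sum>\<beta>\<in>T. e' \<beta> * t ^ w' \<beta>)"
  shows "(\<Sum>\<alpha>\<in>{\<alpha>\<in>S. w \<alpha> = m}. e \<alpha>) = (\<Sum>\<beta>\<in>{\<beta>\<in>T. w' \<beta> = m}. e' \<beta>)"
proof -
  let ?p = "\<Sum>\<alpha>\<in>S. monom (e \<alpha>) (w \<alpha>)" and ?q = "\<Sum>\<beta>\<in>T. monom (e' \<beta>) (w' \<beta>)"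
  have "UNIV - {0} \<subseteq> {t. poly ?p t = poly ?q t}" using eq by (auto simp: poly_sum poly_monom)
  moreover have "infinite (UNIV - {0 :: 'k})" using inf by simp
  ultimately have "?p = ?q" by (intro poly_eqI_infinite) (metis finite_subset)
  then have "coeff ?p m = coeff ?q m" by simp
  then show ?thesis using fin by (simp add: coeff_sum sum.inter_filter)
qed

lemma conj_lift_smult:
  "conj_lift D g (smult t F, smult t G) = map_prod (smult t) (smult t) (conj_lift D g (F, G))"
  by (cases g) (simp add: conj_lift_def Let_def bform_subst_smult smult_diff_right mult.commute)

lemma coords_conj_lift_smult: "coords D (conj_lift D g (smult t F, smult t G)) i = t * coords D (conj_lift D g (F, G)) i"
  unfolding conj_lift_smult by (cases "conj_lift D g (F, G)") (simp add: coords_smult)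

text \<open>The matrix of h on the n-th symmetric power: row i holds the coefficients of (a x1 + b
  x2)^i (c x1 + d x2)^(n - i).\<close>

definition rho :: "nat \<Rightarrow> 'k::comm_ring_1 \<times> 'k \<times> 'k \<times> 'k \<Rightarrow> nat \<Rightarrow> nat \<Rightarrow> 'k" where
  "rho n h i k = (case h of (a, b, c, d) \<Rightarrow> coeff ([:b, a:] ^ i * [:d, c:] ^ (n - i)) k)"

lemma rho_expand:
  fixes a b c d x1 x2 :: "'k::comm_ring_1"
  assumes "i \<le> n"
  shows "(a * x1 + b * x2) ^ i * (c * x1 + d * x2) ^ (n - i) = (\<Sum>k\<le>n. rho n (a, b, c, d) i k * x1 ^ k * x2 ^ (n - k))"
proof -
  have mon: "bform_eval n (monom 1 i) X Y = X ^ i * Y ^ (n - i)" for X Y :: 'k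
  proof -
    have "bform_eval n (monom 1 i) X Y = (\<Sum>j\<le>n. if j = i then X ^ j * Y ^ (n - j) else 0)"
      unfolding bform_eval_def by (intro sum.cong) auto
    then show ?thesis using assms by simp
  qed
  have "bform_eval (n * 1) (bform_subst n (monom 1 i) [:b, a:] [:d, c:]) x1 x2 =
      bform_eval n (monom 1 i) (bform_eval 1 [:b, a:] x1 x2) (bform_eval 1 [:d, c:] x1 x2)"
    by (rule bform_eval_subst) auto
  then have "bform_eval n ([:b, a:] ^ i * [:d, c:] ^ (n - i)) x1 x2 = (b * x2 + a * x1) ^ i * (d * x2 + c * x1) ^ (n - i)"
    using assms by (simp add: bform_subst_monom mon bform_eval_linear)
  then show ?thesis by (simp add: bform_eval_def rho_def add.commute)
qed

section \<open>Bihomogeneous forms under linear substitutions and the determinant of their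
  coefficients\<close>

lemma sum_swap3:
  "(\<Sum>j\<in>A. \<Sum>k\<in>B. \<Sum>l\<in>C. f j k l) = (\<Sum>k\<in>B. \<Sum>l\<in>C. \<Sum>j\<in>A. f j k l)"
  by (subst sum.swap, rule sum.cong[OF refl], rule sum.swap)

lemma bih_transform:
  "bih n S (a * x1 + b * x2) (c * x1 + d * x2) (a * y1 + b * y2) (c * y1 + d * y2) =
    bih n (\<lambda>k l. \<Sum>i\<le>n. \<Sum>j\<le>n. rho n (a, b, c, d) i k * S i j * rho n (a, b, c, d) j l) x1 x2 y1 y2"
proof -
  let ?r = "rho n (a, b, c, d)"
  have "bih n S (a * x1 + b * x2) (c * x1 + d * x2) (a * y1 + b * y2) (c * y1 + d * y2) =
    (\<Sum>i\<le>n. \<Sum>j\<le>n. S i j * ((a * x1 + b * x2) ^ i * (c * x1 + d * x2) ^ (n - i)) * ((a * y1 + b * y2) ^ j * (c * y1 + d * y2) ^ (n - j)))"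
    unfolding bih_def by (simp only: mult.assoc)
  also have "\<dots> = (\<Sum>i\<le>n. \<Sum>j\<le>n. S i j * (\<Sum>k\<le>n. ?r i k * x1 ^ k * x2 ^ (n - k)) * (\<Sum>l\<le>n. ?r j l * y1 ^ l * y2 ^ (n - l)))"
    by (intro sum.cong refl) (simp add: rho_expand)
  also have "\<dots> = (\<Sum>i\<le>n. \<Sum>j\<le>n. \<Sum>k\<le>n. \<Sum>l\<le>n. ?r i k * S i j * ?r j l * x1 ^ k * x2 ^ (n - k) * y1 ^ l * y2 ^ (n - l))"
    by (simp add: sum_distrib_left sum_distrib_right mult_ac)
  also have "\<dots> = (\<Sum>i\<le>n. \<Sum>k\<le>n. \<Sum>l\<le>n. \<Sum>j\<le>n. ?r i k * S i j * ?r j l * x1 ^ k * x2 ^ (n - k) * y1 ^ l * y2 ^ (n - l))"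
    by (rule sum.cong[OF refl], rule sum_swap3)
  also have "\<dots> = (\<Sum>k\<le>n. \<Sum>l\<le>n. \<Sum>i\<le>n. \<Sum>j\<le>n. ?r i k * S i j * ?r j l * x1 ^ k * x2 ^ (n - k) * y1 ^ l * y2 ^ (n - l))"
    by (rule sum_swap3)
  also have "\<dots> = bih n (\<lambda>k l. \<Sum>i\<le>n. \<Sum>j\<le>n. ?r i k * S i j * ?r j l) x1 x2 y1 y2"
    unfolding bih_def by (simp only: sum_distrib_right)
  finally show ?thesis .
qed

definition sqmat :: "nat \<Rightarrow> (nat \<Rightarrow> nat \<Rightarrow> 'k) \<Rightarrow> 'k mat" where
  "sqmat n S = mat (Suc n) (Suc n) (\<lambda>(i, j). S i j)"

text \<open>Coefficient matrices of bihomogeneous forms transform by congruence, T = r^t S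
  r.\<close>

lemma det_transform:
  fixes S r :: "nat \<Rightarrow> nat \<Rightarrow> 'k::comm_ring_1"
  assumes "\<And>k l. k \<le> n \<Longrightarrow> l \<le> n \<Longrightarrow> T k l = (\<Sum>i\<le>n. \<Sum>j\<le>n. r i k * S i j * r j l)"
  shows "det (sqmat n T) = det (sqmat n r) ^ 2 * det (sqmat n S)"
proof -
  have r: "sqmat n r \<in> carrier_mat (Suc n) (Suc n)" and S: "sqmat n S \<in> carrier_mat (Suc n) (Suc n)"
    by (simp_all add: sqmat_def)
  have idx: "{0..<Suc n} = {..n}" by auto
  have "sqmat n T = transpose_mat (sqmat n r) * (sqmat n S * sqmat n r)"
  proof (rule eq_matI)
    fix k l assume "k < dim_row (transpose_mat (sqmat n r) * (sqmat n S * sqmat n r))"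
      "l < dim_col (transpose_mat (sqmat n r) * (sqmat n S * sqmat n r))"
    then have kl: "k \<le> n" "l \<le> n" by (auto simp: sqmat_def)
    have "(transpose_mat (sqmat n r) * (sqmat n S * sqmat n r)) $$ (k, l) = (\<Sum>i\<le>n. r i k * (\<Sum>j\<le>n. S i j * r j l))"
      using kl by (simp add: sqmat_def scalar_prod_def idx)
    then show "sqmat n T $$ (k, l) = (transpose_mat (sqmat n r) * (sqmat n S * sqmat n r)) $$ (k, l)"
      using kl assms by (simp add: sqmat_def sum_distrib_left mult.assoc)
  qed (simp_all add: sqmat_def)
  then show ?thesis using r S
    by (simp add: det_mult[of _ "Suc n"] det_transpose[of _ "Suc n"] power2_eq_square mult_ac)
qed

definition bracket_power :: "nat \<Rightarrow> nat \<Rightarrow> nat \<Rightarrow> 'k::comm_ring_1" where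
  "bracket_power n i j = (if j = n - i then of_nat (n choose i) * (- 1) ^ (n - i) else 0)"

lemma bih_bracket_power: "bih n (bracket_power n) x1 x2 y1 y2 = (x1 * y2 - x2 * y1) ^ n"
proof -
  have "bih n (bracket_power n) x1 x2 y1 y2 =
      (\<Sum>i\<le>n. \<Sum>j\<le>n. if j = n - i then of_nat (n choose i) * (- 1) ^ (n - i) * x1 ^ i * x2 ^ (n - i) * y1 ^ j * y2 ^ (n - j) else 0)"
    unfolding bih_def by (intro sum.cong refl) (auto simp: bracket_power_def)
  also have "\<dots> = (\<Sum>i\<le>n. of_nat (n choose i) * (x1 * y2) ^ i * (- (x2 * y1)) ^ (n - i))"
  proof (intro sum.cong refl)
    fix i assume "i \<in> {..n}"
    then have "n - (n - i) = i" by simp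
    then show "(\<Sum>j\<le>n. if j = n - i then of_nat (n choose i) * (- 1) ^ (n - i) * x1 ^ i * x2 ^ (n - i) * y1 ^ j * y2 ^ (n - j) else 0) =
        of_nat (n choose i) * (x1 * y2) ^ i * (- (x2 * y1)) ^ (n - i)"
      by (simp add: power_mult_distrib power_minus[of "x2 * y1"] mult_ac)
  qed
  also have "\<dots> = (x1 * y2 + - (x2 * y1)) ^ n" by (rule binomial_ring[symmetric])
  finally show ?thesis by simp
qed

text \<open>The matrix is antidiagonal; reversing the columns makes it diagonal with signed binomial
  coefficients.\<close>

lemma det_bracket_power:
  assumes "\<And>i. i \<le> n \<Longrightarrow> of_nat (n choose i) \<noteq> (0 :: 'k::field)"
  shows "det (sqmat n (bracket_power n :: nat \<Rightarrow> nat \<Rightarrow> 'k)) \<noteq> 0"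
proof -
  let ?J = "sqmat n (bracket_power n :: nat \<Rightarrow> nat \<Rightarrow> 'k)"
  let ?P = "sqmat n (\<lambda>i j. if j = n - i then 1 else (0 :: 'k))"
  have J: "?J \<in> carrier_mat (Suc n) (Suc n)" and P: "?P \<in> carrier_mat (Suc n) (Suc n)" by (simp_all add: sqmat_def)
  have idx: "{0..<Suc n} = {..n}" by auto
  have ent: "(?J * ?P) $$ (i, j) = (if i = j then of_nat (n choose i) * (- 1) ^ (n - i) else 0)" if "i \<le> n" "j \<le> n" for i j
  proof -
    have "(?J * ?P) $$ (i, j) = (\<Sum>k\<le>n. bracket_power n i k * (if j = n - k then 1 else 0))"
      using that by (simp add: sqmat_def scalar_prod_def idx)
    also have "\<dots> = (\<Sum>k\<le>n. if k = n - i then (of_nat (n choose i) * (- 1) ^ (n - i)) * (if j = n - k then 1 else 0) else 0)"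
      by (intro sum.cong refl) (auto simp: bracket_power_def)
    also have "\<dots> = (of_nat (n choose i) * (- 1) ^ (n - i)) * (if j = n - (n - i) then 1 else 0)"
      by (simp only: sum.delta[OF finite_atMost]) simp
    finally show ?thesis using that by auto
  qed
  have "det (?J * ?P) = prod_list (diag_mat (?J * ?P))"
    by (rule det_upper_triangular[of _ "Suc n"]) (use J P ent in \<open>auto simp: upper_triangular_def sqmat_def\<close>)
  also have "\<dots> \<noteq> 0"
  proof -
    have "diag_mat (?J * ?P) = map (\<lambda>i. (?J * ?P) $$ (i, i)) [0..<Suc n]" by (simp add: diag_mat_def sqmat_def)
    then show ?thesis using ent assms by (auto simp: prod_list_zero_iff)
  qed
  finally show ?thesis using det_mult[OF J P] by auto
qed

text \<open>The part of f of weight 0, made homogeneous by powers of the bracket, is a form s of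
  bidegree (n, n) in the columns of the conjugating matrix. Its coefficient matrix is polynomial in
  the pair, and SL2 moves it by congruence, so its determinant f2 is a candidate invariant; a
  homogeneous component of f2 of positive degree is the one sought.\<close>

theorem not_unstable_imp_semistable:
  fixes F G :: "'k::field poly"
  assumes ac: "roots_exist TYPE('k)" and F: "degree F \<le> D" and G: "degree G \<le> D" and nu: "\<not> unstable D (F, G)"
  shows "semistable D (F, G)"
proof -
  have inf: "infinite (UNIV :: 'k set)" by (rule roots_exist_imp_infinite[OF ac])
  define M where "M = 2 * D + 2"
  obtain f where f: "polyfun M f" "f (\<lambda>_. 0) = 0"
    "\<And>a b c. a \<noteq> 0 \<Longrightarrow> f (coords D (conj_lift D (a, b, c, (1 + b * c) / a) (F, G))) = 1"
    using ex_polyfun_one_on_orbit[OF ac nu] unfolding M_def by blast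
  obtain S c where S: "finite S" "\<And>\<alpha> i. \<alpha> \<in> S \<Longrightarrow> i \<ge> M \<Longrightarrow> \<alpha> i = 0" "f = mp_eval M S c"
    by (rule polyfun_mp_eval[OF f(1)]) blast
  define mv where "mv = (\<lambda>\<alpha> (u :: nat \<Rightarrow> 'k). \<Prod>i<M. u i ^ \<alpha> i)"
  have f_mv: "f u = (\<Sum>\<alpha>\<in>S. c \<alpha> * mv \<alpha> u)" for u by (simp add: S(3) mp_eval_def mv_def)
  have mv_scale: "mv \<alpha> (\<lambda>i. t ^ w i * u i) = mv \<alpha> u * t ^ (\<Sum>i<M. w i * \<alpha> i)" for \<alpha> t w u
    unfolding mv_def by (rule prod_power_scale)
  have mv_cong: "mv \<alpha> u = mv \<alpha> u'" if "\<And>i. i < M \<Longrightarrow> u i = u' i" for \<alpha> u u'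
    unfolding mv_def using that by (intro prod.cong) auto
  define X where "X = (\<lambda>\<alpha>. \<Sum>i<M. xdeg D i * \<alpha> i)"
  define Y where "Y = (\<lambda>\<alpha>. \<Sum>i<M. ydeg D i * \<alpha> i)"
  \<comment> \<open>Nonconstant monomials of weight 0, which do not change when the conjugating
    matrix is multiplied on the right by diag(t, 1/t).\<close>
  define S1 where "S1 = {\<alpha> \<in> S. X \<alpha> = Y \<alpha> \<and> (\<exists>i<M. \<alpha> i \<noteq> 0)}"
  have finS1: "finite S1" using S(1) by (simp add: S1_def)
  have mv_0: "mv \<alpha> (\<lambda>_. 0) = (if \<exists>i<M. \<alpha> i \<noteq> 0 then 0 else 1)" for \<alpha> :: "nat \<Rightarrow> nat"
  proof (cases "\<exists>i<M. \<alpha> i \<noteq> 0")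
    case True
    then obtain i where "i < M" "(0 :: 'k) ^ \<alpha> i = 0" by (auto simp: power_0_left)
    then have "mv \<alpha> (\<lambda>_. 0) = 0" unfolding mv_def by (intro prod_zero) auto
    then show ?thesis using True by simp
  next
    case False
    then have "mv \<alpha> (\<lambda>_. 0) = 1" unfolding mv_def by (intro prod.neutral) auto
    then show ?thesis unfolding if_not_P[OF False] .
  qed
  \<comment> \<open>At most one exponent function in S has no nonzero value below M, and its
    coefficient is f(0) = 0.\<close>
  have c0: "c \<alpha> = 0" if "\<alpha> \<in> S" "\<not> (\<exists>i<M. \<alpha> i \<noteq> 0)" for \<alpha>
  proof -
    have eq: "\<alpha>' = \<alpha>" if "\<alpha>' \<in> S" "\<not> (\<exists>i<M. \<alpha>' i \<noteq> 0)" for \<alpha>'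
    proof
      fix i show "\<alpha>' i = \<alpha> i"
        using that \<open>\<alpha> \<in> S\<close> \<open>\<not> (\<exists>i<M. \<alpha> i \<noteq> 0)\<close> S(2)[of \<alpha> i] S(2)[of \<alpha>' i] by (cases "i < M") auto
    qed
    have "f (\<lambda>_. 0) = (\<Sum>\<alpha>'\<in>S. if \<alpha>' = \<alpha> then c \<alpha> else 0)"
      unfolding f_mv
    proof (intro sum.cong refl)
      fix \<alpha>' assume \<alpha>': "\<alpha>' \<in> S"
      show "c \<alpha>' * mv \<alpha>' (\<lambda>_. 0) = (if \<alpha>' = \<alpha> then c \<alpha> else 0)"
      proof (cases "\<alpha>' = \<alpha>")
        case True
        have "mv \<alpha> (\<lambda>_. 0) = 1" unfolding mv_0 if_not_P[OF that(2)] ..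
        then show ?thesis using True by simp
      next
        case False
        then have "\<exists>i<M. \<alpha>' i \<noteq> 0" using eq[OF \<alpha>'] by blast
        then have "mv \<alpha>' (\<lambda>_. 0) = 0" unfolding mv_0 by (rule if_P)
        then show ?thesis using False by simp
      qed
    qed
    then show ?thesis using f(2) that S(1) by simp
  qed
  have orbit: "(\<Sum>\<alpha>\<in>S1. c \<alpha> * mv \<alpha> (coords D (conj_lift D (a, b, e, (1 + b * e) / a) (F, G)))) = 1" if a: "a \<noteq> 0" for a b e
  proof -
    define u where "u = coords D (conj_lift D (a, b, e, (1 + b * e) / a) (F, G))"
    \<comment> \<open>Along g diag(t, 1/t) the monomial \<alpha> is scaled by t to the power X
      \<alpha> - Y \<alpha>. Shifting by K makes all exponents natural numbers, and weight 0 becomes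
      the coefficient of t^K.\<close>
    define K where "K = (\<Sum>\<alpha>\<in>S. Y \<alpha>)"
    have YK: "Y \<alpha> \<le> K" if "\<alpha> \<in> S" for \<alpha> unfolding K_def using that S(1) by (intro member_le_sum) auto
    have "(\<Sum>\<alpha>\<in>S. (c \<alpha> * mv \<alpha> u) * t ^ (X \<alpha> + (K - Y \<alpha>))) = (\<Sum>\<beta>\<in>{()}. 1 * t ^ K)" if t: "t \<noteq> 0" for t
    proof -
      let ?g = "(t * a, b / t, t * e, (1 + b / t * (t * e)) / (t * a))"
      have "?g = mmult (a, b, e, (1 + b * e) / a) (t, 0, 0, 1 / t)" using t a by (simp add: field_simps)
      then have co: "coords D (conj_lift D ?g (F, G)) i = t ^ xdeg D i * ((1 / t) ^ ydeg D i * u i)" if "i < M" for i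
        using that by (simp only: conj_lift_mmult[symmetric] coords_conj_diag M_def u_def) (simp add: mult_ac)
      have "mv \<alpha> (coords D (conj_lift D ?g (F, G))) = mv \<alpha> u * (1 / t) ^ Y \<alpha> * t ^ X \<alpha>" for \<alpha>
        using mv_cong[OF co, where \<alpha> = \<alpha>] by (simp only: mv_scale X_def Y_def)
      moreover have "f (coords D (conj_lift D ?g (F, G))) = 1" using t a by (intro f(3)) simp
      ultimately have "1 = (\<Sum>\<alpha>\<in>S. c \<alpha> * (mv \<alpha> u * (1 / t) ^ Y \<alpha> * t ^ X \<alpha>))" unfolding f_mv by simp
      then have "t ^ K = (\<Sum>\<alpha>\<in>S. c \<alpha> * (mv \<alpha> u * (1 / t) ^ Y \<alpha> * t ^ X \<alpha>)) * t ^ K" by simp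
      also have "\<dots> = (\<Sum>\<alpha>\<in>S. (c \<alpha> * mv \<alpha> u) * t ^ (X \<alpha> + (K - Y \<alpha>)))"
        unfolding sum_distrib_right
      proof (intro sum.cong refl)
        fix \<alpha> assume "\<alpha> \<in> S"
        then have "t ^ K = t ^ Y \<alpha> * t ^ (K - Y \<alpha>)" using YK by (simp flip: power_add)
        then show "c \<alpha> * (mv \<alpha> u * (1 / t) ^ Y \<alpha> * t ^ X \<alpha>) * t ^ K = (c \<alpha> * mv \<alpha> u) * t ^ (X \<alpha> + (K - Y \<alpha>))"
          using t by (simp add: power_add power_one_over)
      qed
      finally show ?thesis by simp
    qed
    from graded_components_eq[OF inf S(1) _ this, of K]
    have "(\<Sum>\<alpha>\<in>{\<alpha>\<in>S. X \<alpha> + (K - Y \<alpha>) = K}. c \<alpha> * mv \<alpha> u) = 1" by simp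
    also have "{\<alpha>\<in>S. X \<alpha> + (K - Y \<alpha>) = K} = {\<alpha>\<in>S. X \<alpha> = Y \<alpha>}" using YK by force
    also have "(\<Sum>\<alpha>\<in>{\<alpha>\<in>S. X \<alpha> = Y \<alpha>}. c \<alpha> * mv \<alpha> u) = (\<Sum>\<alpha>\<in>S1. c \<alpha> * mv \<alpha> u)"
      by (rule sum.mono_neutral_right) (use S(1) c0 in \<open>auto simp: S1_def\<close>)
    finally show ?thesis by (simp add: u_def)
  qed
  \<comment> \<open>Large enough for every bracket exponent n - X \<alpha> to be nonnegative, and
    with a regular coefficient matrix for the n-th bracket power.\<close>
  obtain n where n: "n \<ge> (\<Sum>\<alpha>\<in>S. X \<alpha>)" "\<And>i. i \<le> n \<Longrightarrow> of_nat (n choose i) \<noteq> (0 :: 'k)"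
    using ex_binomials_nonzero[of "\<Sum>\<alpha>\<in>S. X \<alpha>"] by blast
  have Xn: "X \<alpha> \<le> n" "Y \<alpha> = X \<alpha>" if "\<alpha> \<in> S1" for \<alpha>
  proof -
    have "X \<alpha> \<le> (\<Sum>\<alpha>\<in>S. X \<alpha>)" using that S(1) by (intro member_le_sum) (auto simp: S1_def)
    then show "X \<alpha> \<le> n" using n(1) by simp
    show "Y \<alpha> = X \<alpha>" using that by (simp add: S1_def)
  qed
  \<comment> \<open>The bracket is the determinant of the matrix with columns x and y; its powers
    bring all monomials to the common bidegree (n, n).\<close>
  define s where "s = (\<lambda>u x1 x2 y1 y2. \<Sum>\<alpha>\<in>S1. c \<alpha> * ((x1 * y2 - x2 * y1) ^ (n - X \<alpha>) *
      mv \<alpha> (coords D (conj_lift D (x1, y1, x2, y2) (pair_of D u)))))"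
  have "bihom M n n s"
    unfolding s_def
  proof (intro bihom_sum bihom_scale polyfun_const)
    fix \<alpha> assume \<alpha>: "\<alpha> \<in> S1"
    have "bihom M 1 1 (\<lambda>u x1 x2 y1 y2. x1 * y2 - x2 * y1 :: 'k)"
      using bihom_diff[OF bihom_mult[OF bihom_vars(1,4)] bihom_mult[OF bihom_vars(2,3)], of M] by simp
    from bihom_power[OF this, of "n - X \<alpha>"]
    have 1: "bihom M (n - X \<alpha>) (n - X \<alpha>) (\<lambda>u x1 x2 y1 y2. (x1 * y2 - x2 * y1 :: 'k) ^ (n - X \<alpha>))" by simp
    have 2: "bihom M (X \<alpha>) (Y \<alpha>) (\<lambda>u x1 x2 y1 y2 :: 'k. mv \<alpha> (coords D (conj_lift D (x1, y1, x2, y2) (pair_of D u))))"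
      unfolding mv_def X_def Y_def
      by (intro bihom_prod bihom_power) (use bihom_coords in \<open>auto simp: M_def\<close>)
    show "bihom M n n (\<lambda>u x1 x2 y1 y2 :: 'k. (x1 * y2 - x2 * y1) ^ (n - X \<alpha>) *
        mv \<alpha> (coords D (conj_lift D (x1, y1, x2, y2) (pair_of D u))))"
      using bihom_mult[OF 1 2] Xn[OF \<alpha>] by simp
  qed
  then obtain Sm where Sm: "\<And>i j. polyfun M (Sm i j)" "\<And>u x1 x2 y1 y2. s u x1 x2 y1 y2 = bih n (\<lambda>i j. Sm i j u) x1 x2 y1 y2"
    by (rule bihom_coeffs) blast
  define f2 where "f2 = (\<lambda>u. det (sqmat n (\<lambda>i j. Sm i j u)))"
  have f2_poly: "polyfun M f2" unfolding f2_def sqmat_def by (rule polyfun_det) (rule Sm(1))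
  let ?J = "bracket_power n :: nat \<Rightarrow> nat \<Rightarrow> 'k"
  have detJ: "det (sqmat n ?J) \<noteq> 0" by (rule det_bracket_power) (rule n(2))
  have sqcong: "sqmat n A = sqmat n B" if "\<And>i j. i \<le> n \<Longrightarrow> j \<le> n \<Longrightarrow> A i j = B i j" for A B :: "nat \<Rightarrow> nat \<Rightarrow> 'k"
    unfolding sqmat_def by (rule eq_matI) (use that in auto)
  have f2_inv: "f2 (coords D (conj_lift D h (F', G'))) = f2 (coords D (F', G'))"
    if h: "h \<in> sl2" and FG': "degree F' \<le> D" "degree G' \<le> D" for h F' G'
  proof -
    obtain h1 h2 h3 h4 where hh: "h = (h1, h2, h3, h4)" by (cases h)
    have det: "h1 * h4 - h2 * h3 = 1" using h by (simp add: hh sl2_def)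
    have br: "(h1 * x1 + h2 * x2) * (h3 * y1 + h4 * y2) - (h3 * x1 + h4 * x2) * (h1 * y1 + h2 * y2) = x1 * y2 - x2 * y1" for x1 x2 y1 y2
    proof -
      have "(h1 * x1 + h2 * x2) * (h3 * y1 + h4 * y2) - (h3 * x1 + h4 * x2) * (h1 * y1 + h2 * y2) = (h1 * h4 - h2 * h3) * (x1 * y2 - x2 * y1)"
        by (simp add: algebra_simps)
      then show ?thesis by (simp add: det)
    qed
    let ?r = "rho n h"
    \<comment> \<open>The bracket is itself invariant under SL2. Comparing determinants for its
      power shows that the symmetric power matrix has determinant of square 1.\<close>
    have "?J k l = (\<Sum>i\<le>n. \<Sum>j\<le>n. ?r i k * ?J i j * ?r j l)" if "k \<le> n" "l \<le> n" for k l
      by (rule bih_eqD[OF inf _ that])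
        (simp only: hh bih_transform[symmetric] bih_bracket_power br)
    then have "det (sqmat n ?J) = det (sqmat n ?r) ^ 2 * det (sqmat n ?J)" by (rule det_transform)
    then have r1: "det (sqmat n ?r) ^ 2 = 1" using detJ by simp
    let ?u = "coords D (F', G')" and ?u' = "coords D (conj_lift D h (F', G'))"
    have pu: "pair_of D ?u = (F', G')" by (rule pair_of_coords[OF FG'])
    have pu': "pair_of D ?u' = conj_lift D h (F', G')"
      using pair_of_coords[OF degree_conj_lift[of D h "(F', G')"]] by simp
    have s_h: "s ?u' x1 x2 y1 y2 = s ?u (h1 * x1 + h2 * x2) (h3 * x1 + h4 * x2) (h1 * y1 + h2 * y2) (h3 * y1 + h4 * y2)" for x1 x2 y1 y2
    proof -
      have m: "mmult h (x1, y1, x2, y2) = (h1 * x1 + h2 * x2, h1 * y1 + h2 * y2, h3 * x1 + h4 * x2, h3 * y1 + h4 * y2)"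
        by (simp add: hh)
      show ?thesis unfolding s_def pu pu' br conj_lift_mmult m ..
    qed
    have "Sm k l ?u' = (\<Sum>i\<le>n. \<Sum>j\<le>n. ?r i k * Sm i j ?u * ?r j l)" if "k \<le> n" "l \<le> n" for k l
      by (rule bih_eqD[OF inf _ that])
        (simp only: hh bih_transform[symmetric] Sm(2)[symmetric] s_h[unfolded hh])
    then have "f2 ?u' = det (sqmat n ?r) ^ 2 * f2 ?u" unfolding f2_def by (rule det_transform)
    then show ?thesis by (simp add: r1)
  qed
  define u0 where "u0 = coords D (F, G)"
  have f2_u0: "f2 u0 \<noteq> 0"
  proof -
    have "Sm i j u0 = ?J i j" if "i \<le> n" "j \<le> n" for i j
    proof (rule bih_eqD[OF inf _ that])
      fix x y :: 'k assume xy: "x \<noteq> 0" "x \<noteq> y"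
      define \<delta> where "\<delta> = x - y"
      have d0: "\<delta> \<noteq> 0" using xy by (simp add: \<delta>_def)
      \<comment> \<open>The matrix with columns (x, 1) and (y, 1) is this element of SL2 times
        diag(1, \<delta>). The weight 0 part is 1 at the former, and diag(1, \<delta>) together with
        the bracket powers contributes \<delta>^n to every monomial, so s is the n-th bracket power
        here.\<close>
      let ?g = "(x, y / \<delta>, 1, (1 + y / \<delta> * 1) / x)"
      define u where "u = coords D (conj_lift D ?g (F, G))"
      have "1 + y / \<delta> = x / \<delta>" using d0 by (simp add: field_simps \<delta>_def)
      then have "(x, y, 1, 1) = mmult ?g (1, 0, 0, \<delta>)" using xy d0 by simp
      then have co: "coords D (conj_lift D (x, y, 1, 1) (F, G)) i = \<delta> ^ ydeg D i * u i" if "i < M" for i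
        using that by (simp only: conj_lift_mmult[symmetric] coords_conj_diag M_def u_def) simp
      have mvd: "mv \<alpha> (coords D (conj_lift D (x, y, 1, 1) (F, G))) = mv \<alpha> u * \<delta> ^ Y \<alpha>" for \<alpha>
        using mv_cong[OF co, where \<alpha> = \<alpha>] by (simp only: mv_scale Y_def)
      have "s u0 x 1 y 1 = (\<Sum>\<alpha>\<in>S1. c \<alpha> * (\<delta> ^ (n - X \<alpha>) * (mv \<alpha> u * \<delta> ^ Y \<alpha>)))"
        unfolding s_def u0_def pair_of_coords[OF F G] mvd by (simp add: \<delta>_def)
      also have "\<dots> = (\<Sum>\<alpha>\<in>S1. (c \<alpha> * mv \<alpha> u) * \<delta> ^ n)"
      proof (intro sum.cong refl)
        fix \<alpha> assume "\<alpha> \<in> S1"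
        then have "\<delta> ^ n = \<delta> ^ (n - X \<alpha>) * \<delta> ^ Y \<alpha>" using Xn by (simp flip: power_add)
        then show "c \<alpha> * (\<delta> ^ (n - X \<alpha>) * (mv \<alpha> u * \<delta> ^ Y \<alpha>)) = (c \<alpha> * mv \<alpha> u) * \<delta> ^ n" by (simp add: mult_ac)
      qed
      also have "\<dots> = \<delta> ^ n" using orbit[OF xy(1), of "y / \<delta>" 1] by (simp add: u_def flip: sum_distrib_right)
      finally show "bih n (\<lambda>i j. Sm i j u0) x 1 y 1 = bih n ?J x 1 y 1"
        by (simp add: bih_bracket_power \<delta>_def flip: Sm(2))
    qed
    then have "sqmat n (\<lambda>i j. Sm i j u0) = sqmat n ?J" by (rule sqcong)
    then show ?thesis using detJ by (simp add: f2_def)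
  qed
  \<comment> \<open>Needed so that the component with nonzero value has positive degree: no monomial
    in S1 is constant, so s vanishes for the zero pair.\<close>
  have f2_0: "f2 (\<lambda>_. 0) = 0"
  proof -
    have "conj_lift D g (0, 0) = (0, 0)" for g :: "'k \<times> 'k \<times> 'k \<times> 'k" by (cases g) (simp add: conj_lift_def)
    then have "coords D (conj_lift D g (pair_of D (\<lambda>_. 0))) = (\<lambda>_. 0 :: 'k)" for g
      by (auto simp: pair_of_def coords_def fun_eq_iff)
    then have "s (\<lambda>_. 0) x1 x2 y1 y2 = 0" for x1 x2 y1 y2
      unfolding s_def by (intro sum.neutral) (auto simp: mv_0 S1_def)
    then have "bih n (\<lambda>i j. Sm i j (\<lambda>_. 0)) x 1 y 1 = bih n (\<lambda>i j. 0) x 1 y 1" for x y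
      by (simp add: bih_def[of n "\<lambda>i j. 0"] flip: Sm(2))
    then have "Sm i j (\<lambda>_. 0) = 0" if "i \<le> n" "j \<le> n" for i j using bih_eqD[OF inf _ that] by blast
    then have "sqmat n (\<lambda>i j. Sm i j (\<lambda>_. 0)) = 0\<^sub>m (Suc n) (Suc n)" by (intro eq_matI) (auto simp: sqmat_def)
    then show ?thesis by (simp add: f2_def)
  qed
  obtain T e where T: "finite T" "\<And>\<alpha> i. \<alpha> \<in> T \<Longrightarrow> i \<ge> M \<Longrightarrow> \<alpha> i = 0" "f2 = mp_eval M T e"
    by (rule polyfun_mp_eval[OF f2_poly]) blast
  define dg where "dg = (\<lambda>\<alpha> :: nat \<Rightarrow> nat. \<Sum>i<M. \<alpha> i)"
  have f2_mv: "f2 u = (\<Sum>\<alpha>\<in>T. e \<alpha> * mv \<alpha> u)" for u by (simp add: T(3) mp_eval_def mv_def)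
  have f2_scale: "f2 (\<lambda>i. t * u i) = (\<Sum>\<alpha>\<in>T. (e \<alpha> * mv \<alpha> u) * t ^ dg \<alpha>)" for t u
    unfolding f2_mv using mv_scale[of _ t "\<lambda>_. 1" u] by (simp add: dg_def mult.assoc)
  define Tm where "Tm = (\<lambda>m. {\<alpha>\<in>T. dg \<alpha> = m})"
  have comp: "mp_eval M (Tm m) e u = (\<Sum>\<alpha>\<in>Tm m. e \<alpha> * mv \<alpha> u)" for m u by (simp add: mp_eval_def mv_def)
  have "\<exists>m. mp_eval M (Tm m) e u0 \<noteq> 0"
  proof (rule ccontr)
    assume neg: "\<not> ?thesis"
    have "f2 u0 = (\<Sum>m\<in>dg ` T. \<Sum>\<alpha>\<in>Tm m. e \<alpha> * mv \<alpha> u0)"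
      unfolding f2_mv Tm_def by (rule sum.image_gen[OF T(1)])
    also have "\<dots> = 0" using neg by (simp add: comp)
    finally show False using f2_u0 by simp
  qed
  then obtain m where m: "mp_eval M (Tm m) e u0 \<noteq> 0" by blast
  have "m > 0"
  proof (rule ccontr)
    assume "\<not> m > 0"
    then have m0: "m = 0" by simp
    have z: "(\<exists>i<M. \<alpha> i \<noteq> 0) \<longleftrightarrow> dg \<alpha> \<noteq> 0" for \<alpha> by (auto simp: dg_def)
    have "mp_eval M (Tm 0) e u0 = (\<Sum>\<alpha>\<in>Tm 0. e \<alpha>)"
      unfolding comp
    proof (intro sum.cong refl)
      fix \<alpha> assume "\<alpha> \<in> Tm 0"
      then have "\<alpha> i = 0" if "i < M" for i using that z[of \<alpha>] by (auto simp: Tm_def)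
      then show "e \<alpha> * mv \<alpha> u0 = e \<alpha>" by (simp add: mv_def)
    qed
    also have "\<dots> = f2 (\<lambda>_. 0)"
      unfolding f2_mv mv_0 z Tm_def using T(1) by (intro sum.mono_neutral_cong_left) auto
    finally show False using m m0 f2_0 by simp
  qed
  moreover have "mp_eval M (Tm m) e (coords D (conj_lift D g (F', G'))) = mp_eval M (Tm m) e (coords D (F', G'))"
    if g: "g \<in> sl2" and FG': "degree F' \<le> D" "degree G' \<le> D" for g F' G'
    unfolding comp unfolding Tm_def
  proof (rule graded_components_eq[OF inf T(1) T(1)])
    \<comment> \<open>Conjugation is linear in the pair, so scaling by t separates the invariance of
      f2 into its homogeneous components.\<close>
    fix t :: 'k assume "t \<noteq> 0"
    have "degree (smult t F') \<le> D" "degree (smult t G') \<le> D"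
      using FG' degree_smult_le order_trans by blast+
    from f2_inv[OF g this] have "f2 (\<lambda>i. t * coords D (conj_lift D g (F', G')) i) = f2 (\<lambda>i. t * coords D (F', G') i)"
      by (simp only: ext[of "coords D (conj_lift D g (smult t F', smult t G'))", OF coords_conj_lift_smult]
          ext[of "coords D (smult t F', smult t G')", OF coords_smult])
    then show "(\<Sum>\<alpha>\<in>T. e \<alpha> * mv \<alpha> (coords D (conj_lift D g (F', G'))) * t ^ dg \<alpha>) =
        (\<Sum>\<alpha>\<in>T. e \<alpha> * mv \<alpha> (coords D (F', G')) * t ^ dg \<alpha>)" by (simp only: f2_scale)
  qed
  moreover have "finite (Tm m)" "\<forall>\<alpha>\<in>Tm m. (\<forall>i\<ge>M. \<alpha> i = 0) \<and> (\<Sum>i<M. \<alpha> i) = m"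
    using T by (auto simp: Tm_def dg_def)
  ultimately show ?thesis
    unfolding semistable_def M_def[symmetric]
    using m unfolding u0_def by (intro exI[of _ m] exI[of _ "Tm m"] exI[of _ e]) blast
qed

section \<open>Iterates\<close>

lemma bires_linear:
  fixes a b c d :: "'a::field"
  assumes "a * d - b * c \<noteq> 0"
  shows "bires 1 1 [:b, a:] [:d, c:] = a * d - b * c"
proof -
  have "(b, a) \<noteq> (0, 0)" using assms by auto
  then show ?thesis using bires_poisson[of "[:d, c:]" 1 1 "\<lambda>_. b" "\<lambda>_. a" 1]
    by (simp add: bform_eval_linear algebra_simps)
qed

text \<open>The outer matrix contributes its determinant to the power D, the inner substitution to
  the power D^2; both are 1.\<close>

lemma bires_conj_lift:
  fixes F G :: "'a::field poly"
  assumes ac: "roots_exist TYPE('a)" and F: "degree F \<le> D" and G: "degree G \<le> D" and h: "h \<in> sl2"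
    and eq: "conj_lift D h (F, G) = (F', G')"
  shows "bires D D F' G' = bires D D F G"
proof -
  obtain a b c d where hh: "h = (a, b, c, d)" by (cases h)
  have det: "a * d - b * c = 1" using h by (simp add: hh sl2_def)
  let ?F = "bform_subst D F [:b, a:] [:d, c:]" and ?G = "bform_subst D G [:b, a:] [:d, c:]"
  have "F' = smult d ?F + smult (- b) ?G" "G' = smult (- c) ?F + smult a ?G"
    using eq by (auto simp: hh conj_lift_def Let_def)
  then have "bires D D F' G' = (d * a - (- b) * (- c)) ^ D * bires D D ?F ?G"
    by (simp only: bires_mix)
  also have "bires D D ?F ?G = bires D D F G ^ 1 * bires 1 1 [:b, a:] [:d, c:] ^ (D * D)"
    using bires_comp[OF ac F G, of "[:b, a:]" 1 "[:d, c:]"] by simp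
  also have "bires 1 1 [:b, a:] [:d, c:] = 1" using bires_linear[of a d b c] det by simp
  finally show ?thesis using det by (simp add: mult.commute)
qed

lemma degree_iter_lift:
  "degree (fst (iter_lift d FG n)) \<le> d ^ n \<and> degree (snd (iter_lift d FG n)) \<le> d ^ n"
proof (induction n)
  case (Suc n)
  obtain A B where "iter_lift d FG n = (A, B)" by (cases "iter_lift d FG n")
  then show ?case using Suc by (simp add: degree_bform_subst)
qed simp

text \<open>In determinant 1 the inner factors h and h^-1 cancel exactly, so the lifts themselves
  agree and not only up to a scalar.\<close>

lemma iter_lift_conj:
  fixes F G :: "'a::field poly"
  assumes h: "h \<in> sl2"
  shows "iter_lift d (conj_lift d h (F, G)) n = conj_lift (d ^ n) h (iter_lift d (F, G) n)"
proof -
  obtain a b c e where hh: "h = (a, b, c, e)" by (cases h)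
  have det: "a * e - b * c = 1" using h by (simp add: hh sl2_def)
  show ?thesis
  proof (induction n)
    case 0
    have "bform_subst (Suc 0) 1 P Q = Q" for P Q :: "'a poly" by (simp add: bform_subst_def)
    then have "conj_lift 1 h ([:0, 1:], 1) = ([:0, a * e - b * c:], [:a * e - b * c:])"
      by (simp add: hh conj_lift_def Let_def bform_subst_linear mult.commute)
    then show ?case using det by (simp add: one_pCons)
  next
    case (Suc n)
    obtain A B where AB: "iter_lift d (F, G) n = (A, B)" by (cases "iter_lift d (F, G) n")
    have deg: "degree A \<le> d ^ n" "degree B \<le> d ^ n" using degree_iter_lift[of d "(F, G)" n] AB by auto
    define A2 where "A2 = bform_subst (d ^ n) A [:b, a:] [:e, c:]"
    define B2 where "B2 = bform_subst (d ^ n) B [:b, a:] [:e, c:]"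
    let ?A = "smult e A2 - smult b B2" and ?B = "smult a B2 - smult c A2"
    have conjAB: "conj_lift (d ^ n) h (A, B) = (?A, ?B)" by (simp add: hh conj_lift_def Let_def A2_def B2_def)
    have "smult b ?B + smult a ?A = smult (a * e - b * c) A2"
      by (simp add: smult_diff_right smult_diff_left algebra_simps)
    moreover have "smult e ?B + smult c ?A = smult (a * e - b * c) B2"
      by (simp add: smult_diff_right smult_diff_left algebra_simps)
    ultimately have inv: "smult b ?B + smult a ?A = A2" "smult e ?B + smult c ?A = B2" by (simp_all add: det)
    have sub: "bform_subst d (bform_subst d H [:b, a:] [:e, c:]) ?A ?B =
        bform_subst (d * d ^ n) (bform_subst d H A B) [:b, a:] [:e, c:]" for H
    proof -
      have "bform_subst (d * 1) (bform_subst d H [:b, a:] [:e, c:]) ?A ?B =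
          bform_subst d H (bform_subst 1 [:b, a:] ?A ?B) (bform_subst 1 [:e, c:] ?A ?B)"
        by (rule bform_subst_subst) auto
      also have "\<dots> = bform_subst d H A2 B2"
        using inv by (simp only: One_nat_def bform_subst_linear)
      also have "\<dots> = bform_subst (d * d ^ n) (bform_subst d H A B) [:b, a:] [:e, c:]"
        unfolding A2_def B2_def by (rule bform_subst_subst[OF deg, symmetric])
      finally show ?thesis by simp
    qed
    have "iter_lift d (conj_lift d h (F, G)) (Suc n) =
        (bform_subst d (fst (conj_lift d h (F, G))) ?A ?B, bform_subst d (snd (conj_lift d h (F, G))) ?A ?B)"
      using Suc AB conjAB by simp
    also have "\<dots> = conj_lift (d * d ^ n) h (bform_subst d F A B, bform_subst d G A B)"
      by (simp add: hh conj_lift_def Let_def bform_subst_diff bform_subst_smult sub)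
    finally show ?case using AB by simp
  qed
qed

lemma iter_lift_smult:
  fixes F G :: "'a::field poly"
  assumes "t \<noteq> 0"
  shows "\<exists>r. r \<noteq> 0 \<and> iter_lift d (smult t F, smult t G) n = map_prod (smult r) (smult r) (iter_lift d (F, G) n)"
proof (induction n)
  case 0
  show ?case by (intro exI[of _ 1]) simp
next
  case (Suc n)
  then obtain r where r: "r \<noteq> 0" "iter_lift d (smult t F, smult t G) n = map_prod (smult r) (smult r) (iter_lift d (F, G) n)" by blast
  obtain A B where AB: "iter_lift d (F, G) n = (A, B)" by (cases "iter_lift d (F, G) n")
  show ?case using r AB assms
    by (intro exI[of _ "t * r ^ d"]) (simp add: bform_subst_smult bform_subst_scale)
qed

text \<open>The composition formula yields the recursion e(n + 1) = d^n + d^2 e(n). Its solution,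
  stated without division, is the constant of the minimal resultant formula.\<close>

lemma bires_iter_lift:
  fixes F G :: "'a::field poly"
  assumes ac: "roots_exist TYPE('a)" and F: "degree F \<le> d" and G: "degree G \<le> d"
  shows "\<exists>e. bires (d ^ n) (d ^ n) (fst (iter_lift d (F, G) n)) (snd (iter_lift d (F, G) n)) = bires d d F G ^ e
     \<and> e * (d * (d - 1)) = d ^ n * (d ^ n - 1)"
proof (induction n)
  case 0
  have "bires 1 1 [:0, 1:] [:1, 0:] = (1 :: 'a)" using bires_linear[of 1 1 0 0] by simp
  then show ?case by (intro exI[of _ 0]) (simp add: one_pCons)
next
  case (Suc n)
  obtain A B where AB: "iter_lift d (F, G) n = (A, B)" by (cases "iter_lift d (F, G) n")
  have deg: "degree A \<le> d ^ n" "degree B \<le> d ^ n" using degree_iter_lift[of d "(F, G)" n] AB by auto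
  obtain e where e: "bires (d ^ n) (d ^ n) A B = bires d d F G ^ e" "e * (d * (d - 1)) = d ^ n * (d ^ n - 1)"
    using Suc AB by auto
  have "bires (d * d ^ n) (d * d ^ n) (bform_subst d F A B) (bform_subst d G A B) = bires d d F G ^ (d ^ n + e * (d * d))"
    unfolding bires_comp[OF ac F G deg] e(1) by (simp add: power_add power_mult)
  moreover have "(d ^ n + e * (d * d)) * (d * (d - 1)) = d ^ Suc n * (d ^ Suc n - 1)"
  proof (cases "d = 0")
    case False
    then obtain k where k: "d = Suc k" by (cases d) auto
    obtain l where l: "d ^ n = Suc l" using False by (metis not0_implies_Suc power_not_zero)
    have "(d ^ n + e * (d * d)) * (d * (d - 1)) = d ^ n * (d * (d - 1)) + (d * d) * (e * (d * (d - 1)))" by (simp add: algebra_simps)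
    also have "\<dots> = d ^ n * d * ((d - 1) + d * (d ^ n - 1))" unfolding e(2) by (simp add: algebra_simps)
    also have "(d - 1) + d * (d ^ n - 1) = d ^ Suc n - 1" using k l by simp
    finally show ?thesis by (simp add: mult_ac)
  qed simp
  ultimately show ?case using AB by auto
qed

text \<open>A nonzero form is a product of linear forms, so if it vanishes on (P, Q) one linear form
  does, and P and Q are proportional.\<close>

lemma constant_direction:
  fixes H P Q :: "'k::field poly"
  assumes ac: "roots_exist TYPE('k)" and H: "degree H \<le> d" "H \<noteq> 0" and z: "bform_subst d H P Q = 0"
  obtains a b K where "(a, b) \<noteq> (0, 0)" "P = smult a K" "Q = smult b K"
proof -
  obtain c l0 l1 where *: "H = smult c (\<Prod>i<d. [:l0 i, l1 i:])" "\<And>i. (l0 i, l1 i) \<noteq> (0::'k, 0::'k)"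
    by (rule bform_factorization[OF ac H(1)]) blast
  have "c \<noteq> 0" using * H(2) by auto
  moreover have "bform_subst d H P Q = smult c (\<Prod>i<d. smult (l0 i) Q + smult (l1 i) P)"
    using bform_subst_prod[of d "\<lambda>i. [:l0 i, l1 i:]" 1 P Q] by (simp add: *(1) bform_subst_smult bform_subst_linear)
  ultimately obtain i where i: "smult (l0 i) Q + smult (l1 i) P = 0" using z by auto
  show ?thesis
  proof (cases "l1 i = 0")
    case True
    then have l0: "l0 i \<noteq> 0" using *(2)[of i] by simp
    then have "Q = 0" using i True by simp
    then show ?thesis using that[of 1 0 P] by simp
  next
    case False
    have "smult (l1 i) P = smult (- l0 i) Q" using i by (simp add: eq_neg_iff_add_eq_0 add.commute)
    then have "smult (1 / l1 i) (smult (l1 i) P) = smult (1 / l1 i) (smult (- l0 i) Q)" by simp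
    then have "P = smult (- l0 i / l1 i) Q" using False by simp
    then show ?thesis using that[of "- l0 i / l1 i" 1 Q] by simp
  qed
qed

text \<open>The induction also carries that an iterate of constant direction [a:b] forces (F, G) to
  have that direction. If the next iterate vanishes, then (P, Q) has a constant direction, hence so
  has (F, G) = (aA, bA), and the vanishing says A(a, b) = 0, which is membership in I(d).\<close>

lemma not_in_I_imp_iter_lift_nonzero:
  fixes F G :: "'k::field poly"
  assumes ac: "roots_exist TYPE('k)" and F: "degree F \<le> d" and G: "degree G \<le> d" and nI: "\<not> in_I d (F, G)"
  shows "iter_lift d (F, G) n \<noteq> (0, 0)"
proof -
  have FG0: "(F, G) \<noteq> (0, 0)"
  proof
    assume "(F, G) = (0, 0)"
    then have "in_I d (F, G)" unfolding in_I_def by (intro exI[of _ 0] exI[of _ 1]) (auto simp: bform_eval_def)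
    then show False using nI by simp
  qed
  have "iter_lift d (F, G) n \<noteq> (0, 0) \<and>
      (\<forall>a b K. (a, b) \<noteq> (0, 0) \<longrightarrow> iter_lift d (F, G) n = (smult a K, smult b K) \<longrightarrow>
        (\<exists>A. degree A \<le> d \<and> F = smult a A \<and> G = smult b A))"
  proof (induction n)
    case 0
    have "(a, b) = (0, 0)" if "([:0, 1:], 1) = (smult a K, smult b K)" for a b :: 'k and K
    proof -
      have k: "[:0, 1:] = smult a K" "1 = smult b K" using that by auto
      have "smult b (smult a K) = smult a (smult b K)" by (simp add: mult.commute)
      then have "smult b [:0, 1:] = smult a 1" by (simp only: k[symmetric])
      then have "[:0, b:] = [:a:]" by (simp add: one_pCons)
      then show ?thesis by simp
    qed
    then show ?case by (auto simp del: prod.inject)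
  next
    case (Suc n)
    obtain P Q where PQ: "iter_lift d (F, G) n = (P, Q)" by (cases "iter_lift d (F, G) n")
    have IH1: "(P, Q) \<noteq> (0, 0)" using Suc PQ by simp
    have IH2: "\<exists>A. degree A \<le> d \<and> F = smult a A \<and> G = smult b A" if "(a, b) \<noteq> (0, 0)" "P = smult a K" "Q = smult b K" for a b K
      using Suc PQ that by blast
    let ?P = "bform_subst d F P Q" and ?Q = "bform_subst d G P Q"
    have it: "iter_lift d (F, G) (Suc n) = (?P, ?Q)" using PQ by simp
    have nz: "(?P, ?Q) \<noteq> (0, 0)"
    proof
      assume z: "(?P, ?Q) = (0, 0)"
      obtain a b K where abK: "(a, b) \<noteq> (0, 0)" "P = smult a K" "Q = smult b K"
      proof (cases "F = 0")
        case True
        then have "G \<noteq> 0" using FG0 by simp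
        then show ?thesis using constant_direction[OF ac G] z that by auto
      next
        case False
        then show ?thesis using constant_direction[OF ac F] z that by auto
      qed
      have K0: "K \<noteq> 0" using IH1 abK by auto
      obtain A where A: "degree A \<le> d" "F = smult a A" "G = smult b A" using IH2[OF abK] by blast
      have "bform_eval d F a b = 0" "bform_eval d G a b = 0"
        using z K0 unfolding abK(2,3) bform_subst_proportional by auto
      then have "bform_eval d A a b = 0" using abK(1) by (auto simp: A(2,3) bform_eval_smult)
      then have "in_I d (F, G)" unfolding in_I_def using A abK(1) by auto
      then show False using nI by simp
    qed
    have "\<exists>A. degree A \<le> d \<and> F = smult a A \<and> G = smult b A"
      if ab: "(a, b) \<noteq> (0, 0)" and K: "?P = smult a K" "?Q = smult b K" for a b K
    proof -
      \<comment> \<open>This form vanishes on (P, Q). If it were nonzero, (P, Q) and hence (F, G)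
        would have a constant direction (a', b'). The next iterate then has that direction too, so
        (a', b') is proportional to (a, b) and the form is zero after all.\<close>
      let ?L = "smult b F - smult a G"
      have L0: "bform_subst d ?L P Q = 0"
        by (simp add: bform_subst_diff bform_subst_smult K mult.commute)
      have "?L = 0"
      proof (rule ccontr)
        assume L: "?L \<noteq> 0"
        have "degree ?L \<le> d" using F G by (intro degree_diff_le order_trans[OF degree_smult_le])
        then obtain a' b' K' where c: "(a', b') \<noteq> (0, 0)" "P = smult a' K'" "Q = smult b' K'"
          by (rule constant_direction[OF ac _ L L0])
        obtain A where A: "F = smult a' A" "G = smult b' A" using IH2[OF c] by blast
        let ?W = "bform_subst d A P Q"
        have W: "smult a' ?W = smult a K" "smult b' ?W = smult b K"
          using K by (simp_all add: A bform_subst_smult)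
        have "?W \<noteq> 0" using nz by (auto simp: A bform_subst_smult)
        have "smult (b * a') ?W = smult b (smult a' ?W)" by simp
        also have "\<dots> = smult a (smult b' ?W)" unfolding W by (simp add: mult.commute)
        finally have "smult (b * a' - a * b') ?W = 0" by (simp add: smult_diff_left)
        then have "b * a' - a * b' = 0" using \<open>?W \<noteq> 0\<close> by simp
        then have "?L = 0" by (simp add: A smult_diff_left[symmetric])
        then show False using L by simp
      qed
      then have eq: "smult b F = smult a G" by simp
      show ?thesis
      proof (cases "a = 0")
        case True
        then have b: "b \<noteq> 0" using ab by simp
        then have "F = 0" using eq True by simp
        then show ?thesis using True b G by (intro exI[of _ "smult (1 / b) G"]) (auto intro: order_trans[OF degree_smult_le])
      next
        case False
        have "G = smult (1 / a) (smult a G)" using False by simp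
        then have "G = smult b (smult (1 / a) F)" by (simp flip: eq add: mult.commute)
        then show ?thesis using False F by (intro exI[of _ "smult (1 / a) F"]) (auto intro: order_trans[OF degree_smult_le])
      qed
    qed
    then show ?case unfolding it using nz by blast
  qed
  then show ?thesis by blast
qed

text \<open>Substituting (aA, bA) into itself produces only multiples of A(a, b), so the second
  iterate already vanishes.\<close>

lemma in_I_imp_iter_lift_zero:
  assumes "in_I d (F, G)" "degree F \<le> d" "degree G \<le> d"
  shows "iter_lift d (F, G) 2 = (0, 0 :: 'k::field poly)"
proof -
  obtain A a b where A: "F = smult a A" "G = smult b A" "bform_eval d A a b = 0"
    using assms(1) unfolding in_I_def by auto
  have "iter_lift d (F, G) 2 = (bform_subst d F F G, bform_subst d G F G)"
    using assms(2,3) by (simp add: numeral_2_eq_2 bform_subst_id one_pCons)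
  also have "\<dots> = (0, 0)"
    by (simp add: A bform_subst_proportional bform_eval_smult)
  finally show ?thesis .
qed

lemma in_I_smult:
  assumes "in_I d (F, G)"
  shows "in_I d (smult r F, smult r G)"
proof -
  obtain A a b where A: "degree A \<le> d" "(a, b) \<noteq> (0, 0)" "F = smult a A" "G = smult b A" "bform_eval d A a b = 0"
    using assms unfolding in_I_def by auto
  then show ?thesis unfolding in_I_def
    by (intro exI[of _ "smult r A"] exI[of _ a] exI[of _ b])
      (auto simp: bform_eval_smult mult.commute intro: order_trans[OF degree_smult_le])
qed

section \<open>Semistable reduction and the minimal resultant\<close>

context valued_field
begin

lemma bires_nz_imp_nonzero: "D \<ge> 1 \<Longrightarrow> bires D D F G \<noteq> 0 \<Longrightarrow> (F, G) \<noteq> (0, 0 :: 'a poly)"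
  using bires_smult[of D 0 0 0] by (auto simp: zero_power)

lemma normalized_multiple:
  assumes "degree F \<le> D" "degree G \<le> D" "(F, G) \<noteq> (0, 0)"
  obtains t where "t \<noteq> 0" "N D (smult t F, smult t G) = 1"
    "red_pair absv red D (F, G) = map_pair red (smult t F, smult t G)"
proof -
  obtain c where c: "absv c = N D (F, G)" "normalize_lift absv D (F, G) = (smult (inverse c) F, smult (inverse c) G)"
    by (rule normalize_lift_eq)
  have "absv c > 0" using nrm_pos[OF assms] c by simp
  then have "c \<noteq> 0" by simp
  then show ?thesis using c nrm_pos[OF assms]
    by (intro that[of "inverse c"]) (auto simp: nrm_smult absv_inverse red_pair_def)
qed

lemma nrm_conj_smult: "N D (conj_lift D g (smult t F, smult t G)) = absv t * N D (conj_lift D g (F, G))"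
  unfolding conj_lift_smult by (cases "conj_lift D g (F, G)") (simp add: nrm_smult)

theorem semistable_red_iff:
  assumes F: "degree F \<le> D" and G: "degree G \<le> D" and nz: "(F, G) \<noteq> (0, 0)"
  shows "semistable_red absv red D (F, G) \<longleftrightarrow> (\<forall>h\<in>sl2. N D (F, G) \<le> N D (conj_lift D h (F, G)))"
proof -
  obtain t where t: "t \<noteq> 0" "N D (smult t F, smult t G) = 1"
    "red_pair absv red D (F, G) = map_pair red (smult t F, smult t G)"
    by (rule normalized_multiple[OF assms])
  have deg: "degree (smult t F) \<le> D" "degree (smult t G) \<le> D" using F G degree_smult_le order_trans by blast+
  have deg': "degree (map_poly red (smult t F)) \<le> D" "degree (map_poly red (smult t G)) \<le> D"
    using deg by (auto intro: degree_map_poly_le_bound)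
  have "semistable_red absv red D (F, G) \<longleftrightarrow> \<not> unstable D (map_pair red (smult t F, smult t G))"
    unfolding semistable_red_def t(3) map_prod_simp
    using semistable_imp_not_unstable[OF roots_exist_imp_infinite[OF residue_roots_exist] deg']
      not_unstable_imp_semistable[OF residue_roots_exist deg'] by blast
  also have "\<dots> \<longleftrightarrow> (\<forall>h\<in>sl2. 1 \<le> N D (conj_lift D h (smult t F, smult t G)))"
    using t(2) by (subst unstable_red_iff[OF deg]) (auto simp: not_less)
  also have "\<dots> \<longleftrightarrow> (\<forall>h\<in>sl2. absv t * N D (F, G) \<le> absv t * N D (conj_lift D h (F, G)))"
    using t(2) by (simp add: nrm_conj_smult nrm_smult)
  also have "\<dots> \<longleftrightarrow> (\<forall>h\<in>sl2. N D (F, G) \<le> N D (conj_lift D h (F, G)))"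
    using t(1) by (simp add: mult_le_cancel_left_pos)
  finally show ?thesis .
qed

lemma semistable_red_smult:
  assumes F: "degree F \<le> D" and G: "degree G \<le> D" and nz: "(F, G) \<noteq> (0, 0)" and t: "t \<noteq> 0"
  shows "semistable_red absv red D (smult t F, smult t G) \<longleftrightarrow> semistable_red absv red D (F, G)"
proof -
  have deg: "degree (smult t F) \<le> D" "degree (smult t G) \<le> D" using F G degree_smult_le order_trans by blast+
  have nz': "(smult t F, smult t G) \<noteq> (0, 0)" using nz t by auto
  show ?thesis unfolding semistable_red_iff[OF deg nz'] semistable_red_iff[OF F G nz]
    using t by (simp add: nrm_conj_smult nrm_smult mult_le_cancel_left_pos)
qed

lemma Rlift_smult:
  assumes F: "degree F \<le> D" and G: "degree G \<le> D" and D: "D \<ge> 1" and nz: "bires D D F G \<noteq> 0" and t: "t \<noteq> 0"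
  shows "Rlift absv D (smult t F, smult t G) = Rlift absv D (F, G)"
proof -
  have deg: "degree (smult t F) \<le> D" "degree (smult t G) \<le> D" using F G degree_smult_le order_trans by blast+
  have b: "bires D D (smult t F) (smult t G) = t ^ (2 * D) * bires D D F G" by (rule bires_smult)
  have pos: "N D (F, G) > 0" by (rule nrm_pos[OF F G bires_nz_imp_nonzero[OF D nz]])
  have q: "qv absv > 1" by (rule qv_gt_1)
  have "Rlift absv D (smult t F, smult t G) =
      2 * real D * log (qv absv) (absv t * N D (F, G)) - log (qv absv) (absv t ^ (2 * D) * absv (bires D D F G))"
    using Rlift_eq[OF deg D] b nz t by (simp add: nrm_smult absv_mult absv_power)
  also have "log (qv absv) (absv t * N D (F, G)) = log (qv absv) (absv t) + log (qv absv) (N D (F, G))"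
    using t pos by (subst log_mult) auto
  also have "log (qv absv) (absv t ^ (2 * D) * absv (bires D D F G)) = log (qv absv) (absv t ^ (2 * D)) + log (qv absv) (absv (bires D D F G))"
    using t nz by (subst log_mult) auto
  also have "log (qv absv) (absv t ^ (2 * D)) = real (2 * D) * log (qv absv) (absv t)"
    using t by (intro log_nat_power) auto
  finally show ?thesis using Rlift_eq[OF F G D nz] by (simp add: algebra_simps)
qed

text \<open>Divide by a square root t of the determinant; the scalar t acts on lifts by t^(D +
  1).\<close>

lemma pgl2_decomp:
  fixes g :: "'a \<times> 'a \<times> 'a \<times> 'a"
  assumes "g \<in> pgl2"
  obtains h t where "h \<in> sl2" "t \<noteq> 0"
    "\<And>D F G. conj_lift D g (F, G) = map_prod (smult (t ^ (D + 1))) (smult (t ^ (D + 1))) (conj_lift D h (F, G))"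
proof -
  obtain a b c d where g: "g = (a, b, c, d)" by (cases g)
  have nz: "a * d - b * c \<noteq> 0" using assms by (simp add: g pgl2_def)
  obtain t where t: "t ^ 2 = a * d - b * c" using ex_nth_root[of 2 "a * d - b * c"] by auto
  have t0: "t \<noteq> 0" using t nz by auto
  define h where "h = (a / t, b / t, c / t, d / t)"
  have "a / t * (d / t) - b / t * (c / t) = (a * d - b * c) / t ^ 2"
    using t0 by (simp add: power2_eq_square diff_divide_distrib)
  then have h: "h \<in> sl2" using nz by (simp add: h_def sl2_def t)
  have gh: "g = mmult h (t, 0, 0, t)" using t0 by (simp add: g h_def)
  have "conj_lift D g (F, G) = map_prod (smult (t ^ (D + 1))) (smult (t ^ (D + 1))) (conj_lift D h (F, G))" for D F G
  proof -
    obtain F' G' where FG': "conj_lift D h (F, G) = (F', G')" by (cases "conj_lift D h (F, G)")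
    obtain F2 G2 where FG2: "conj_lift D g (F, G) = (F2, G2)" by (cases "conj_lift D g (F, G)")
    have deg: "degree F' \<le> D" "degree G' \<le> D" "degree F2 \<le> D" "degree G2 \<le> D"
      using degree_conj_lift[of D h "(F, G)"] degree_conj_lift[of D g "(F, G)"] FG' FG2 by auto
    have deg2: "degree (smult (t ^ (D + 1)) F') \<le> D" "degree (smult (t ^ (D + 1)) G') \<le> D"
      using deg degree_smult_le order_trans by blast+
    have co: "coords D (F2, G2) i = coords D (smult (t ^ (D + 1)) F', smult (t ^ (D + 1)) G') i" if i: "i < 2 * D + 2" for i
    proof -
      have e: "xdeg D i + ydeg D i = D + 1" using i by (auto simp: xdeg_def ydeg_def)
      have "coords D (conj_lift D g (F, G)) i = t ^ xdeg D i * t ^ ydeg D i * coords D (F', G') i"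
        unfolding gh conj_lift_mmult[symmetric] coords_conj_diag[OF i] FG' ..
      then show ?thesis unfolding coords_smult e[symmetric] power_add FG2 .
    qed
    show ?thesis using coords_eqD[OF co deg(3,4) deg2] by (simp add: FG' FG2)
  qed
  then show ?thesis using that h t0 by blast
qed

lemma sl2_subset_pgl2: "sl2 \<subseteq> (pgl2 :: ('a \<times> 'a \<times> 'a \<times> 'a) set)"
  by (auto simp: sl2_def pgl2_def)

lemma Rlift_conj_sl2:
  assumes F: "degree F \<le> D" and G: "degree G \<le> D" and D: "D \<ge> 1" and nz: "bires D D F G \<noteq> 0" and h: "h \<in> sl2"
  shows "Rlift absv D (conj_lift D h (F, G)) =
    2 * real D * log (qv absv) (N D (conj_lift D h (F, G))) - log (qv absv) (absv (bires D D F G))"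
    and "N D (conj_lift D h (F, G)) > 0"
proof -
  obtain F' G' where FG': "conj_lift D h (F, G) = (F', G')" by (cases "conj_lift D h (F, G)")
  have deg: "degree F' \<le> D" "degree G' \<le> D" using degree_conj_lift[of D h "(F, G)"] FG' by auto
  have b: "bires D D F' G' = bires D D F G" by (rule bires_conj_lift[OF roots_exist F G h FG'])
  show "Rlift absv D (conj_lift D h (F, G)) =
    2 * real D * log (qv absv) (N D (conj_lift D h (F, G))) - log (qv absv) (absv (bires D D F G))"
    using Rlift_eq[OF deg D] nz b by (simp add: FG')
  show "N D (conj_lift D h (F, G)) > 0"
    unfolding FG' using nz b by (intro nrm_pos[OF deg] bires_nz_imp_nonzero[OF D]) simp
qed

text \<open>On SL2 the resultant is constant, so R is an increasing function of the norm of the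
  conjugate, and general elements of PGL2 only rescale the lift. Minimal R, minimal norm and
  semistable reduction thus coincide.\<close>

theorem minres_sl2:
  assumes F: "degree F \<le> D" and G: "degree G \<le> D" and D: "D \<ge> 2" and nz: "bires D D F G \<noteq> 0" and h: "h \<in> sl2"
  shows "minres absv D (F, G) \<le> Rlift absv D (conj_lift D h (F, G))"
    and "minres absv D (F, G) = Rlift absv D (conj_lift D h (F, G)) \<longleftrightarrow> semistable_red absv red D (conj_lift D h (F, G))"
    and "\<exists>h\<in>sl2. semistable_red absv red D (conj_lift D h (F, G))"
proof -
  have D1: "D \<ge> 1" using D by simp
  have q: "qv absv > 1" by (rule qv_gt_1)
  have ss: "semistable_red absv red D (conj_lift D h (F, G)) \<longleftrightarrow>
      (\<forall>h'\<in>sl2. N D (conj_lift D h (F, G)) \<le> N D (conj_lift D h' (F, G)))" if h: "h \<in> sl2" for h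
  proof -
    obtain F' G' where FG': "conj_lift D h (F, G) = (F', G')" by (cases "conj_lift D h (F, G)")
    have deg: "degree F' \<le> D" "degree G' \<le> D" using degree_conj_lift[of D h "(F, G)"] FG' by auto
    have "bires D D F' G' = bires D D F G" by (rule bires_conj_lift[OF roots_exist F G h FG'])
    then have "(F', G') \<noteq> (0, 0)" using nz by (intro bires_nz_imp_nonzero[OF D1]) simp
    from semistable_red_iff[OF deg this]
    have "semistable_red absv red D (conj_lift D h (F, G)) \<longleftrightarrow>
        (\<forall>k\<in>sl2. N D (conj_lift D h (F, G)) \<le> N D (conj_lift D (mmult h k) (F, G)))"
      by (simp add: FG' flip: conj_lift_mmult)
    also have "\<dots> \<longleftrightarrow> (\<forall>h'\<in>sl2. N D (conj_lift D h (F, G)) \<le> N D (conj_lift D h' (F, G)))"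
    proof -
      \<comment> \<open>The products h k exhaust SL2, so minimality relative to the conjugate by h
        is minimality among all conjugates of (F, G).\<close>
      have "\<exists>k\<in>sl2. h' = mmult h k" if "h' \<in> sl2" for h'
      proof (intro bexI[of _ "mmult (adj2 h) h'"])
        show "h' = mmult h (mmult (adj2 h) h')"
          unfolding mmult_assoc[symmetric] mmult_adj2(1)[OF h] by (cases h') simp
        show "mmult (adj2 h) h' \<in> sl2" using that h by (intro mmult_in_sl2 adj2_in_sl2)
      qed
      then show ?thesis using mmult_in_sl2[OF h] by metis
    qed
    finally show ?thesis .
  qed
  obtain g where g: "g \<in> sl2" "\<And>h. h \<in> sl2 \<Longrightarrow> N D (conj_lift D g (F, G)) \<le> N D (conj_lift D h (F, G))"
    by (rule nrm_conj_attains_min[OF F G D nz]) blast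
  let ?R = "\<lambda>h. Rlift absv D (conj_lift D h (F, G))"
  have R_le: "?R h \<le> ?R h' \<longleftrightarrow> N D (conj_lift D h (F, G)) \<le> N D (conj_lift D h' (F, G))"
    if "h \<in> sl2" "h' \<in> sl2" for h h'
    using Rlift_conj_sl2[OF F G D1 nz that(1)] Rlift_conj_sl2[OF F G D1 nz that(2)] D1 q
    by (simp add: log_le_cancel_iff)
  have min: "?R g \<le> ?R k" if k: "k \<in> pgl2" for k
  proof -
    obtain h t where ht: "h \<in> sl2" "t \<noteq> 0"
      "\<And>D F G. conj_lift D k (F, G) = map_prod (smult (t ^ (D + 1))) (smult (t ^ (D + 1))) (conj_lift D h (F, G))"
      by (rule pgl2_decomp[OF k]) blast
    obtain F' G' where FG': "conj_lift D h (F, G) = (F', G')" by (cases "conj_lift D h (F, G)")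
    have deg: "degree F' \<le> D" "degree G' \<le> D" using degree_conj_lift[of D h "(F, G)"] FG' by auto
    have b: "bires D D F' G' = bires D D F G" by (rule bires_conj_lift[OF roots_exist F G ht(1) FG'])
    have "?R k = Rlift absv D (smult (t ^ (D + 1)) F', smult (t ^ (D + 1)) G')" by (simp add: ht(3) FG')
    also have "\<dots> = ?R h" unfolding FG' using ht(2) nz b by (intro Rlift_smult[OF deg D1]) auto
    finally show ?thesis using R_le[OF g(1) ht(1)] g(2)[OF ht(1)] by simp
  qed
  have g': "g \<in> pgl2" using g(1) sl2_subset_pgl2 by blast
  have minres: "minres absv D (F, G) = ?R g"
  proof (rule antisym)
    show "minres absv D (F, G) \<le> ?R g"
      unfolding minres_def by (rule cINF_lower[OF _ g']) (auto intro!: bdd_belowI[of _ "?R g"] min)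
    show "?R g \<le> minres absv D (F, G)"
      unfolding minres_def using g' min by (intro cINF_greatest) auto
  qed
  show "minres absv D (F, G) \<le> ?R h" unfolding minres using min h sl2_subset_pgl2 by blast
  show "minres absv D (F, G) = ?R h \<longleftrightarrow> semistable_red absv red D (conj_lift D h (F, G))"
    unfolding minres ss[OF h]
  proof
    assume "?R g = ?R h"
    then have "N D (conj_lift D h (F, G)) \<le> N D (conj_lift D g (F, G))" using R_le[OF h g(1)] by simp
    then show "\<forall>h'\<in>sl2. N D (conj_lift D h (F, G)) \<le> N D (conj_lift D h' (F, G))"
      using g(2) order_trans by blast
  next
    assume "\<forall>h'\<in>sl2. N D (conj_lift D h (F, G)) \<le> N D (conj_lift D h' (F, G))"
    then have "?R h \<le> ?R g" using R_le[OF h g(1)] g(1) by blast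
    moreover have "?R g \<le> ?R h" using R_le[OF g(1) h] g(2)[OF h] by blast
    ultimately show "?R g = ?R h" by simp
  qed
  show "\<exists>h\<in>sl2. semistable_red absv red D (conj_lift D h (F, G))"
    using ss[OF g(1)] g by blast
qed

text \<open>For a normalized lift the norm of the n-th iterate is at most 1, with equality for all n
  if and only if the reduction lies outside I(d).\<close>

lemma iterate_Rlift:
  assumes F: "degree F \<le> d" and G: "degree G \<le> d" and d: "d \<ge> 2" and nz: "bires d d F G \<noteq> 0"
  defines "C \<equiv> \<lambda>n. (real (d ^ n) * (real (d ^ n) - 1)) / (real d * (real d - 1))"
  shows "Rlift absv (d ^ n) (iter_lift d (F, G) n) \<le> C n * Rlift absv d (F, G)"
    and "Rlift absv (d ^ 2) (iter_lift d (F, G) 2) = C 2 * Rlift absv d (F, G) \<Longrightarrow> \<not> in_I d (red_pair absv red d (F, G))"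
    and "\<not> in_I d (red_pair absv red d (F, G)) \<Longrightarrow> Rlift absv (d ^ n) (iter_lift d (F, G) n) = C n * Rlift absv d (F, G)"
proof -
  have d1: "d \<ge> 1" using d by simp
  have FG0: "(F, G) \<noteq> (0, 0)" by (rule bires_nz_imp_nonzero[OF d1 nz])
  obtain t where t: "t \<noteq> 0" "N d (smult t F, smult t G) = 1"
    "red_pair absv red d (F, G) = map_pair red (smult t F, smult t G)"
    by (rule normalized_multiple[OF F G FG0])
  let ?F = "smult t F" and ?G = "smult t G"
  have deg: "degree ?F \<le> d" "degree ?G \<le> d" using F G degree_smult_le order_trans by blast+
  have nz': "bires d d ?F ?G \<noteq> 0" using bires_smult[of d t F G] nz t(1) by simp
  let ?v = "(map_poly red ?F, map_poly red ?G)"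
  have degv: "degree (map_poly red ?F) \<le> d" "degree (map_poly red ?G) \<le> d"
    using deg by (auto intro: degree_map_poly_le_bound)
  have in_O: "coeffs_in O_v ?F" "coeffs_in O_v ?G" using coeffs_in_O_v[OF deg] t(2) by auto
  let ?it = "\<lambda>n. iter_lift d (?F, ?G) n"
  have degn: "degree (fst (?it n)) \<le> d ^ n" "degree (snd (?it n)) \<le> d ^ n" for n
    using degree_iter_lift[of d "(?F, ?G)" n] by auto
  have dn1: "d ^ n \<ge> 1" for n using d by simp
  have log_res: "log (qv absv) (absv (bires (d ^ n) (d ^ n) (fst (?it n)) (snd (?it n)))) = C n * log (qv absv) (absv (bires d d ?F ?G))
      \<and> bires (d ^ n) (d ^ n) (fst (?it n)) (snd (?it n)) \<noteq> 0" for n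
  proof -
    obtain e where e: "bires (d ^ n) (d ^ n) (fst (?it n)) (snd (?it n)) = bires d d ?F ?G ^ e"
      "e * (d * (d - 1)) = d ^ n * (d ^ n - 1)" using bires_iter_lift[OF roots_exist deg, of n] by blast
    have "real e * (real d * (real d - 1)) = real (d ^ n) * (real (d ^ n) - 1)"
      using arg_cong[OF e(2), of real] d1 dn1[of n] by (simp add: of_nat_diff)
    then have "real e = C n" unfolding C_def using d by (simp add: field_simps)
    moreover have "log (qv absv) (absv (bires d d ?F ?G ^ e)) = real e * log (qv absv) (absv (bires d d ?F ?G))"
      unfolding absv_power using nz' by (intro log_nat_power) auto
    ultimately show ?thesis using e(1) nz' by simp
  qed
  have R1: "Rlift absv d (F, G) = - log (qv absv) (absv (bires d d ?F ?G))"
    using Rlift_eq[OF deg d1 nz'] Rlift_smult[OF F G d1 nz t(1)] t(2) by simp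
  \<comment> \<open>An exact formula: the only deviation from C n times the original value is the
    norm of the iterate of the normalized lift.\<close>
  have Rn: "Rlift absv (d ^ n) (iter_lift d (F, G) n) = 2 * real (d ^ n) * log (qv absv) (N (d ^ n) (?it n)) + C n * Rlift absv d (F, G)" for n
  proof -
    obtain r where r: "r \<noteq> 0" "?it n = map_prod (smult r) (smult r) (iter_lift d (F, G) n)"
      using iter_lift_smult[OF t(1)] by blast
    obtain A B where AB: "iter_lift d (F, G) n = (A, B)" by (cases "iter_lift d (F, G) n")
    have degAB: "degree A \<le> d ^ n" "degree B \<le> d ^ n" using degree_iter_lift[of d "(F, G)" n] AB by auto
    have b: "bires (d ^ n) (d ^ n) A B \<noteq> 0"
      using log_res[of n] bires_smult[of "d ^ n" r A B] r(2) AB by auto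
    have "Rlift absv (d ^ n) (iter_lift d (F, G) n) = Rlift absv (d ^ n) (?it n)"
      using Rlift_smult[OF degAB dn1 b r(1)] r(2) AB by simp
    also have "\<dots> = 2 * real (d ^ n) * log (qv absv) (N (d ^ n) (?it n)) - C n * log (qv absv) (absv (bires d d ?F ?G))"
      using Rlift_eq[OF degn[of n] dn1] log_res[of n] by simp
    finally show ?thesis using R1 by simp
  qed
  have Npos: "N (d ^ n) (?it n) > 0" for n
  proof -
    obtain A B where AB: "?it n = (A, B)" by (cases "?it n")
    have "(A, B) \<noteq> (0, 0)" by (rule bires_nz_imp_nonzero[OF dn1[of n]]) (use log_res[of n] AB in auto)
    then show ?thesis using nrm_pos[of A "d ^ n" B] degn[of n] AB by auto
  qed
  have red_it: "map_pair red (?it n) = iter_lift d ?v n" for n by (rule red.map_pair_iter_lift[OF in_O])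
  have N_le: "N (d ^ n) (?it n) \<le> 1" for n
    using red.coeffs_in_iter_lift[OF in_O, of d n] unfolding nrm_le_iff
    by (auto simp: coords_def coeffs_in_def O_v_def)
  have N_eq: "N (d ^ n) (?it n) = 1 \<longleftrightarrow> iter_lift d ?v n \<noteq> (0, 0)" for n
  proof
    assume "N (d ^ n) (?it n) = 1"
    then obtain i where "i < 2 * d ^ n + 2" "absv (coords (d ^ n) (?it n) i) = 1" using nrm_attained[of "d ^ n" "?it n"] by auto
    then have "red (coords (d ^ n) (?it n) i) \<noteq> 0" by (simp add: red_eq_0_iff)
    then have "coords (d ^ n) (iter_lift d ?v n) i \<noteq> 0" by (simp add: red_it[symmetric] red.coords_map_pair)
    moreover have "coords (d ^ n) (0, 0) i = (0 :: 'k)" by (simp add: coords_def)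
    ultimately show "iter_lift d ?v n \<noteq> (0, 0)" by metis
  next
    assume v0: "iter_lift d ?v n \<noteq> (0, 0)"
    show "N (d ^ n) (?it n) = 1"
    proof (rule ccontr)
      assume "N (d ^ n) (?it n) \<noteq> 1"
      then have "N (d ^ n) (?it n) < 1" using N_le[of n] by linarith
      then have "coords (d ^ n) (iter_lift d ?v n) i = 0" if "i < 2 * d ^ n + 2" for i
        using that unfolding nrm_less_iff by (simp add: red_it[symmetric] red.coords_map_pair red_eq_0_iff less_imp_le)
      moreover obtain P Q where PQ: "iter_lift d ?v n = (P, Q)" by (cases "iter_lift d ?v n")
      moreover have "degree P \<le> d ^ n" "degree Q \<le> d ^ n" using degree_iter_lift[of d ?v n] PQ by auto
      ultimately have "P = 0" "Q = 0"
        by (intro coords_eqD[of "d ^ n" P Q 0 0]; simp add: coords_def[of _ "(0, 0)"])+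
      then show False using v0 PQ by simp
    qed
  qed
  have dpos: "real (d ^ n) > 0" for n using d by simp
  have log_le: "log (qv absv) (N (d ^ n) (?it n)) \<le> 0" for n
    using N_le[of n] Npos[of n] qv_gt_1 by (subst log_le_zero_cancel_iff) auto
  show "Rlift absv (d ^ n) (iter_lift d (F, G) n) \<le> C n * Rlift absv d (F, G)"
    unfolding Rn using log_le[of n] dpos[of n] by (simp add: mult_nonneg_nonpos)
  show "\<not> in_I d (red_pair absv red d (F, G))" if eq: "Rlift absv (d ^ 2) (iter_lift d (F, G) 2) = C 2 * Rlift absv d (F, G)"
  proof
    assume "in_I d (red_pair absv red d (F, G))"
    then have "iter_lift d ?v 2 = (0, 0)" using degv unfolding t(3) by (intro in_I_imp_iter_lift_zero) auto
    then have "N (d ^ 2) (?it 2) \<noteq> 1" using N_eq[of 2] by blast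
    then have "N (d ^ 2) (?it 2) < 1" using N_le[of 2] by linarith
    then have "log (qv absv) (N (d ^ 2) (?it 2)) < 0"
      using Npos[of 2] qv_gt_1 by (subst log_less_zero_cancel_iff) auto
    then have "2 * real (d ^ 2) * log (qv absv) (N (d ^ 2) (?it 2)) < 0" using dpos[of 2] by (intro mult_pos_neg) auto
    then show False using eq Rn[of 2] by linarith
  qed
  show "Rlift absv (d ^ n) (iter_lift d (F, G) n) = C n * Rlift absv d (F, G)" if "\<not> in_I d (red_pair absv red d (F, G))"
  proof -
    have "\<not> in_I d ?v" using that t(3) by simp
    then have "iter_lift d ?v n \<noteq> (0, 0)" by (rule not_in_I_imp_iter_lift_nonzero[OF residue_roots_exist degv])
    then have "N (d ^ n) (?it n) = 1" using N_eq by blast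
    then show ?thesis unfolding Rn by simp
  qed
qed

text \<open>The two normalizations may divide by different coefficients, so the reductions agree
  only up to the reduction of a unit u.\<close>

lemma in_I_red_pair_smult:
  assumes F: "degree F \<le> D" and G: "degree G \<le> D" and nz: "(F, G) \<noteq> (0, 0)" and t: "t \<noteq> 0"
    and I: "in_I D (red_pair absv red D (smult t F, smult t G))"
  shows "in_I D (red_pair absv red D (F, G))"
proof -
  have deg: "degree (smult t F) \<le> D" "degree (smult t G) \<le> D" using F G degree_smult_le order_trans by blast+
  have nz': "(smult t F, smult t G) \<noteq> (0, 0)" using nz t by auto
  obtain s where s: "s \<noteq> 0" "N D (smult s F, smult s G) = 1"
    "red_pair absv red D (F, G) = map_pair red (smult s F, smult s G)"
    by (rule normalized_multiple[OF F G nz])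
  obtain r where r: "r \<noteq> 0" "N D (smult r (smult t F), smult r (smult t G)) = 1"
    "red_pair absv red D (smult t F, smult t G) = map_pair red (smult r (smult t F), smult r (smult t G))"
    by (rule normalized_multiple[OF deg nz'])
  define u where "u = s / (r * t)"
  have "absv s * N D (F, G) = absv (r * t) * N D (F, G)" using s(2) r(2) by (simp add: nrm_smult absv_mult)
  then have "absv u = 1" using nrm_pos[OF F G nz] r(1) t by (simp add: u_def absv_divide)
  then have u: "u \<in> O_v" by (simp add: O_v_def)
  let ?F = "smult r (smult t F)" and ?G = "smult r (smult t G)"
  have deg2: "degree ?F \<le> D" "degree ?G \<le> D" using deg degree_smult_le order_trans by blast+
  note in_O = coeffs_in_O_v[OF deg2 eq_refl[OF r(2)]]
  have e: "smult s F = smult u ?F" "smult s G = smult u ?G" using r(1) t by (simp_all add: u_def)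
  have "red_pair absv red D (F, G) = (smult (red u) (map_poly red ?F), smult (red u) (map_poly red ?G))"
    unfolding s(3) e using red.map_poly_hom_smult[OF u in_O(1)] red.map_poly_hom_smult[OF u in_O(2)] by (simp del: smult_smult)
  then show ?thesis using in_I_smult[of D "map_poly red ?F" "map_poly red ?G" "red u"] I unfolding r(3) by (simp del: smult_smult)
qed

end

theorem theorem3p1:
  fixes absv :: "'a::field \<Rightarrow> real" and red :: "'a \<Rightarrow> 'k::field"
    and d :: nat and F G :: "'a poly"
  assumes "nonarch_complete_algclosed absv"
    and "residue_map absv red"
    and "d \<ge> 2"
    and "degree F \<le> d" and "degree G \<le> d" and "bform_coprime d F G"
  shows "(\<forall>n\<ge>1. minres absv (d ^ n) (iter_lift d (F, G) n)
              = (real (d ^ n) * (real (d ^ n) - 1)) / (real d * (real d - 1)) * minres absv d (F, G))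
     \<longleftrightarrow>
     (\<forall>g\<in>pgl2. semistable_red absv red d (conj_lift d g (F, G)) \<longrightarrow>
        \<not> in_I d (red_pair absv red d (conj_lift d g (F, G))) \<and>
        (\<forall>n\<ge>1. semistable_red absv red (d ^ n) (iter_lift d (conj_lift d g (F, G)) n)))"
proof -
  interpret valued_field absv red using assms(1,2) by unfold_locales
  note d = assms(3) and F = assms(4) and G = assms(5)
  have d1: "d \<ge> 1" using d by simp
  have nz: "bires d d F G \<noteq> 0" by (rule bform_coprime_imp_bires_nz[OF roots_exist F G d1 assms(6)])
  define C where "C = (\<lambda>n. (real (d ^ n) * (real (d ^ n) - 1)) / (real d * (real d - 1)))"
  let ?R = "\<lambda>n h. Rlift absv (d ^ n) (iter_lift d (conj_lift d h (F, G)) n)"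
  have iter: "minres absv (d ^ n) (iter_lift d (F, G) n) \<le> ?R n h"
    "minres absv (d ^ n) (iter_lift d (F, G) n) = ?R n h \<longleftrightarrow>
      semistable_red absv red (d ^ n) (iter_lift d (conj_lift d h (F, G)) n)"
    if n: "n \<ge> 1" and h: "h \<in> sl2" for n h
  proof -
    obtain A B where AB: "iter_lift d (F, G) n = (A, B)" by (cases "iter_lift d (F, G) n")
    have deg: "degree A \<le> d ^ n" "degree B \<le> d ^ n" using degree_iter_lift[of d "(F, G)" n] AB by auto
    obtain e where "bires (d ^ n) (d ^ n) A B = bires d d F G ^ e"
      using bires_iter_lift[OF roots_exist F G, of n] AB by auto
    then have nzn: "bires (d ^ n) (d ^ n) A B \<noteq> 0" using nz by simp
    have "d ^ 1 \<le> d ^ n" using n d by (intro power_increasing) auto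
    then have dn: "d ^ n \<ge> 2" using d by simp
    have c: "iter_lift d (conj_lift d h (F, G)) n = conj_lift (d ^ n) h (A, B)"
      using iter_lift_conj[OF h, of d F G n] AB by simp
    show "minres absv (d ^ n) (iter_lift d (F, G) n) \<le> ?R n h"
      unfolding c AB by (rule minres_sl2(1)[OF deg dn nzn h])
    show "minres absv (d ^ n) (iter_lift d (F, G) n) = ?R n h \<longleftrightarrow>
        semistable_red absv red (d ^ n) (iter_lift d (conj_lift d h (F, G)) n)"
      unfolding c AB by (rule minres_sl2(2)[OF deg dn nzn h])
  qed
  have conj: "\<exists>F' G'. conj_lift d h (F, G) = (F', G') \<and> degree F' \<le> d \<and> degree G' \<le> d \<and> bires d d F' G' \<noteq> 0"
    if h: "h \<in> sl2" for h
  proof -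
    obtain F' G' where FG': "conj_lift d h (F, G) = (F', G')" by (cases "conj_lift d h (F, G)")
    then show ?thesis using degree_conj_lift[of d h "(F, G)"] bires_conj_lift[OF roots_exist F G h FG'] nz by auto
  qed
  show ?thesis
    unfolding C_def[symmetric, THEN fun_cong]
  proof
    assume i: "\<forall>n\<ge>1. minres absv (d ^ n) (iter_lift d (F, G) n) = C n * minres absv d (F, G)"
    show "\<forall>g\<in>pgl2. semistable_red absv red d (conj_lift d g (F, G)) \<longrightarrow>
        \<not> in_I d (red_pair absv red d (conj_lift d g (F, G))) \<and>
        (\<forall>n\<ge>1. semistable_red absv red (d ^ n) (iter_lift d (conj_lift d g (F, G)) n))"
    proof (intro ballI impI)
      fix g :: "'a \<times> 'a \<times> 'a \<times> 'a" assume g: "g \<in> pgl2" and ss: "semistable_red absv red d (conj_lift d g (F, G))"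
      obtain h t where h: "h \<in> sl2" and t: "t \<noteq> 0"
        and ht: "\<And>D F G. conj_lift D g (F, G) = map_prod (smult (t ^ (D + 1))) (smult (t ^ (D + 1))) (conj_lift D h (F, G))"
        by (rule pgl2_decomp[OF g]) blast
      obtain F' G' where FG': "conj_lift d h (F, G) = (F', G')" and deg: "degree F' \<le> d" "degree G' \<le> d" and nz': "bires d d F' G' \<noteq> 0"
        using conj[OF h] by blast
      let ?t = "t ^ (d + 1)"
      have t0: "?t \<noteq> 0" using t by simp
      have FG0: "(F', G') \<noteq> (0, 0)" by (rule bires_nz_imp_nonzero[OF d1 nz'])
      have gF: "conj_lift d g (F, G) = (smult ?t F', smult ?t G')" by (simp add: ht FG')
      have "semistable_red absv red d (conj_lift d h (F, G))"
        using ss unfolding gF FG' semistable_red_smult[OF deg FG0 t0] .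
      then have min: "minres absv d (F, G) = Rlift absv d (F', G')"
        using minres_sl2(2)[OF F G d nz h] by (simp add: FG')
      \<comment> \<open>The squeeze: the assumed formula makes the two ends equal, so the iterate of
        this conjugate attains both bounds.\<close>
      have eq: "minres absv (d ^ n) (iter_lift d (F, G) n) = ?R n h \<and> ?R n h = C n * Rlift absv d (F', G')" if n: "n \<ge> 1" for n
      proof -
        have "?R n h \<le> C n * Rlift absv d (F', G')"
          unfolding FG' C_def by (rule iterate_Rlift(1)[OF deg d nz'])
        moreover have "minres absv (d ^ n) (iter_lift d (F, G) n) \<le> ?R n h" by (rule iter(1)[OF n h])
        moreover have "minres absv (d ^ n) (iter_lift d (F, G) n) = C n * Rlift absv d (F', G')" using i n min by simp
        ultimately show ?thesis by linarith
      qed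
      have "\<not> in_I d (red_pair absv red d (F', G'))"
        using eq[of 2] iterate_Rlift(2)[OF deg d nz'] by (simp add: FG' C_def)
      then have "\<not> in_I d (red_pair absv red d (conj_lift d g (F, G)))"
        unfolding gF using in_I_red_pair_smult[OF deg FG0 t0] by blast
      moreover have "semistable_red absv red (d ^ n) (iter_lift d (conj_lift d g (F, G)) n)" if n: "n \<ge> 1" for n
      proof -
        have ssn: "semistable_red absv red (d ^ n) (iter_lift d (F', G') n)"
          using iter(2)[OF n h] eq[OF n] by (simp add: FG')
        obtain r where r: "r \<noteq> 0" "iter_lift d (smult ?t F', smult ?t G') n = map_prod (smult r) (smult r) (iter_lift d (F', G') n)"
          using iter_lift_smult[OF t0] by blast
        obtain A B where AB: "iter_lift d (F', G') n = (A, B)" by (cases "iter_lift d (F', G') n")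
        have degAB: "degree A \<le> d ^ n" "degree B \<le> d ^ n" using degree_iter_lift[of d "(F', G')" n] AB by auto
        obtain e where "bires (d ^ n) (d ^ n) A B = bires d d F' G' ^ e"
          using bires_iter_lift[OF roots_exist deg, of n] AB by auto
        then have "(A, B) \<noteq> (0, 0)" using nz' d by (intro bires_nz_imp_nonzero[of "d ^ n"]) auto
        then show ?thesis unfolding gF r(2) AB using ssn semistable_red_smult[OF degAB _ r(1)] by (simp add: AB)
      qed
      ultimately show "\<not> in_I d (red_pair absv red d (conj_lift d g (F, G))) \<and>
          (\<forall>n\<ge>1. semistable_red absv red (d ^ n) (iter_lift d (conj_lift d g (F, G)) n))" by blast
    qed
  next
    assume ii: "\<forall>g\<in>pgl2. semistable_red absv red d (conj_lift d g (F, G)) \<longrightarrow>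
        \<not> in_I d (red_pair absv red d (conj_lift d g (F, G))) \<and>
        (\<forall>n\<ge>1. semistable_red absv red (d ^ n) (iter_lift d (conj_lift d g (F, G)) n))"
    \<comment> \<open>One semistable conjugate suffices in this direction, and it exists because the
      minimum is attained.\<close>
    obtain h where h: "h \<in> sl2" and ss: "semistable_red absv red d (conj_lift d h (F, G))"
      using minres_sl2(3)[OF F G d nz, of "(1, 0, 0, 1)"] by (auto simp: sl2_def)
    then have notI: "\<not> in_I d (red_pair absv red d (conj_lift d h (F, G)))"
      and ssn: "\<And>n. n \<ge> 1 \<Longrightarrow> semistable_red absv red (d ^ n) (iter_lift d (conj_lift d h (F, G)) n)"
      using ii sl2_subset_pgl2 by blast+
    obtain F' G' where FG': "conj_lift d h (F, G) = (F', G')" and deg: "degree F' \<le> d" "degree G' \<le> d" and nz': "bires d d F' G' \<noteq> 0"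
      using conj[OF h] by blast
    have min: "minres absv d (F, G) = Rlift absv d (F', G')"
      using minres_sl2(2)[OF F G d nz h] ss by (simp add: FG')
    show "\<forall>n\<ge>1. minres absv (d ^ n) (iter_lift d (F, G) n) = C n * minres absv d (F, G)"
    proof (intro allI impI)
      fix n :: nat assume n: "n \<ge> 1"
      have "minres absv (d ^ n) (iter_lift d (F, G) n) = ?R n h" using iter(2)[OF n h] ssn[OF n] by simp
      also have "\<dots> = C n * Rlift absv d (F', G')"
        using iterate_Rlift(3)[OF deg d nz', of n] notI by (simp add: FG' C_def)
      finally show "minres absv (d ^ n) (iter_lift d (F, G) n) = C n * minres absv d (F, G)" by (simp add: min)
    qed
  qed
qed

end
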